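(* It holds that $$\sup_{\delta\in\mathcal A}J(\delta)=Y_0(0,0)=\lim_{n\to\infty}Y_0^n(0,0)=\lim_{n\to\infty}\sup_{\delta\in\mathcal A_n}J(\delta).$$
   Context: Setting. $T>0$; $(\Omega,\mathcal F,\mathbb P)$ is a probability space carrying a standard $d$-dimensional Brownian motion $B=(B_t)_{0\le t\le T}$; $(\mathcal F_t)_{0\le t\le T}$ is the natural filtration of $B$ completed with the $\mathbb P$-null sets of $\mathcal F$; $\mathscr P$ is the $\sigma$-algebra of $\mathcal F_t$-progressively measurable sets on $[0,T]\times\Omega$. $\mathcal H^{2,d}$: $\mathscr P$-measurable $\mathbb R^d$-valued $v$ with $\mathbb E\int_0^T|v_s|^2ds<\infty$. $\mathcal S_c^2$: continuous $\mathscr P$-measurable real processes $Y$ with $\mathbb E[\sup_{t\le T}|Y_t|^2]<\infty$. $\mathcal S_{c,i}^2$: non-decreasing $k\in\mathcal S_c^2$ with $k_0=0$. $L=(L_t)_{0\le t\le T}$ is a $\mathscr P$-measurable $\mathbb R^l$-valued process with $\mathbb E\int_0^T|L_s|^2ds<\infty$. $U\subset\mathbb R^l$ is a finite (nonempty) set. Assumption (A): $h:[0,T]\times\Omega\times\mathbb R^l\to[0,\infty)$ is $\mathscr P\otimes\mathcal B(\mathbb R^l)$-measurable with $0\le h\le\gamma$ for a constant $\gamma$; $\psi:U\to[0,\infty)$ satisfies $\inf_{\beta\in U}\psi(\beta)\ge c$ for a constant $c>0$. Strategies. $\mathcal A$ is the set of sequences $\delta=(\tau_n,\xi_n)_{n\ge0}$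 where $(\tau_n)$ are $\mathcal F_t$-stopping times with $0\le\tau_0\le\tau_1\le\dots\le T$ a.s. and each $\xi_n$ is a $U$-valued $\mathcal F_{\tau_n}$-measurable random variable. $\mathcal D$ is the set of $\delta\in\mathcal A$ with $\mathbb P(\tau_n<T \text{ for all } n\ge0)=0$. For $n\ge 1$, $\mathcal A_n=\{(\tau_m,\xi_m)_{m\ge0}\in\mathcal D:\ \tau_n=T\ \mathbb P\text{-a.s.}\}$. The controlled process is $L^\delta_t=L_t+\sum_{n\ge0}\xi_n\mathbf 1_{[\tau_n\le t]}$ and the reward is $J(\delta)=\mathbb E\big[\int_0^Th(s,L^\delta_s)ds-\sum_{n\ge0}\psi(\xi_n)\mathbf 1_{[\tau_n<T]}\big]$; if $\mathbb P(\tau_n<T\ \forall n)>0$ then $J(\delta)=-\infty$, because $h$ is bounded and $\psi\ge c$. Approximating processes and their limit. For a stopping time $\nu$ with values in $[0,T]$ and an $\mathcal F_\nu$-measurable $\mathbb R^l$-valued random variable $\xi$, $(Y^0(\nu,\xi),Z^0(\nu,\xi))\in\mathcal S_c^2\times\mathcal H^{2,d}$ is the unique solution of $$Y^0_t(\nu,\xi)=\int_t^Th(s,L_s+\xi)\mathbf 1_{[s\ge\nu]}ds-\int_t^TZ^0_s(\nu,\xi)dB_s,\quad 0\le t\le T,$$ and, recursively for $n\ge1$, $(Y^n(\nu,\xi),Z^n(\nu,\xi),K^n(\nu,\xi))\in\mathcal S_c^2\times\mathcal H^{2,d}\times\mathcal S_{c,i}^2$ is the unique solution of the reflected BSDE $$Y^n_t(\nu,\xi)=\int_t^Th(s,L_s+\xi)\mathbf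 1_{[s\ge\nu]}ds+K^n_T(\nu,\xi)-K^n_t(\nu,\xi)-\int_t^TZ^n_s(\nu,\xi)dB_s,$$ $$Y^n_t(\nu,\xi)\ge O^n_t(\nu,\xi):=\max_{\beta\in U}\{-\psi(\beta)+Y^{n-1}_t(\nu,\xi+\beta)\},\quad \int_0^T(Y^n_t(\nu,\xi)-O^n_t(\nu,\xi))dK^n_t(\nu,\xi)=0,\quad 0\le t\le T.$$ The sequence $(Y^n(\nu,\xi))_n$ is non-decreasing in $n$ with $0\le Y^n_t(\nu,\xi)\le\gamma(T-t)$; $Y_t(\nu,\xi):=\lim_{n\to\infty}Y^n_t(\nu,\xi)$. $Y_0(0,0)$ and $Y_0^n(0,0)$ are the values at time $0$ for $\nu=0$, $\xi=0$. *)

theory Defs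
  imports "HOL-Probability.Probability"
begin

section \<open>Brownian motion and its completed natural filtration\<close>

definition standard_brownian_motion ::
  "'a measure \<Rightarrow> real \<Rightarrow> (real \<Rightarrow> 'a \<Rightarrow> real ^ 'd) \<Rightarrow> bool"
where
  "standard_brownian_motion M T B \<longleftrightarrow>
     (\<forall>t\<in>{0..T}. B t \<in> borel_measurable M) \<and>
     (AE \<omega> in M. B 0 \<omega> = 0) \<and>
     (AE \<omega> in M. continuous_on {0..T} (\<lambda>t. B t \<omega>)) \<and>
     (\<forall>s t. 0 \<le> s \<and> s < t \<and> t \<le> T \<longrightarrow>
        distributed M lborel (\<lambda>\<omega>. B t \<omega> - B s \<omega>)
          (\<lambda>x. ennreal (\<Prod>i\<in>UNIV. normal_density 0 (sqrt (t - s)) (x $ i)))) \<and>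
     (\<forall>(n::nat) p. 0 \<le> p 0 \<and> (\<forall>i<n. p i \<le> p (Suc i)) \<and> p n \<le> T \<longrightarrow>
        prob_space.indep_vars M (\<lambda>_. borel) (\<lambda>i \<omega>. B (p (Suc i)) \<omega> - B (p i) \<omega>) {..<n})"

text \<open>The filtration is indexed by all reals, as the library's notions of filtration and stopping
  time require: before time 0 it only contains the null sets and their complements, and after
  \<open>T\<close> it is constant.\<close>

definition brownian_filtration ::
  "'a measure \<Rightarrow> real \<Rightarrow> (real \<Rightarrow> 'a \<Rightarrow> real ^ 'd) \<Rightarrow> real \<Rightarrow> 'a measure"
where
  "brownian_filtration M T B t =
     sigma (space M)
       ({B s -` A \<inter> space M | s A. 0 \<le> s \<and> s \<le> min t T \<and> A \<in> sets borel} \<union> null_sets M)"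

lemma brownian_filtration_gen_subset:
  "{B s -` A \<inter> space M | s A. 0 \<le> s \<and> s \<le> min t T \<and> A \<in> sets borel} \<union> null_sets M
     \<subseteq> Pow (space M)"
  using sets.sets_into_space by (fastforce simp: null_sets_def)

lemma filtration_brownian_filtration: "filtration (space M) (brownian_filtration M T B)"
proof
  show "space (brownian_filtration M T B i) = space M" for i
    unfolding brownian_filtration_def
    by (rule space_measure_of) (rule brownian_filtration_gen_subset)
next
  fix i j :: real
  assume "i \<le> j"
  then show "sets (brownian_filtration M T B i) \<subseteq> sets (brownian_filtration M T B j)"
    unfolding brownian_filtration_def
      sets_measure_of[OF brownian_filtration_gen_subset]
    by (intro sigma_sets_mono') fastforce
qed

abbreviation stopped_sigma ::
  "'a measure \<Rightarrow> real \<Rightarrow> (real \<Rightarrow> 'a \<Rightarrow> real ^ 'd) \<Rightarrow> ('a \<Rightarrow> real) \<Rightarrow> 'a measure"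
where
  "stopped_sigma M T B \<nu> \<equiv> filtration.pre_sigma (space M) (brownian_filtration M T B) \<nu>"

definition progressive_sigma ::
  "'a measure \<Rightarrow> real \<Rightarrow> (real \<Rightarrow> 'a \<Rightarrow> real ^ 'd) \<Rightarrow> (real \<times> 'a) measure"
where
  "progressive_sigma M T B =
     sigma ({0..T} \<times> space M)
       {A. A \<subseteq> {0..T} \<times> space M \<and>
           (\<forall>t\<in>{0..T}. A \<inter> ({0..t} \<times> space M)
              \<in> sets (restrict_space borel {0..t} \<Otimes>\<^sub>M brownian_filtration M T B t))}"

lemma sets_progressive_sigma:
  "sets (progressive_sigma M T B) =
     {A. A \<subseteq> {0..T} \<times> space M \<and>
         (\<forall>t\<in>{0..T}. A \<inter> ({0..t} \<times> space M)
            \<in> sets (restrict_space borel {0..t} \<Otimes>\<^sub>M brownian_filtration M T B t))}"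
  (is "_ = ?S")
proof -
  interpret F: filtration "space M" "brownian_filtration M T B"
    by (rule filtration_brownian_filtration)
  let ?P = "\<lambda>t. restrict_space borel {0..t} \<Otimes>\<^sub>M brownian_filtration M T B t"
  have sp: "space (?P t) = {0..t} \<times> space M" for t
    by (simp add: space_pair_measure space_restrict_space F.space_F)
  have "sigma_algebra ({0..T} \<times> space M) ?S"
    unfolding sigma_algebra_iff2
  proof (intro conjI ballI allI impI)
    fix A assume A: "A \<in> ?S"
    show "{0..T} \<times> space M - A \<in> ?S"
    proof (intro CollectI conjI ballI)
      fix t assume t: "t \<in> {0..T}"
      have "({0..T} \<times> space M - A) \<inter> ({0..t} \<times> space M) = space (?P t) - A \<inter> ({0..t} \<times> space M)"
        using t by (auto simp: sp)
      then show "({0..T} \<times> space M - A) \<inter> ({0..t} \<times> space M) \<in> sets (?P t)"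
        using A t by auto
    qed auto
  next
    fix A :: "nat \<Rightarrow> (real \<times> 'a) set" assume A: "range A \<subseteq> ?S"
    have "(\<Union>i. A i) \<inter> ({0..t} \<times> space M) \<in> sets (?P t)" if "t \<in> {0..T}" for t
    proof -
      have "(\<Union>i. A i \<inter> ({0..t} \<times> space M)) \<in> sets (?P t)"
        using A that by (intro sets.countable_UN) auto
      then show ?thesis
        by (simp add: Int_UN_distrib2)
    qed
    then show "\<Union>(range A) \<in> ?S"
      using A by blast
  qed auto
  then show ?thesis
    unfolding progressive_sigma_def by (rule sigma_algebra.sets_measure_of_eq)
qed

section \<open>Spaces of processes\<close>

definition H2_process ::
  "'a measure \<Rightarrow> real \<Rightarrow> (real \<Rightarrow> 'a \<Rightarrow> real ^ 'd) \<Rightarrow> (real \<Rightarrow> 'a \<Rightarrow> 'b::euclidean_space) \<Rightarrow> bool"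
where
  "H2_process M T B v \<longleftrightarrow>
     (\<lambda>(s, \<omega>). v s \<omega>) \<in> borel_measurable (progressive_sigma M T B) \<and>
     (\<integral>\<^sup>+\<omega>. (\<integral>\<^sup>+s\<in>{0..T}. ennreal ((norm (v s \<omega>))\<^sup>2) \<partial>lborel) \<partial>M) < \<infinity>"

definition Sc2_process ::
  "'a measure \<Rightarrow> real \<Rightarrow> (real \<Rightarrow> 'a \<Rightarrow> real ^ 'd) \<Rightarrow> (real \<Rightarrow> 'a \<Rightarrow> real) \<Rightarrow> bool"
where
  "Sc2_process M T B Y \<longleftrightarrow>
     (\<lambda>(s, \<omega>). Y s \<omega>) \<in> borel_measurable (progressive_sigma M T B) \<and>
     (\<forall>\<omega>\<in>space M. continuous_on {0..T} (\<lambda>t. Y t \<omega>)) \<and>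
     (\<integral>\<^sup>+\<omega>. (SUP t\<in>{0..T}. ennreal (\<bar>Y t \<omega>\<bar>\<^sup>2)) \<partial>M) < \<infinity>"

definition Sci2_process ::
  "'a measure \<Rightarrow> real \<Rightarrow> (real \<Rightarrow> 'a \<Rightarrow> real ^ 'd) \<Rightarrow> (real \<Rightarrow> 'a \<Rightarrow> real) \<Rightarrow> bool"
where
  "Sci2_process M T B k \<longleftrightarrow>
     Sc2_process M T B k \<and>
     (\<forall>\<omega>\<in>space M. mono_on {0..T} (\<lambda>t. k t \<omega>) \<and> k 0 \<omega> = 0)"

section \<open>The It\^o integral\<close>

text \<open>A triple \<open>(n, p, \<zeta>)\<close> encodes the simple process
  \<open>\<Sum>i<n. \<zeta> i\<close> on \<open>(p i, p (i+1)]\<close>, whose coefficients are bounded and \<open>\<F>\<close>-measurable at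
  time \<open>p i\<close>. The stochastic integral of \<open>Z\<close> is the continuous process which is, at every time,
  the limit in mean square of the integrals of simple processes tending to \<open>Z\<close> in mean square;
  it is unique up to indistinguishability, hence a relation.\<close>

type_synonym ('a, 'd) simple_integrand = "nat \<times> (nat \<Rightarrow> real) \<times> (nat \<Rightarrow> 'a \<Rightarrow> real ^ 'd)"

fun simple_integrand ::
  "'a measure \<Rightarrow> real \<Rightarrow> (real \<Rightarrow> 'a \<Rightarrow> real ^ 'd) \<Rightarrow> ('a, 'd) simple_integrand \<Rightarrow> bool"
where
  "simple_integrand M T B (n, p, \<zeta>) \<longleftrightarrow>
     0 \<le> p 0 \<and> (\<forall>i<n. p i \<le> p (Suc i)) \<and> p n \<le> T \<and>
     (\<forall>i<n. \<zeta> i \<in> borel_measurable (brownian_filtration M T B (p i)) \<and>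
            (\<exists>C. \<forall>\<omega>\<in>space M. norm (\<zeta> i \<omega>) \<le> C))"

fun simple_value :: "('a, 'd) simple_integrand \<Rightarrow> real \<Rightarrow> 'a \<Rightarrow> real ^ 'd"
where
  "simple_value (n, p, \<zeta>) s \<omega> = (\<Sum>i<n. indicat_real {p i<..p (Suc i)} s *\<^sub>R \<zeta> i \<omega>)"

fun simple_integral ::
  "(real \<Rightarrow> 'a \<Rightarrow> real ^ 'd) \<Rightarrow> ('a, 'd) simple_integrand \<Rightarrow> real \<Rightarrow> 'a \<Rightarrow> real"
where
  "simple_integral B (n, p, \<zeta>) t \<omega> =
     (\<Sum>i<n. \<zeta> i \<omega> \<bullet> (B (min (p (Suc i)) t) \<omega> - B (min (p i) t) \<omega>))"

definition ito_integral ::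
  "'a measure \<Rightarrow> real \<Rightarrow> (real \<Rightarrow> 'a \<Rightarrow> real ^ 'd) \<Rightarrow> (real \<Rightarrow> 'a \<Rightarrow> real ^ 'd) \<Rightarrow>
   (real \<Rightarrow> 'a \<Rightarrow> real) \<Rightarrow> bool"
where
  "ito_integral M T B Z I \<longleftrightarrow>
     (\<lambda>(s, \<omega>). I s \<omega>) \<in> borel_measurable (progressive_sigma M T B) \<and>
     (\<forall>\<omega>\<in>space M. continuous_on {0..T} (\<lambda>t. I t \<omega>)) \<and>
     (\<exists>S. (\<forall>k. simple_integrand M T B (S k)) \<and>
        (\<lambda>k. \<integral>\<^sup>+\<omega>. (\<integral>\<^sup>+s\<in>{0..T}. ennreal ((norm (simple_value (S k) s \<omega> - Z s \<omega>))\<^sup>2) \<partial>lborel) \<partial>M)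
          \<longlonglongrightarrow> 0 \<and>
        (\<forall>t\<in>{0..T}.
          (\<lambda>k. \<integral>\<^sup>+\<omega>. ennreal ((simple_integral B (S k) t \<omega> - I t \<omega>)\<^sup>2) \<partial>M) \<longlonglongrightarrow> 0))"

section \<open>Backward equations\<close>

definition bsde_solution ::
  "'a measure \<Rightarrow> real \<Rightarrow> (real \<Rightarrow> 'a \<Rightarrow> real ^ 'd) \<Rightarrow> (real \<Rightarrow> 'a \<Rightarrow> real) \<Rightarrow>
   (real \<Rightarrow> 'a \<Rightarrow> real) \<Rightarrow> (real \<Rightarrow> 'a \<Rightarrow> real ^ 'd) \<Rightarrow> bool"
where
  "bsde_solution M T B f Y Z \<longleftrightarrow>
     Sc2_process M T B Y \<and> H2_process M T B Z \<and>
     (\<exists>I. ito_integral M T B Z I \<and>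
        (AE \<omega> in M. \<forall>t\<in>{0..T}. Y t \<omega> = (LBINT s:{t..T}. f s \<omega>) - (I T \<omega> - I t \<omega>)))"

text \<open>The integral with respect to \<open>dK\<close> is the pathwise Lebesgue--Stieltjes integral; the path of
  \<open>K\<close> is extended to the real line by constants.\<close>

definition rbsde_solution ::
  "'a measure \<Rightarrow> real \<Rightarrow> (real \<Rightarrow> 'a \<Rightarrow> real ^ 'd) \<Rightarrow> (real \<Rightarrow> 'a \<Rightarrow> real) \<Rightarrow> (real \<Rightarrow> 'a \<Rightarrow> real) \<Rightarrow>
   (real \<Rightarrow> 'a \<Rightarrow> real) \<Rightarrow> (real \<Rightarrow> 'a \<Rightarrow> real ^ 'd) \<Rightarrow> (real \<Rightarrow> 'a \<Rightarrow> real) \<Rightarrow> bool"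
where
  "rbsde_solution M T B f Ob Y Z K \<longleftrightarrow>
     Sc2_process M T B Y \<and> H2_process M T B Z \<and> Sci2_process M T B K \<and>
     (\<exists>I. ito_integral M T B Z I \<and>
        (AE \<omega> in M. \<forall>t\<in>{0..T}.
           Y t \<omega> = (LBINT s:{t..T}. f s \<omega>) + K T \<omega> - K t \<omega> - (I T \<omega> - I t \<omega>))) \<and>
     (AE \<omega> in M. \<forall>t\<in>{0..T}. Ob t \<omega> \<le> Y t \<omega>) \<and>
     (AE \<omega> in M.
        (LINT t:{0..T}|interval_measure (\<lambda>t. K (max 0 (min T t)) \<omega>). Y t \<omega> - Ob t \<omega>) = 0)"

definition driver ::
  "(real \<Rightarrow> 'a \<Rightarrow> real ^ 'l \<Rightarrow> real) \<Rightarrow> (real \<Rightarrow> 'a \<Rightarrow> real ^ 'l) \<Rightarrow> ('a \<Rightarrow> real) \<Rightarrow> ('a \<Rightarrow> real ^ 'l) \<Rightarrow>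
   real \<Rightarrow> 'a \<Rightarrow> real"
where
  "driver h L \<nu> \<xi> s \<omega> = h s \<omega> (L s \<omega> + \<xi> \<omega>) * indicat_real {\<nu> \<omega>..} s"

definition obstacle ::
  "(real ^ 'l) set \<Rightarrow> (real ^ 'l \<Rightarrow> real) \<Rightarrow>
   (('a \<Rightarrow> real) \<Rightarrow> ('a \<Rightarrow> real ^ 'l) \<Rightarrow> real \<Rightarrow> 'a \<Rightarrow> real) \<Rightarrow>
   ('a \<Rightarrow> real) \<Rightarrow> ('a \<Rightarrow> real ^ 'l) \<Rightarrow> real \<Rightarrow> 'a \<Rightarrow> real"
where
  "obstacle U \<psi> Yp \<nu> \<xi> t \<omega> = Max ((\<lambda>\<beta>. - \<psi> \<beta> + Yp \<nu> (\<lambda>\<omega>'. \<xi> \<omega>' + \<beta>) t \<omega>) ` U)"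

definition admissible_start ::
  "'a measure \<Rightarrow> real \<Rightarrow> (real \<Rightarrow> 'a \<Rightarrow> real ^ 'd) \<Rightarrow> ('a \<Rightarrow> real) \<Rightarrow> ('a \<Rightarrow> real ^ 'l) \<Rightarrow> bool"
where
  "admissible_start M T B \<nu> \<xi> \<longleftrightarrow>
     stopping_time (brownian_filtration M T B) \<nu> \<and>
     (\<forall>\<omega>\<in>space M. \<nu> \<omega> \<in> {0..T}) \<and>
     \<xi> \<in> borel_measurable (stopped_sigma M T B \<nu>)"

definition limit_process ::
  "(nat \<Rightarrow> ('a \<Rightarrow> real) \<Rightarrow> ('a \<Rightarrow> real ^ 'l) \<Rightarrow> real \<Rightarrow> 'a \<Rightarrow> real) \<Rightarrow>
   ('a \<Rightarrow> real) \<Rightarrow> ('a \<Rightarrow> real ^ 'l) \<Rightarrow> real \<Rightarrow> 'a \<Rightarrow> real"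
where
  "limit_process Y \<nu> \<xi> t \<omega> = lim (\<lambda>n. Y n \<nu> \<xi> t \<omega>)"

section \<open>Impulse strategies and the reward\<close>

type_synonym ('a, 'l) strategy = "(nat \<Rightarrow> 'a \<Rightarrow> real) \<times> (nat \<Rightarrow> 'a \<Rightarrow> real ^ 'l)"

definition strategies ::
  "'a measure \<Rightarrow> real \<Rightarrow> (real \<Rightarrow> 'a \<Rightarrow> real ^ 'd) \<Rightarrow> (real ^ 'l) set \<Rightarrow> ('a, 'l) strategy set"
where
  "strategies M T B U =
     {(\<tau>, \<xi>). (\<forall>n. stopping_time (brownian_filtration M T B) (\<tau> n)) \<and>
        (AE \<omega> in M. 0 \<le> \<tau> 0 \<omega> \<and> (\<forall>n. \<tau> n \<omega> \<le> \<tau> (Suc n) \<omega> \<and> \<tau> n \<omega> \<le> T)) \<and>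
        (\<forall>n. \<xi> n \<in> borel_measurable (stopped_sigma M T B (\<tau> n)) \<and>
             (\<forall>\<omega>\<in>space M. \<xi> n \<omega> \<in> U))}"

definition finite_strategies ::
  "'a measure \<Rightarrow> real \<Rightarrow> (real \<Rightarrow> 'a \<Rightarrow> real ^ 'd) \<Rightarrow> (real ^ 'l) set \<Rightarrow> ('a, 'l) strategy set"
where
  "finite_strategies M T B U =
     {(\<tau>, \<xi>) \<in> strategies M T B U. measure M {\<omega> \<in> space M. \<forall>n. \<tau> n \<omega> < T} = 0}"

definition bounded_strategies ::
  "'a measure \<Rightarrow> real \<Rightarrow> (real \<Rightarrow> 'a \<Rightarrow> real ^ 'd) \<Rightarrow> (real ^ 'l) set \<Rightarrow> nat \<Rightarrow> ('a, 'l) strategy set"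
where
  "bounded_strategies M T B U n =
     {(\<tau>, \<xi>) \<in> finite_strategies M T B U. AE \<omega> in M. \<tau> n \<omega> = T}"

definition controlled ::
  "(real \<Rightarrow> 'a \<Rightarrow> real ^ 'l) \<Rightarrow> ('a, 'l) strategy \<Rightarrow> real \<Rightarrow> 'a \<Rightarrow> real ^ 'l"
where
  "controlled L \<delta> t \<omega> =
     L t \<omega> + (\<Sum>n. indicat_real {fst \<delta> n \<omega>..} t *\<^sub>R snd \<delta> n \<omega>)"

definition ereal_expectation :: "'a measure \<Rightarrow> ('a \<Rightarrow> ereal) \<Rightarrow> ereal"
where
  "ereal_expectation M X =
     enn2ereal (\<integral>\<^sup>+\<omega>. e2ennreal (X \<omega>) \<partial>M) - enn2ereal (\<integral>\<^sup>+\<omega>. e2ennreal (- X \<omega>) \<partial>M)"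

text \<open>The positive part below is bounded, so that the expectation is well defined in
  \<open>[-\<infinity>, \<infinity>)\<close>. It is \<open>-\<infinity>\<close> whenever infinitely many interventions before \<open>T\<close> occur with
  positive probability, since the total cost is then infinite on that event; this does not depend
  on the value given to the divergent series in \<^const>\<open>controlled\<close>.\<close>

definition reward ::
  "'a measure \<Rightarrow> real \<Rightarrow> (real \<Rightarrow> 'a \<Rightarrow> real ^ 'l) \<Rightarrow> (real \<Rightarrow> 'a \<Rightarrow> real ^ 'l \<Rightarrow> real) \<Rightarrow>
   (real ^ 'l \<Rightarrow> real) \<Rightarrow> ('a, 'l) strategy \<Rightarrow> ereal"
where
  "reward M T L h \<psi> \<delta> =
     ereal_expectation M (\<lambda>\<omega>.
       ereal (LBINT s:{0..T}. h s \<omega> (controlled L \<delta> s \<omega>)) -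
       (\<Sum>n. ereal (\<psi> (snd \<delta> n \<omega>) * indicat_real {..<T} (fst \<delta> n \<omega>))))"

end

theory Submission
  imports Defs
begin

text \<open>
  The identity behind everything is obtained by stopping: for stopping times \<open>\<sigma> \<le> \<tau>\<close> and
  \<open>A \<in> \<F>\<^sub>\<sigma>\<close>, optional stopping of the It\^o integral in the (reflected) backward equation with driver
  \<open>f\<close> gives \<open>E[1\<^sub>A (Y\<^sub>\<sigma> - \<integral>\<^sub>\<sigma>\<^sup>T f)] = E[1\<^sub>A (Y\<^sub>\<tau> - \<integral>\<^sub>\<tau>\<^sup>T f + K\<^sub>\<tau> - K\<^sub>\<sigma>)]\<close>. Here \<open>K\<close> increases, and it is flat up to the
  first time after \<open>\<sigma>\<close> at which \<open>Y\<close> meets the obstacle. Comparing two equations at this hitting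
  time shows, by induction on \<open>n\<close>, that \<open>Y\<^sup>n\<^sub>\<sigma>(\<nu>, \<xi>)\<close> depends on the start \<open>(\<nu>, \<xi>)\<close> only through the
  level \<open>\<xi>\<close>. A second induction, which peels off the first intervention, then shows that
  \<open>E[Y\<^sup>n\<^sub>\<nu>(\<nu>, \<xi>)]\<close> bounds the reward of \<open>n\<close> interventions after \<open>\<nu>\<close>, with equality when one intervenes
  at the hitting times with a maximizing \<open>\<beta>\<close>. As \<open>\<F>\<^sub>0\<close> is trivial, \<open>Y\<^sup>n\<^sub>0(0, 0)\<close> is the
  supremum over the strategies with \<open>n\<close> interventions. Finally, dropping all interventions after the
  \<open>n\<close>-th costs at most \<open>\<gamma> T P(\<tau>\<^sub>n < T)\<close>, and if this does not tend to \<open>0\<close>, the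
  intervention costs make the reward \<open>-\<infinity>\<close>.
\<close>

section \<open>Preliminaries\<close>

text \<open>The processes \<open>Y n\<close> are given only as solutions, one for each start, and
  the hypotheses do not tie the solutions for different starts together. Dynamic programming needs
  such a tie: at an intervention \<tau> with random \<xi>, the obstacle offers the old start with a
  constant shift, whereas the problem resumed at \<tau> has the start (\<tau>, \<Xi> + \<xi>). Since
  \<open>U\<close> is finite, the constant shifts can be glued along the events \<xi> = \<beta>.
  Comparison works on the very event where the desired inequality fails. This event is known at
  \<sigma>, so the stopping identity may be integrated over it, and a positive integrand with
  non-positive integral must vanish. The stochastic integral enters only as a martingale, a property
  inherited by mean square limits of simple integrals. The series in \<open>controlled\<close> may
  diverge, and the reward integrand is never shown to be measurable. Rewards of general strategies
  are therefore bounded pathwise by integrable truncated payoffs; exact values are computed only for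
  strategies that end after a fixed number of interventions.\<close>

lemma lborel_integral_uminus:
  fixes f :: "'b::euclidean_space \<Rightarrow> real"
  assumes "f \<in> borel_measurable borel"
  shows "(\<integral>x. f (- x) \<partial>lborel) = (\<integral>x. f x \<partial>lborel)"
proof -
  have eq: "(lborel :: 'b measure) = distr lborel borel uminus"
    using lborel_affine[of "-1" "0::'b"] by (simp add: density_1)
  have "(\<integral>x. f x \<partial>lborel) = (\<integral>x. f x \<partial>distr lborel borel uminus)"
    by (subst eq) simp
  also have "\<dots> = (\<integral>x. f (- x) \<partial>lborel)"
    using assms by (subst integral_distr) auto
  finally show ?thesis by simp
qed

text \<open>Integrability: the absolute integrand is a product over coordinates, with a first
  absolute moment in coordinate \<open>i\<close> and a density in all others. The mean vanishes
  because the density is even and the coordinate is odd.\<close>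

lemma normal_prod_component:
  fixes i :: "'d::finite"
  assumes "\<sigma> > 0"
  defines "p \<equiv> \<lambda>x::real^'d. \<Prod>j\<in>UNIV. normal_density 0 \<sigma> (x $ j)"
  shows "integrable lborel (\<lambda>x. p x * x $ i)"
    and "(\<integral>x. p x * x $ i \<partial>lborel) = 0"
proof -
  have [measurable]: "p \<in> borel_measurable borel"
    unfolding p_def by measurable
  define g where "g = (\<lambda>(b::real^'d) x. ennreal (if b = axis i 1 then \<bar>normal_density 0 \<sigma> x * x\<bar> else normal_density 0 \<sigma> x))"
  have g[measurable]: "g b \<in> borel_measurable borel" for b :: "real^'d"
    unfolding g_def by measurable
  have bas: "(Basis :: (real^'d) set) = (\<lambda>j. axis j 1) ` UNIV"
    by (auto simp: Basis_vec_def)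
  have inj: "inj (\<lambda>j::'d. axis j (1::real))"
    by (auto simp: inj_def axis_eq_axis)
  have eq: "ennreal (norm (p x * x $ i)) = (\<Prod>b\<in>Basis. g b (x \<bullet> b))" for x :: "real^'d"
  proof -
    have "(\<Prod>b\<in>Basis. g b (x \<bullet> b)) = (\<Prod>j\<in>UNIV. g (axis j 1) (x $ j))"
      unfolding bas by (subst prod.reindex[OF inj]) (simp add: inner_axis)
    also have "\<dots> = (\<Prod>j\<in>UNIV. ennreal (if j = i then \<bar>normal_density 0 \<sigma> (x $ j) * x $ j\<bar> else normal_density 0 \<sigma> (x $ j)))"
      unfolding g_def by (intro prod.cong) (auto simp: axis_eq_axis)
    also have "\<dots> = ennreal (\<Prod>j\<in>UNIV. (if j = i then \<bar>normal_density 0 \<sigma> (x $ j) * x $ j\<bar> else normal_density 0 \<sigma> (x $ j)))"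
      by (rule prod_ennreal) auto
    also have "(\<Prod>j\<in>UNIV. (if j = i then \<bar>normal_density 0 \<sigma> (x $ j) * x $ j\<bar> else normal_density 0 \<sigma> (x $ j)))
        = (\<Prod>j\<in>UNIV. normal_density 0 \<sigma> (x $ j) * (if j = i then \<bar>x $ j\<bar> else 1))"
      by (intro prod.cong) (auto simp: abs_mult)
    also have "\<dots> = p x * \<bar>x $ i\<bar>"
      unfolding p_def prod.distrib by (simp add: prod.delta)
    finally show ?thesis
      by (simp add: abs_mult p_def prod_nonneg)
  qed
  have "(\<integral>\<^sup>+x. ennreal (norm (p x * x $ i)) \<partial>lborel) = (\<Prod>b\<in>Basis. (\<integral>\<^sup>+x. g b x \<partial>lborel))"
    unfolding eq by (rule nn_integral_lborel_prod) auto
  also have "\<dots> < \<infinity>"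
  proof -
    have "integrable lborel (\<lambda>x. \<bar>normal_density 0 \<sigma> x * x\<bar>)"
      using integrable_normal_moment[of \<sigma> 0 1] assms(1) by (intro integrable_abs) auto
    then have "(\<integral>\<^sup>+x. g b x \<partial>lborel) \<noteq> top" for b :: "real^'d"
      unfolding g_def using assms(1)
      by (cases "b = axis i 1") (simp_all add: nn_integral_eq_integral)
    then show ?thesis
      by (simp add: ennreal_prod_eq_top less_top[symmetric])
  qed
  finally show int: "integrable lborel (\<lambda>x. p x * x $ i)"
    by (intro integrableI_bounded) auto
  have "(\<integral>x. p (-x) * (-x) $ i \<partial>lborel) = (\<integral>x. p x * x $ i \<partial>lborel)"
    by (rule lborel_integral_uminus) measurable
  moreover have "p (-x) = p x" for x
    unfolding p_def by (simp add: normal_density_def)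
  ultimately show "(\<integral>x. p x * x $ i \<partial>lborel) = 0"
    by simp
qed

text \<open>A non-negative function with zero integral vanishes almost everywhere, so the measure dk
  gives no mass to the times at which \<open>x\<close> is positive. Clamping the time extends the
  path by constants, which makes it the distribution function of a measure on the whole
  line.\<close>

lemma skorokhod_flat:
  fixes k x :: "real \<Rightarrow> real"
  assumes k: "continuous_on {0..T} k" "mono_on {0..T} k"
    and x: "continuous_on {0..T} x" "\<And>t. t \<in> {0..T} \<Longrightarrow> 0 \<le> x t"
    and zero: "(LINT t:{0..T}|interval_measure (\<lambda>t. k (max 0 (min T t))). x t) = 0"
    and ab: "0 \<le> a" "a \<le> b" "b \<le> T" and pos: "\<And>t. a \<le> t \<Longrightarrow> t < b \<Longrightarrow> 0 < x t"
  shows "k a = k b"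
proof -
  define \<kappa> where "\<kappa> t = k (max 0 (min T t))" for t
  have T: "0 \<le> T" using ab by simp
  have \<kappa>_eq: "\<kappa> t = k t" if "t \<in> {0..T}" for t using that by (simp add: \<kappa>_def)
  have \<kappa>_mono: "\<kappa> s \<le> \<kappa> t" if "s \<le> t" for s t
    unfolding \<kappa>_def using T that by (intro mono_onD[OF k(2)]) auto
  have "continuous_on UNIV (\<lambda>t. k (max 0 (min T t)))"
    using T by (intro continuous_on_compose2[OF k(1)] continuous_intros) auto
  then have \<kappa>_cont: "isCont \<kappa> t" for t
    unfolding \<kappa>_def by (simp add: continuous_on_eq_continuous_at)
  let ?\<mu> = "interval_measure \<kappa>"
  have right: "continuous (at_right t) \<kappa>" for t
    using \<kappa>_cont by (rule continuous_at_imp_continuous_at_within)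
  have Icc: "emeasure ?\<mu> {0..T} = ennreal (\<kappa> T - \<kappa> 0)"
    using T \<kappa>_cont by (intro emeasure_interval_measure_Icc \<kappa>_mono) (auto simp: continuous_at_imp_continuous_on)
  obtain C where "\<forall>y\<in>x ` {0..T}. norm y \<le> C"
    using compact_imp_bounded[OF compact_continuous_image[OF x(1) compact_Icc]]
    unfolding bounded_iff by blast
  then have C: "\<bar>x t\<bar> \<le> C" if "t \<in> {0..T}" for t
    using that by simp
  have meas: "(\<lambda>t. indicat_real {0..T} t *\<^sub>R x t) \<in> borel_measurable borel"
    using borel_measurable_continuous_on_indicator[OF _ x(1)] by simp
  \<comment> \<open>Without integrability the Bochner integral would be 0 by convention, and
    \<open>zero\<close> would say nothing about \<open>x\<close>.\<close>
  have int: "integrable ?\<mu> (\<lambda>t. indicat_real {0..T} t *\<^sub>R x t)"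
  proof (rule integrableI_bounded_set[where A="{0..T}" and B=C])
    show "emeasure ?\<mu> {0..T} < \<infinity>" unfolding Icc by simp
  qed (use meas C in \<open>auto simp: indicator_def\<close>)
  have "AE t in ?\<mu>. indicat_real {0..T} t *\<^sub>R x t = 0"
  proof (subst integral_nonneg_eq_0_iff_AE[OF int, symmetric])
    show "AE t in ?\<mu>. 0 \<le> indicat_real {0..T} t *\<^sub>R x t"
      using x(2) by (auto simp: indicator_def)
    show "(LINT t|?\<mu>. indicat_real {0..T} t *\<^sub>R x t) = 0"
      using zero unfolding set_lebesgue_integral_def \<kappa>_def .
  qed
  then have flat: "k t = k a" if "a \<le> t" "t < b" for t
  proof -
    have sub: "{a<..t} \<subseteq> {s \<in> space ?\<mu>. \<not> indicat_real {0..T} s *\<^sub>R x s = 0}"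
    proof
      fix s assume s: "s \<in> {a<..t}"
      then have "0 < x s" "s \<in> {0..T}" using that ab pos[of s] by auto
      then show "s \<in> {s \<in> space ?\<mu>. \<not> indicat_real {0..T} s *\<^sub>R x s = 0}" by simp
    qed
    obtain N where N: "{s \<in> space ?\<mu>. \<not> indicat_real {0..T} s *\<^sub>R x s = 0} \<subseteq> N" "emeasure ?\<mu> N = 0" "N \<in> sets ?\<mu>"
      using AE_E[OF \<open>AE t in ?\<mu>. indicat_real {0..T} t *\<^sub>R x t = 0\<close>] by metis
    have "emeasure ?\<mu> {a<..t} \<le> emeasure ?\<mu> N"
      using sub N by (intro emeasure_mono) auto
    then have "emeasure ?\<mu> {a<..t} = 0"
      using N(2) by simp
    moreover have "emeasure ?\<mu> {a<..t} = ennreal (\<kappa> t - \<kappa> a)"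
      using that by (intro emeasure_interval_measure_Ioc \<kappa>_mono right)
    ultimately have "\<kappa> t \<le> \<kappa> a" by (simp add: ennreal_eq_0_iff)
    then show ?thesis using \<kappa>_mono[OF that(1)] that ab by (simp add: \<kappa>_eq)
  qed
  show ?thesis
  proof (cases "a = b")
    case False
    then have "a < b" using ab by simp
    \<comment> \<open>Positivity is assumed only before \<open>b\<close>, so constancy holds on the
      half-open interval; continuity of \<open>k\<close> carries it to the endpoint.\<close>
    have "norm (k b - k a) \<le> 0"
    proof (rule continuous_on_closure_norm_le[where f="\<lambda>t. k t - k a" and x=b and s="{a..<b}"])
      show "continuous_on (closure {a..<b}) (\<lambda>t. k t - k a)"
        using \<open>a < b\<close> ab by (intro continuous_intros continuous_on_subset[OF k(1)]) (auto simp: closure_atLeastLessThan)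
      show "\<forall>t\<in>{a..<b}. norm (k t - k a) \<le> 0"
      proof
        fix t assume "t \<in> {a..<b}"
        then have "k t = k a" by (intro flat) auto
        then show "norm (k t - k a) \<le> 0" by simp
      qed
      show "b \<in> closure {a..<b}" using \<open>a < b\<close> by (simp add: closure_atLeastLessThan)
    qed
    then show ?thesis by simp
  qed simp
qed

text \<open>A path that is not integrable has integral 0 by default, and 0 obeys both bounds. This
  covers paths of the controlled state whose measurability is unknown.\<close>

lemma LBINT_bounds:
  fixes f :: "real \<Rightarrow> real"
  assumes f: "\<And>s. s \<in> {0..T} \<Longrightarrow> 0 \<le> f s \<and> f s \<le> \<gamma>" and a: "0 \<le> a" and T: "0 \<le> T"
  shows "0 \<le> (LBINT s:{a..T}. f s)" and "(LBINT s:{a..T}. f s) \<le> \<gamma> * T"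
proof -
  have \<gamma>: "0 \<le> \<gamma>" using f[of T] T by simp
  show "0 \<le> (LBINT s:{a..T}. f s)"
    unfolding set_lebesgue_integral_def using f a by (intro integral_nonneg_AE AE_I2) (auto simp: indicator_def)
  show "(LBINT s:{a..T}. f s) \<le> \<gamma> * T"
    unfolding set_lebesgue_integral_def
  proof (cases "integrable lborel (\<lambda>s. indicat_real {a..T} s *\<^sub>R f s)")
    case True
    then have "(\<integral>s. indicat_real {a..T} s *\<^sub>R f s \<partial>lborel) \<le> (\<integral>s. indicat_real {0..T} s *\<^sub>R \<gamma> \<partial>lborel)"
    proof (rule integral_mono)
      show "indicat_real {a..T} s *\<^sub>R f s \<le> indicat_real {0..T} s *\<^sub>R \<gamma>" for s
        using f[of s] a \<gamma> by (auto simp: indicator_def)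
    qed (use T in simp)
    then show "(\<integral>s. indicat_real {a..T} s *\<^sub>R f s \<partial>lborel) \<le> \<gamma> * T"
      using T by (simp add: mult.commute)
  next
    case False
    then show "(\<integral>s. indicat_real {a..T} s *\<^sub>R f s \<partial>lborel) \<le> \<gamma> * T"
      using \<gamma> T by (simp add: not_integrable_integral_eq)
  qed
qed

lemma continuous_on_Max:
  fixes f :: "'i \<Rightarrow> 'x::topological_space \<Rightarrow> real"
  assumes "finite I" "I \<noteq> {}" "\<And>i. i \<in> I \<Longrightarrow> continuous_on S (f i)"
  shows "continuous_on S (\<lambda>x. Max ((\<lambda>i. f i x) ` I))"
  using assms
proof (induction I rule: finite_ne_induct)
  case (insert i I)
  then have "continuous_on S (\<lambda>x. max (f i x) (Max ((\<lambda>i. f i x) ` I)))"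
    by (intro continuous_on_max) auto
  then show ?case using insert by simp
qed simp

text \<open>Provides the best intervention as a random variable. A newly added index wins ties, so
  each choice is decided by one measurable comparison.\<close>

lemma measurable_argmax:
  fixes f :: "'i::topological_space \<Rightarrow> 'a \<Rightarrow> real"
  assumes "finite I" "I \<noteq> {}" "\<And>i. i \<in> I \<Longrightarrow> f i \<in> borel_measurable N"
  shows "\<exists>\<xi>\<in>borel_measurable N. \<forall>\<omega>\<in>space N. \<xi> \<omega> \<in> I \<and> f (\<xi> \<omega>) \<omega> = Max ((\<lambda>i. f i \<omega>) ` I)"
  using assms
proof (induction I rule: finite_ne_induct)
  case (singleton i)
  then show ?case by (intro bexI[of _ "\<lambda>_. i"]) auto
next
  case (insert i I)
  then obtain \<xi> where \<xi>: "\<xi> \<in> borel_measurable N"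
    "\<And>\<omega>. \<omega> \<in> space N \<Longrightarrow> \<xi> \<omega> \<in> I \<and> f (\<xi> \<omega>) \<omega> = Max ((\<lambda>i. f i \<omega>) ` I)" by auto
  have max: "(\<lambda>\<omega>. Max ((\<lambda>i. f i \<omega>) ` I)) \<in> borel_measurable N"
    using insert by (intro borel_measurable_Max) auto
  let ?\<xi> = "\<lambda>\<omega>. if Max ((\<lambda>i. f i \<omega>) ` I) \<le> f i \<omega> then i else \<xi> \<omega>"
  have "?\<xi> \<in> borel_measurable N"
    using \<xi>(1) max insert.prems[of i] by (intro measurable_If borel_measurable_le) auto
  moreover have "?\<xi> \<omega> \<in> insert i I \<and> f (?\<xi> \<omega>) \<omega> = Max ((\<lambda>i. f i \<omega>) ` insert i I)" if "\<omega> \<in> space N" for \<omega>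
  proof -
    have "Max ((\<lambda>i. f i \<omega>) ` insert i I) = max (f i \<omega>) (Max ((\<lambda>i. f i \<omega>) ` I))"
      using insert.hyps by simp
    then show ?thesis
      using \<xi>(2)[OF that] by (simp add: max_def del: Max_le_iff image_insert)
  qed
  ultimately show ?case by (intro bexI[of _ ?\<xi>]) auto
qed

lemma LBINT_point: "(LBINT s:{t::real}. f s) = (0::real)"
  unfolding set_lebesgue_integral_def
  by (intro integral_eq_zero_AE eventually_mono[OF AE_lborel_singleton[of t]]) simp

text \<open>\<open>nn_integral\<close> is monotone on arbitrary functions, so a reward can be
  compared with an integrable bound before anything is known about the measurability of its
  integrand.\<close>

lemma ereal_expectation_mono:
  assumes "AE \<omega> in M. X \<omega> \<le> X' \<omega>"
  shows "ereal_expectation M X \<le> ereal_expectation M X'"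
  unfolding ereal_expectation_def
proof (rule ereal_minus_mono)
  have "(\<integral>\<^sup>+\<omega>. e2ennreal (X \<omega>) \<partial>M) \<le> (\<integral>\<^sup>+\<omega>. e2ennreal (X' \<omega>) \<partial>M)"
    using assms by (intro nn_integral_mono_AE) (auto elim!: eventually_mono intro: e2ennreal_mono)
  then show "enn2ereal (\<integral>\<^sup>+\<omega>. e2ennreal (X \<omega>) \<partial>M) \<le> enn2ereal (\<integral>\<^sup>+\<omega>. e2ennreal (X' \<omega>) \<partial>M)"
    by (simp add: less_eq_ennreal.rep_eq)
  have "(\<integral>\<^sup>+\<omega>. e2ennreal (- X' \<omega>) \<partial>M) \<le> (\<integral>\<^sup>+\<omega>. e2ennreal (- X \<omega>) \<partial>M)"
    using assms by (intro nn_integral_mono_AE) (auto elim!: eventually_mono intro: e2ennreal_mono)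
  then show "enn2ereal (\<integral>\<^sup>+\<omega>. e2ennreal (- X' \<omega>) \<partial>M) \<le> enn2ereal (\<integral>\<^sup>+\<omega>. e2ennreal (- X \<omega>) \<partial>M)"
    by (simp add: less_eq_ennreal.rep_eq)
qed

lemma ereal_expectation_real:
  assumes f: "integrable M f"
  shows "ereal_expectation M (\<lambda>\<omega>. ereal (f \<omega>)) = ereal (\<integral>\<omega>. f \<omega> \<partial>M)"
proof -
  have "(\<integral>\<^sup>+\<omega>. ennreal (f \<omega>) \<partial>M) < \<infinity>" "(\<integral>\<^sup>+\<omega>. ennreal (- f \<omega>) \<partial>M) < \<infinity>"
    using f by (auto simp: real_integrable_def less_top)
  then obtain a b where ab: "0 \<le> a" "(\<integral>\<^sup>+\<omega>. ennreal (f \<omega>) \<partial>M) = ennreal a"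
    "0 \<le> b" "(\<integral>\<^sup>+\<omega>. ennreal (- f \<omega>) \<partial>M) = ennreal b"
    by (metis ennreal_cases infinity_ennreal_def less_irrefl)
  then have "(\<integral>\<omega>. f \<omega> \<partial>M) = a - b"
    using real_lebesgue_integral_def[OF f] by simp
  then show ?thesis
    using ab by (simp add: ereal_expectation_def e2ennreal_ereal enn2ereal_ennreal)
qed

text \<open>Meant for the terminal time: at \<open>T\<close> itself the controlled state also
  receives all interventions parked at \<open>T\<close>, possibly through a divergent series, while
  the truncated state does not. Changing a function at one point preserves measurability, so two
  such functions are either both measurable or both have the default integral 0.\<close>

lemma lborel_integral_cong_off_point:
  fixes f g :: "real \<Rightarrow> real"
  assumes eq: "\<And>s. s \<noteq> t \<Longrightarrow> f s = g s"
  shows "integral\<^sup>L lborel f = integral\<^sup>L lborel g"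
proof -
  have m: "f' \<in> borel_measurable lborel" if "\<And>s. s \<noteq> t \<Longrightarrow> f' s = g' s" "g' \<in> borel_measurable lborel"
    for f' g' :: "real \<Rightarrow> real"
  proof -
    have "(\<lambda>s. if s = t then f' t else g' s) \<in> borel_measurable lborel"
      using that(2) by measurable
    also have "(\<lambda>s. if s = t then f' t else g' s) = f'"
      using that(1) by auto
    finally show ?thesis .
  qed
  show ?thesis
  proof (cases "f \<in> borel_measurable lborel")
    case True
    then show ?thesis
      using m[OF eq[symmetric] True] eq
      by (intro integral_cong_AE eventually_mono[OF AE_lborel_singleton[of t]])
  next
    case False
    then have "\<not> integrable lborel f" "\<not> integrable lborel g"
      using m[OF eq] by (auto dest: borel_measurable_integrable)
    then show ?thesis by (simp add: not_integrable_integral_eq)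
  qed
qed

section \<open>Brownian filtration, martingales and backward equations\<close>

locale brownian = prob_space M
  for M :: "'a measure" and T :: real and B :: "real \<Rightarrow> 'a \<Rightarrow> real ^ 'd" +
  assumes T_pos: "0 < T"
    and bm: "standard_brownian_motion M T B"
begin

abbreviation F :: "real \<Rightarrow> 'a measure" where
  "F \<equiv> brownian_filtration M T B"

sublocale filtration "space M" F
  by (rule filtration_brownian_filtration)

section \<open>The completed Brownian filtration inside the given probability space\<close>

lemma B_measurable: "t \<in> {0..T} \<Longrightarrow> B t \<in> borel_measurable M"
  using bm by (simp add: standard_brownian_motion_def)

lemma sets_F:
  "sets (F t) = sigma_sets (space M)
     ({B s -` A \<inter> space M | s A. 0 \<le> s \<and> s \<le> min t T \<and> A \<in> sets borel} \<union> null_sets M)"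
  unfolding brownian_filtration_def
  by (rule sets_measure_of) (rule brownian_filtration_gen_subset)

lemma sets_F_subset: "sets (F t) \<subseteq> sets M"
  unfolding sets_F
proof (rule sets.sigma_sets_subset, safe)
  fix s and A :: "(real^'d) set" assume "0 \<le> s" "s \<le> min t T" "A \<in> sets borel"
  then show "B s -` A \<inter> space M \<in> sets M"
    using B_measurable[of s] by (auto intro: measurable_sets)
qed auto

lemma in_sets_F: "A \<in> sets (F t) \<Longrightarrow> A \<in> sets M"
  using sets_F_subset by blast

lemma null_sets_F: "N \<in> null_sets M \<Longrightarrow> N \<in> sets (F t)"
  unfolding sets_F by (rule sigma_sets.Basic) auto

lemma F_eq_T: "t \<ge> T \<Longrightarrow> sets (F t) = sets (F T)"
  unfolding sets_F by (simp add: min_absorb2)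

lemma subalgebra_F: "subalgebra M (F t)"
  unfolding subalgebra_def using sets_F_subset space_F by auto

lemma measurable_F: "X \<in> measurable (F t) N \<Longrightarrow> X \<in> measurable M N"
  by (rule measurable_from_subalg[OF subalgebra_F])

section \<open>Brownian increments against events of the past\<close>

lemma
  assumes "0 \<le> s" "s < t" "t \<le> T"
  shows integrable_increment: "integrable M (\<lambda>\<omega>. (B t \<omega> - B s \<omega>) $ i)"
    and expectation_increment: "(\<integral>\<omega>. (B t \<omega> - B s \<omega>) $ i \<partial>M) = 0"
proof -
  have d: "distributed M lborel (\<lambda>\<omega>. B t \<omega> - B s \<omega>)
          (\<lambda>x. ennreal (\<Prod>i\<in>UNIV. normal_density 0 (sqrt (t - s)) (x $ i)))"
    using bm assms by (simp add: standard_brownian_motion_def)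
  have nn: "0 \<le> (\<Prod>i\<in>UNIV. normal_density 0 (sqrt (t - s)) (x $ i))" for x :: "real^'d"
    by (intro prod_nonneg) auto
  have m: "(\<lambda>x. x $ i) \<in> borel_measurable (lborel :: (real^'d) measure)"
    by measurable
  have "sqrt (t - s) > 0"
    using assms by simp
  note n = normal_prod_component[OF this, of i]
  show "integrable M (\<lambda>\<omega>. (B t \<omega> - B s \<omega>) $ i)"
    using distributed_integrable[OF d m nn] n(1) by simp
  show "(\<integral>\<omega>. (B t \<omega> - B s \<omega>) $ i \<partial>M) = 0"
    using distributed_integral[OF d m nn] n(2) by simp
qed

lemma indep_increments:
  "0 \<le> p 0 \<Longrightarrow> (\<And>i. i < n \<Longrightarrow> p i \<le> p (Suc i)) \<Longrightarrow> p n \<le> T \<Longrightarrow>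
     indep_vars (\<lambda>_. borel) (\<lambda>i \<omega>. B (p (Suc i)) \<omega> - B (p i) \<omega>) {..<n}"
  using bm by (simp add: standard_brownian_motion_def)

abbreviation cylinder :: "real set \<Rightarrow> (real \<Rightarrow> (real ^ 'd) set) \<Rightarrow> 'a set" where
  "cylinder J C \<equiv> {\<omega>\<in>space M. \<forall>u\<in>J. B u \<omega> \<in> C u}"

text \<open>Since \<open>B 0\<close> vanishes almost surely, each value of \<open>B\<close> up to
  time \<open>s\<close> is almost surely a sum of successive increments, and these are independent
  of the increment over [s, t]. The cylinder indicator thus multiplies an independent variable of
  mean zero.\<close>

lemma cylinder_increment:
  assumes J: "finite J" "J \<subseteq> {0..s}" and C: "\<And>u. u \<in> J \<Longrightarrow> C u \<in> sets borel"
    and st: "0 \<le> s" "s < t" "t \<le> T"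
  shows "(\<integral>\<omega>\<in>cylinder J C. (B t \<omega> - B s \<omega>) $ i \<partial>M) = 0"
proof -
  \<comment> \<open>Inserting 0 makes the partition start where \<open>B\<close> vanishes, and
    inserting \<open>s\<close> makes the list end at \<open>s\<close>.\<close>
  define xs where "xs = sorted_list_of_set (insert 0 (insert s J))"
  define N where "N = length xs - 1"
  \<comment> \<open>Indices past the list give \<open>t\<close>, so the increment number
    \<open>N\<close> is exactly the one from \<open>s\<close> to \<open>t\<close>.\<close>
  define p where "p k = (if k < length xs then xs ! k else t)" for k
  have fin: "finite (insert 0 (insert s J))"
    using J by simp
  have set_xs: "set xs = insert 0 (insert s J)" and sorted: "sorted xs"
    unfolding xs_def using fin by (simp_all only: set_sorted_list_of_set sorted_sorted_list_of_set)
  have len: "length xs = Suc N"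
    unfolding N_def using set_xs by (cases xs) auto
  have p0: "p 0 = 0"
  proof -
    obtain k where k: "k < length xs" "xs ! k = 0"
      using set_xs by (metis in_set_conv_nth insertI1)
    then have "xs ! 0 \<le> 0"
      using sorted by (metis le0 sorted_nth_mono)
    moreover have "xs ! 0 \<in> set xs" using len by simp
    then have "0 \<le> xs ! 0" using set_xs J st by auto
    ultimately show ?thesis using len by (simp add: p_def)
  qed
  have pN: "p N = s"
  proof -
    obtain k where k: "k < length xs" "xs ! k = s"
      using set_xs by (metis in_set_conv_nth insertI1 insertI2)
    then have "s \<le> xs ! N"
      using sorted len by (metis less_Suc_eq_le lessI sorted_nth_mono)
    moreover have "xs ! N \<in> set xs" using len by simp
    then have "xs ! N \<le> s" using set_xs J st by auto
    ultimately show ?thesis using len by (simp add: p_def)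
  qed
  have pt: "p (Suc N) = t" using len by (simp add: p_def)
  have mono: "p k \<le> p (Suc k)" if "k < Suc N" for k
  proof (cases "k = N")
    case True then show ?thesis using pN pt st by simp
  next
    case False
    then show ?thesis using that sorted len by (simp add: p_def sorted_nth_mono)
  qed
  define d where "d = (\<lambda>k \<omega>. B (p (Suc k)) \<omega> - B (p k) \<omega>)"
  have ind: "indep_vars (\<lambda>_. borel) d {..<Suc N}"
    unfolding d_def using p0 pt st mono by (intro indep_increments) auto
  have "\<exists>k\<le>N. p k = u" if "u \<in> J" for u
  proof -
    have "u \<in> set xs" using that set_xs by simp
    then obtain k where "k < length xs" "xs ! k = u" by (auto simp: in_set_conv_nth)
    then show ?thesis using len by (intro exI[of _ k]) (auto simp: p_def)
  qed
  then obtain \<kappa> where \<kappa>: "\<And>u. u \<in> J \<Longrightarrow> \<kappa> u \<le> N \<and> p (\<kappa> u) = u"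
    by metis
  have tel: "(\<Sum>j<k. d j \<omega>) = B (p k) \<omega> - B (p 0) \<omega>" for k \<omega>
    unfolding d_def by (rule sum_lessThan_telescope)
  \<comment> \<open>The cylinder in the coordinates of the first \<open>N\<close> increments: the
    value at \<open>u\<close> is the partial sum up to the position \<kappa> u of \<open>u\<close>
    in the partition.\<close>
  define S where "S = {f \<in> space (\<Pi>\<^sub>M k\<in>{..<N}. (borel :: (real^'d) measure)). \<forall>u\<in>J. (\<Sum>j<\<kappa> u. f j) \<in> C u}"
  have S: "S \<in> sets (\<Pi>\<^sub>M k\<in>{..<N}. (borel :: (real^'d) measure))"
  proof -
    have m: "(\<lambda>f. \<Sum>j<\<kappa> u. f j) \<in> borel_measurable (\<Pi>\<^sub>M k\<in>{..<N}. (borel :: (real^'d) measure))"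
      if "u \<in> J" for u
    proof (rule borel_measurable_sum)
      fix j assume "j \<in> {..<\<kappa> u}"
      then have "j \<in> {..<N}" using \<kappa>[OF that] by simp
      then show "(\<lambda>x. x j) \<in> borel_measurable (\<Pi>\<^sub>M k\<in>{..<N}. (borel :: (real^'d) measure))"
        by (rule measurable_component_singleton)
    qed
    show ?thesis
      unfolding S_def using J(1) C
      by (intro sets.sets_Collect_finite_All measurable_sets_Collect[OF m]) auto
  qed
  let ?R = "\<lambda>A \<omega>. restrict (\<lambda>k. d k \<omega>) A"
  have "indep_var (PiM {..<N} (\<lambda>_. borel)) (?R {..<N}) (PiM {N} (\<lambda>_. borel)) (?R {N})"
    by (rule indep_var_restrict[OF ind]) auto
  then have "indep_var borel ((indicat_real S) \<circ> ?R {..<N}) borel ((\<lambda>f. f N $ i) \<circ> ?R {N})"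
  proof (rule indep_var_compose)
    show "indicat_real S \<in> borel_measurable (PiM {..<N} (\<lambda>_. borel))"
      using S by (rule borel_measurable_indicator)
    have "(\<lambda>f. f N) \<in> borel_measurable (PiM {N} (\<lambda>_. borel :: (real^'d) measure))"
      by (rule measurable_component_singleton) simp
    then show "(\<lambda>f. f N $ i) \<in> borel_measurable (PiM {N} (\<lambda>_. borel :: (real^'d) measure))"
      by (rule measurable_compose) measurable
  qed
  then have iv: "indep_var borel (\<lambda>\<omega>. indicat_real S (?R {..<N} \<omega>)) borel (\<lambda>\<omega>. (B t \<omega> - B s \<omega>) $ i)"
    by (simp add: comp_def d_def pN pt)
  have m: "(\<lambda>\<omega>. indicat_real S (?R {..<N} \<omega>)) \<in> borel_measurable M"
    using iv by (simp add: indep_var_rv1)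
  have "integrable M (\<lambda>\<omega>. indicat_real S (?R {..<N} \<omega>))"
    by (rule integrable_const_bound[where B=1]) (use m in auto)
  then have "(\<integral>\<omega>. indicat_real S (?R {..<N} \<omega>) * (B t \<omega> - B s \<omega>) $ i \<partial>M) = 0"
    using indep_var_lebesgue_integral[OF iv _ integrable_increment] expectation_increment st by simp
  moreover have "(\<integral>\<omega>\<in>cylinder J C. (B t \<omega> - B s \<omega>) $ i \<partial>M)
      = (\<integral>\<omega>. indicat_real S (?R {..<N} \<omega>) * (B t \<omega> - B s \<omega>) $ i \<partial>M)"
    unfolding set_lebesgue_integral_def real_scaleR_def
  proof (rule integral_cong_AE)
    have X: "(\<lambda>\<omega>. (B t \<omega> - B s \<omega>) $ i) \<in> borel_measurable M"
      using integrable_increment[OF st] by (rule borel_measurable_integrable)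
    have E: "cylinder J C \<in> sets M"
      using J st C by (intro sets.sets_Collect_finite_All measurable_sets_Collect[OF B_measurable]) auto
    show "(\<lambda>\<omega>. indicat_real (cylinder J C) \<omega> * (B t \<omega> - B s \<omega>) $ i) \<in> borel_measurable M"
      using X E by (intro borel_measurable_times borel_measurable_indicator)
    show "(\<lambda>\<omega>. indicat_real S (?R {..<N} \<omega>) * (B t \<omega> - B s \<omega>) $ i) \<in> borel_measurable M"
      using X m by (intro borel_measurable_times)
    have "AE \<omega> in M. B 0 \<omega> = 0"
      using bm by (simp add: standard_brownian_motion_def)
    then show "AE \<omega> in M. indicat_real (cylinder J C) \<omega> * (B t \<omega> - B s \<omega>) $ i
        = indicat_real S (?R {..<N} \<omega>) * (B t \<omega> - B s \<omega>) $ i"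
      using AE_space
    proof eventually_elim
      case (elim \<omega>)
      have "(\<Sum>j<\<kappa> u. ?R {..<N} \<omega> j) = B u \<omega>" if "u \<in> J" for u
      proof -
        have "(\<Sum>j<\<kappa> u. ?R {..<N} \<omega> j) = (\<Sum>j<\<kappa> u. d j \<omega>)"
          using \<kappa>[OF that] by (intro sum.cong) auto
        then show ?thesis
          using \<kappa>[OF that] elim p0 by (simp add: tel)
      qed
      then have "\<omega> \<in> cylinder J C \<longleftrightarrow> ?R {..<N} \<omega> \<in> S"
        using elim by (auto simp: S_def space_PiM)
      then show ?case by (auto simp: indicator_def)
    qed
  qed
  ultimately show ?thesis by simp
qed

text \<open>Cylinders and null sets together form an intersection-stable generator of the completed
  sigma-algebra: an intersection involving a null set is null, and two cylinders merge over the
  union of their index sets. The events with vanishing integral are closed under complements, as the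
  increment has mean zero, and under disjoint unions.\<close>

lemma set_integral_increment:
  assumes A: "A \<in> sets (F s)" and st: "0 \<le> s" "s < t" "t \<le> T"
  shows "(\<integral>\<omega>\<in>A. (B t \<omega> - B s \<omega>) $ i \<partial>M) = 0"
proof -
  let ?X = "\<lambda>\<omega>. (B t \<omega> - B s \<omega>) $ i"
  have int: "set_integrable M A' ?X" if "A' \<in> sets M" for A'
    unfolding set_integrable_def real_scaleR_def using integrable_mult_indicator[OF that integrable_increment[OF st]] by simp
  define G where "G = {cylinder J C | J C. finite J \<and> J \<subseteq> {0..s} \<and> (\<forall>u\<in>J. C u \<in> sets borel)}
     \<union> null_sets M"
  have GM: "G \<subseteq> sets M"
  proof (clarsimp simp: G_def, rule conjI, clarsimp)
    fix J and C :: "real \<Rightarrow> (real^'d) set" assume J: "finite J" "J \<subseteq> {0..s}" "\<forall>u\<in>J. C u \<in> sets borel"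
    then show "cylinder J C \<in> sets M"
      using st by (intro sets.sets_Collect_finite_All measurable_sets_Collect[OF B_measurable]) auto
  qed auto
  have "Int_stable G"
    unfolding Int_stable_def
  proof (intro ballI)
    fix a b assume ab: "a \<in> G" "b \<in> G"
    show "a \<inter> b \<in> G"
    proof (cases "a \<in> null_sets M \<or> b \<in> null_sets M")
      case True
      then have "a \<inter> b \<in> null_sets M"
        using GM ab by (auto intro: null_set_Int1 null_set_Int2)
      then show ?thesis by (simp add: G_def)
    next
      case False
      obtain J C where a: "a = cylinder J C" "finite J" "J \<subseteq> {0..s}" "\<forall>u\<in>J. C u \<in> sets borel"
        using ab(1) False unfolding G_def by blast
      obtain J' C' where b: "b = cylinder J' C'" "finite J'" "J' \<subseteq> {0..s}" "\<forall>u\<in>J'. C' u \<in> sets borel"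
        using ab(2) False unfolding G_def by blast
      define E where "E u = (if u \<in> J then C u else UNIV) \<inter> (if u \<in> J' then C' u else UNIV)" for u
      have "a \<inter> b = cylinder (J \<union> J') E"
        unfolding a(1) b(1) E_def by auto
      moreover have "\<forall>u\<in>J \<union> J'. E u \<in> sets borel"
        unfolding E_def using a b by auto
      ultimately have "\<exists>J C. a \<inter> b = cylinder J C \<and> finite J \<and> J \<subseteq> {0..s} \<and> (\<forall>u\<in>J. C u \<in> sets borel)"
        using a(2,3) b(2,3) by (intro exI[of _ "J \<union> J'"] exI[of _ E]) simp
      then show ?thesis
        unfolding G_def by simp
    qed
  qed
  moreover have "G \<subseteq> Pow (space M)"
    using GM sets.sets_into_space by blast
  moreover have "A \<in> sigma_sets (space M) G"
  proof -
    have "{B u -` C \<inter> space M | u C. 0 \<le> u \<and> u \<le> min s T \<and> C \<in> sets borel} \<subseteq> G"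
    proof safe
      fix u and C :: "(real^'d) set" assume u: "0 \<le> u" "u \<le> min s T" "C \<in> sets borel"
      then have "\<exists>J C'. B u -` C \<inter> space M = cylinder J C' \<and> finite J \<and> J \<subseteq> {0..s} \<and> (\<forall>v\<in>J. C' v \<in> sets borel)"
        by (intro exI[of _ "{u}"] exI[of _ "\<lambda>_. C"]) auto
      then show "B u -` C \<inter> space M \<in> G"
        unfolding G_def by simp
    qed
    then have "{B u -` C \<inter> space M | u C. 0 \<le> u \<and> u \<le> min s T \<and> C \<in> sets borel} \<union> null_sets M \<subseteq> G"
      unfolding G_def by blast
    then show ?thesis
      using A unfolding sets_F by (rule sigma_sets_mono'[THEN subsetD])
  qed
  ultimately show ?thesis
  proof (induction rule: sigma_sets_induct_disjoint)
    case (basic A)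
    show ?case
    proof (cases "A \<in> null_sets M")
      case True
      then show ?thesis
        unfolding set_lebesgue_integral_def
        by (intro integral_eq_zero_AE) (auto dest!: AE_not_in elim!: eventually_mono)
    next
      case False
      then obtain J C where "A = cylinder J C" "finite J" "J \<subseteq> {0..s}" "\<forall>u\<in>J. C u \<in> sets borel"
        using basic unfolding G_def by blast
      then show ?thesis using cylinder_increment st by blast
    qed
  next
    case empty then show ?case by (simp add: set_lebesgue_integral_def)
  next
    case (compl A)
    have A: "A \<in> sets M" using compl GM sets.sigma_sets_subset by blast
    have "(\<integral>\<omega>\<in>space M. ?X \<omega> \<partial>M) = (\<integral>\<omega>\<in>space M - A. ?X \<omega> \<partial>M) + (\<integral>\<omega>\<in>A. ?X \<omega> \<partial>M)"
      using A sets.sets_into_space[OF A] by (subst set_integral_Un[OF _ int int, symmetric]) (auto simp: Un_absorb2)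
    moreover have "(\<integral>\<omega>\<in>space M. ?X \<omega> \<partial>M) = 0"
      using set_integral_space[OF integrable_increment[OF st]] expectation_increment[OF st] by metis
    ultimately show ?case using compl by simp
  next
    case (union A)
    then have A: "A k \<in> sets M" for k using GM sets.sigma_sets_subset by blast
    have "(\<integral>\<omega>\<in>(\<Union>k. A k). ?X \<omega> \<partial>M) = (\<Sum>k. \<integral>\<omega>\<in>A k. ?X \<omega> \<partial>M)"
      using A union(1) by (intro lebesgue_integral_countable_add int) (auto simp: disjoint_family_on_def)
    then show ?case using union by simp
  qed
qed

text \<open>Vanishing integrals over all events of \<open>F s\<close> mean that the conditional
  expectation of the increment is zero; the bounded factor \<eta> is then pulled out of it.\<close>

lemma integral_mult_increment:
  assumes \<eta>: "\<eta> \<in> borel_measurable (F s)" and C: "\<And>\<omega>. \<omega> \<in> space M \<Longrightarrow> \<bar>\<eta> \<omega>\<bar> \<le> C"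
    and st: "0 \<le> s" "s < t" "t \<le> T"
  shows "integrable M (\<lambda>\<omega>. \<eta> \<omega> * (B t \<omega> - B s \<omega>) $ i)"
    and "(\<integral>\<omega>. \<eta> \<omega> * (B t \<omega> - B s \<omega>) $ i \<partial>M) = 0"
proof -
  let ?X = "\<lambda>\<omega>. (B t \<omega> - B s \<omega>) $ i"
  interpret S: finite_measure_subalgebra M "F s"
    by unfold_locales (rule subalgebra_F)
  have X[measurable]: "integrable M ?X"
    by (rule integrable_increment[OF st])
  have m[measurable]: "\<eta> \<in> borel_measurable M"
    using \<eta> by (rule measurable_F)
  show int: "integrable M (\<lambda>\<omega>. \<eta> \<omega> * ?X \<omega>)"
  proof (rule Bochner_Integration.integrable_bound[of _ "\<lambda>\<omega>. C * ?X \<omega>"])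
    show "AE \<omega> in M. norm (\<eta> \<omega> * ?X \<omega>) \<le> norm (C * ?X \<omega>)"
      using C by (auto simp: abs_mult intro!: mult_right_mono AE_I2 intro: order_trans[OF _ abs_ge_self])
  qed (use X in auto)
  have "AE \<omega> in M. real_cond_exp M (F s) ?X \<omega> = 0"
    using X set_integral_increment[OF _ st] by (intro S.real_cond_exp_charact) auto
  then have "(\<integral>\<omega>. \<eta> \<omega> * real_cond_exp M (F s) ?X \<omega> \<partial>M) = (\<integral>\<omega>. 0 \<partial>M)"
    by (intro integral_cong_AE) auto
  then show "(\<integral>\<omega>. \<eta> \<omega> * ?X \<omega> \<partial>M) = 0"
    using S.real_cond_exp_intg(2)[OF int \<eta>] X by auto
qed

text \<open>Only null sets and preimages under the almost surely constant \<open>B 0\<close>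
  generate \<open>F 0\<close>. In a countable union either some member has probability 1 or all
  members are null.\<close>

lemma prob_F_0: "A \<in> sets (F 0) \<Longrightarrow> measure M A = 0 \<or> measure M A = 1"
proof -
  assume "A \<in> sets (F 0)"
  then show ?thesis
    unfolding sets_F
  proof (induction rule: sigma_sets.induct)
    case (Basic a)
    then consider "a \<in> null_sets M" | C where "a = B 0 -` C \<inter> space M" "C \<in> sets borel"
      using T_pos by force
    then show ?case
    proof cases
      case 1 then show ?thesis by (simp add: measure_eq_0_null_sets)
    next
      case 2
      have m: "B 0 \<in> borel_measurable M" using T_pos by (intro B_measurable) simp
      have "AE \<omega> in M. B 0 \<omega> = 0"
        using bm by (simp add: standard_brownian_motion_def)
      then have "AE \<omega> in M. \<omega> \<in> a \<longleftrightarrow> \<omega> \<in> (if 0 \<in> C then space M else {})"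
        using AE_space by eventually_elim (auto simp: 2)
      then have "measure M a = measure M (if 0 \<in> C then space M else {})"
        using 2 m by (intro measure_eq_AE) auto
      then show ?thesis by (auto simp: prob_space)
    qed
  next
    case Empty then show ?case by simp
  next
    case (Compl a)
    then have "a \<in> sets M" using sets_F_subset unfolding sets_F by blast
    then show ?case using Compl by (auto simp: prob_compl)
  next
    case (Union a)
    then have a: "a i \<in> sets M" for i using sets_F_subset unfolding sets_F by blast
    show ?case
    proof (cases "\<exists>i. measure M (a i) = 1")
      case True
      then obtain i where "measure M (a i) = 1" by blast
      then have "1 \<le> measure M (\<Union>i. a i)"
        using a by (metis UN_upper UNIV_I finite_measure_mono sets.countable_UN'' uncountable_def countableI_type)
      then show ?thesis using prob_le_1[of "\<Union>i. a i"] by linarith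
    next
      case False
      then have "a i \<in> null_sets M" for i
        using Union a by (metis emeasure_eq_measure ennreal_0 null_setsI)
      then have "(\<Union>i. a i) \<in> null_sets M" by blast
      then show ?thesis by (simp add: measure_eq_0_null_sets)
    qed
  qed
qed

text \<open>The event that \<open>X\<close> exceeds its mean has probability 0 or 1, and probability
  1 would make the mean exceed itself. So \<open>X\<close> stays below its mean almost surely, with
  a non-negative difference of integral zero.\<close>

lemma F_0_measurable_const:
  fixes X :: "'a \<Rightarrow> real"
  assumes X: "X \<in> borel_measurable (F 0)" "integrable M X"
  shows "AE \<omega> in M. X \<omega> = expectation X"
proof -
  let ?m = "expectation X"
  let ?A = "{\<omega> \<in> space M. ?m < X \<omega>}"
  have A: "?A \<in> sets (F 0)"
    using borel_measurable_less[OF borel_measurable_const X(1), of ?m] by (simp add: space_F)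
  have "AE \<omega> in M. X \<omega> \<le> ?m"
  proof (cases "measure M ?A = 0")
    case True
    then have "?A \<in> null_sets M"
      using in_sets_F[OF A] by (simp add: emeasure_eq_measure null_setsI)
    then show ?thesis
      by (auto intro: AE_I' simp: not_le)
  next
    case False
    then have "measure M ?A = 1" using prob_F_0[OF A] by blast
    then have "AE \<omega> in M. \<omega> \<in> ?A" by (metis AE_prob_1 )
    then have "AE \<omega> in M. ?m < X \<omega>" by auto
    then have "?m < ?m" by (rule expectation_greater[OF X(2)])
    then show ?thesis by simp
  qed
  moreover have "(\<integral>\<omega>. ?m - X \<omega> \<partial>M) = 0"
    using X(2) by (simp add: prob_space)
  ultimately have "AE \<omega> in M. ?m - X \<omega> = 0"
    using X(2) by (subst integral_nonneg_eq_0_iff_AE[symmetric]) auto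
  then show ?thesis by auto
qed

section \<open>Stopping times in [0, T] and stopped progressive processes\<close>

abbreviation prog :: "(real \<Rightarrow> 'a \<Rightarrow> 'b::topological_space) \<Rightarrow> bool" where
  "prog Y \<equiv> (\<lambda>(s, \<omega>). Y s \<omega>) \<in> borel_measurable (progressive_sigma M T B)"

text \<open>The range condition holds on every path, so that a process on [0, T] may be evaluated at
  \<sigma> without an exceptional set.\<close>

definition stop :: "('a \<Rightarrow> real) \<Rightarrow> bool" where
  "stop \<sigma> \<longleftrightarrow> stopping_time F \<sigma> \<and> (\<forall>\<omega>\<in>space M. \<sigma> \<omega> \<in> {0..T})"

lemma stop_range: "stop \<sigma> \<Longrightarrow> \<omega> \<in> space M \<Longrightarrow> 0 \<le> \<sigma> \<omega> \<and> \<sigma> \<omega> \<le> T"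
  by (auto simp: stop_def)

lemma stop_const: "t \<in> {0..T} \<Longrightarrow> stop (\<lambda>_. t)"
  by (simp add: stop_def stopping_time_const)

lemma stop_measurable: "stop \<sigma> \<Longrightarrow> \<sigma> \<in> borel_measurable M"
  unfolding stop_def by (intro measurable_stopping_time[where F=F]) (auto simp: space_F sets_F_subset)

lemma stop_le: "stop \<sigma> \<Longrightarrow> s \<le> t \<Longrightarrow> {\<omega>\<in>space M. \<sigma> \<omega> \<le> s} \<in> sets (F t)"
  using stopping_time_le_const[of \<sigma> s t] unfolding stop_def pred_def space_F by blast

lemma pre_sigmaI:
  assumes \<sigma>: "stop \<sigma>" and A: "A \<subseteq> space M"
    and le: "\<And>t. t \<in> {0..T} \<Longrightarrow> {\<omega>\<in>A. \<sigma> \<omega> \<le> t} \<in> sets (F t)"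
  shows "A \<in> sets (pre_sigma \<sigma>)"
proof (rule sets_pre_sigmaI)
  show "stopping_time F \<sigma>" using \<sigma> by (simp add: stop_def)
  fix t
  consider "t < 0" | "t \<in> {0..T}" | "t > T" by force
  then show "{\<omega>\<in>A. \<sigma> \<omega> \<le> t} \<in> sets (F t)"
  proof cases
    case 1
    then have "{\<omega>\<in>A. \<sigma> \<omega> \<le> t} = {}" using stop_range[OF \<sigma>] A by force
    then show ?thesis by (simp only: sets.empty_sets)
  next
    case 3
    then have "{\<omega>\<in>A. \<sigma> \<omega> \<le> t} = {\<omega>\<in>A. \<sigma> \<omega> \<le> T}" using stop_range[OF \<sigma>] A by force
    then show ?thesis using le[of T] T_pos 3 by (simp add: F_eq_T[of t])
  qed (rule le)
qed

lemma pre_sigmaD: "stop \<sigma> \<Longrightarrow> A \<in> sets (pre_sigma \<sigma>) \<Longrightarrow> {\<omega>\<in>A. \<sigma> \<omega> \<le> t} \<in> sets (F t)"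
  unfolding stop_def by (blast dest: sets_pre_sigmaD)

lemma pre_sigma_subset:
  assumes \<sigma>: "stop \<sigma>" and A: "A \<in> sets (pre_sigma \<sigma>)"
  shows "A \<in> sets M"
proof -
  have "A \<subseteq> space M"
    using sets.sets_into_space[OF A] by (simp add: space_pre_sigma)
  then have "{\<omega>\<in>A. \<sigma> \<omega> \<le> T} = A" using stop_range[OF \<sigma>] by force
  then show ?thesis using pre_sigmaD[OF \<sigma> A, of T] by (metis in_sets_F)
qed

lemma subalgebra_pre_sigma: "stop \<sigma> \<Longrightarrow> subalgebra M (pre_sigma \<sigma>)"
  unfolding subalgebra_def by (auto simp: space_pre_sigma dest: pre_sigma_subset)

lemma measurable_pre_sigma: "stop \<sigma> \<Longrightarrow> X \<in> measurable (pre_sigma \<sigma>) N \<Longrightarrow> X \<in> measurable M N"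
  by (rule measurable_from_subalg[OF subalgebra_pre_sigma])

lemma pre_sigma_mono:
  assumes "stop \<sigma>" "stop \<tau>" "\<And>\<omega>. \<omega> \<in> space M \<Longrightarrow> \<sigma> \<omega> \<le> \<tau> \<omega>"
  shows "sets (pre_sigma \<sigma>) \<subseteq> sets (pre_sigma \<tau>)"
  using assms unfolding stop_def by (intro mono_pre_sigma) auto

lemma measurable_pre_sigma_mono:
  assumes "stop \<sigma>" "stop \<tau>" "\<And>\<omega>. \<omega> \<in> space M \<Longrightarrow> \<sigma> \<omega> \<le> \<tau> \<omega>"
    and "X \<in> measurable (pre_sigma \<sigma>) N"
  shows "X \<in> measurable (pre_sigma \<tau>) N"
proof -
  have "subalgebra (pre_sigma \<tau>) (pre_sigma \<sigma>)"
    unfolding subalgebra_def using pre_sigma_mono[OF assms(1-3)] by (simp add: space_pre_sigma)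
  then show ?thesis using assms(4) by (rule measurable_from_subalg)
qed

lemma measurable_pre_sigma_const:
  assumes "t \<in> {0..T}" and X: "X \<in> measurable (pre_sigma (\<lambda>_. t)) N"
  shows "X \<in> measurable (F t) N"
proof -
  have "A \<in> sets (F t)" if "A \<in> sets (pre_sigma (\<lambda>_. t))" for A
    using pre_sigmaD[OF stop_const[OF assms(1)] that, of t] by simp
  then have "subalgebra (F t) (pre_sigma (\<lambda>_. t))"
    unfolding subalgebra_def by (auto simp: space_pre_sigma space_F)
  then show ?thesis using X by (rule measurable_from_subalg)
qed

lemma space_progressive: "space (progressive_sigma M T B) = {0..T} \<times> space M"
  unfolding progressive_sigma_def by (rule space_measure_of) auto

text \<open>On the event \<sigma> \<le> t the stopped value factors through \<omega> \<mapsto> (min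
  (\<sigma> \<omega>) t, \<omega>), which is measurable from \<open>F t\<close> into the strip on
  which progressive sets are measurable.\<close>

lemma measurable_stopped:
  assumes Y: "prog Y" and \<sigma>: "stop \<sigma>"
  shows "(\<lambda>\<omega>. Y (\<sigma> \<omega>) \<omega>) \<in> borel_measurable (pre_sigma \<sigma>)"
proof (rule measurableI)
  fix S :: "'b set" assume S: "S \<in> sets borel"
  let ?P = "(\<lambda>(s, \<omega>). Y s \<omega>) -` S \<inter> space (progressive_sigma M T B)"
  have P: "?P \<in> sets (progressive_sigma M T B)"
    using Y S by (rule measurable_sets)
  show "(\<lambda>\<omega>. Y (\<sigma> \<omega>) \<omega>) -` S \<inter> space (pre_sigma \<sigma>) \<in> sets (pre_sigma \<sigma>)"
    unfolding space_pre_sigma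
  proof (rule pre_sigmaI[OF \<sigma>])
    fix t assume t: "t \<in> {0..T}"
    let ?R = "restrict_space borel {0..t} \<Otimes>\<^sub>M F t"
    have P': "?P \<inter> ({0..t} \<times> space M) \<in> sets ?R"
      using P t unfolding sets_progressive_sigma by blast
    have "(\<lambda>\<omega>. min (\<sigma> \<omega>) t) \<in> borel_measurable (F t)"
    proof (rule borel_measurableI_le)
      fix a
      show "{\<omega>\<in>space (F t). min (\<sigma> \<omega>) t \<le> a} \<in> sets (F t)"
      proof (cases "a < t")
        case True
        then have "{\<omega>\<in>space (F t). min (\<sigma> \<omega>) t \<le> a} = {\<omega>\<in>space M. \<sigma> \<omega> \<le> a}"
          by (auto simp: space_F)
        then show ?thesis using stop_le[OF \<sigma>, of a t] True by simp
      next
        case False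
        then have "{\<omega>\<in>space (F t). min (\<sigma> \<omega>) t \<le> a} = space (F t)" by auto
        then show ?thesis by simp
      qed
    qed
    then have "(\<lambda>\<omega>. (min (\<sigma> \<omega>) t, \<omega>)) \<in> measurable (F t) ?R"
      using stop_range[OF \<sigma>] t
      by (intro measurable_Pair measurable_restrict_space2 measurable_ident) (auto simp: space_F)
    from measurable_sets[OF this P']
    have "(\<lambda>\<omega>. (min (\<sigma> \<omega>) t, \<omega>)) -` (?P \<inter> ({0..t} \<times> space M)) \<inter> space M \<inter> {\<omega>\<in>space M. \<sigma> \<omega> \<le> t} \<in> sets (F t)"
      using stop_le[OF \<sigma>, of t t] unfolding space_F by (rule sets.Int) simp
    also have "(\<lambda>\<omega>. (min (\<sigma> \<omega>) t, \<omega>)) -` (?P \<inter> ({0..t} \<times> space M)) \<inter> space M \<inter> {\<omega>\<in>space M. \<sigma> \<omega> \<le> t}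
      = {\<omega> \<in> (\<lambda>\<omega>. Y (\<sigma> \<omega>) \<omega>) -` S \<inter> space M. \<sigma> \<omega> \<le> t}"
      using stop_range[OF \<sigma>] t by (auto simp: space_progressive min_def)
    finally show "{\<omega> \<in> (\<lambda>\<omega>. Y (\<sigma> \<omega>) \<omega>) -` S \<inter> space M. \<sigma> \<omega> \<le> t} \<in> sets (F t)" .
  qed auto
qed simp

lemma measurable_prog:
  assumes "prog Y" "t \<in> {0..T}"
  shows "Y t \<in> borel_measurable (F t)"
  using measurable_pre_sigma_const[OF assms(2) measurable_stopped[OF assms(1) stop_const[OF assms(2)]]] .

section \<open>The martingale property of the Ito integral\<close>

lemma inner_increment:
  assumes \<eta>: "\<eta> \<in> borel_measurable (F a)" and C: "\<And>\<omega>. \<omega> \<in> space M \<Longrightarrow> norm (\<eta> \<omega>) \<le> C"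
    and ab: "0 \<le> a" "a \<le> b" "b \<le> T"
  shows "integrable M (\<lambda>\<omega>. \<eta> \<omega> \<bullet> (B b \<omega> - B a \<omega>))" (is ?int)
    and "(\<integral>\<omega>. \<eta> \<omega> \<bullet> (B b \<omega> - B a \<omega>) \<partial>M) = 0" (is ?zero)
proof -
  have "?int \<and> ?zero"
  proof (cases "a = b")
    case True then show ?thesis by simp
  next
    case False
    then have "a < b" using ab by simp
    have m: "(\<lambda>\<omega>. \<eta> \<omega> $ i) \<in> borel_measurable (F a)" for i
      using \<eta> by (rule measurable_compose) measurable
    have b: "\<bar>\<eta> \<omega> $ i\<bar> \<le> C" if "\<omega> \<in> space M" for i \<omega>
      using component_le_norm_cart[of "\<eta> \<omega>" i] C[OF that] by simp
    have i: "integrable M (\<lambda>\<omega>. \<eta> \<omega> $ i * (B b \<omega> - B a \<omega>) $ i)"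
      "(\<integral>\<omega>. \<eta> \<omega> $ i * (B b \<omega> - B a \<omega>) $ i \<partial>M) = 0" for i
      by (rule integral_mult_increment[OF m b ab(1) \<open>a < b\<close> ab(3)], assumption)+
    show ?thesis
      unfolding inner_vec_def inner_real_def using i by simp
  qed
  then show ?int ?zero by auto
qed

text \<open>If [p, q] and [s, t] do not overlap, the term does not move between \<open>s\<close> and
  \<open>t\<close>. Otherwise it moves by \<zeta> times the increment over the overlap, and the
  indicator of \<open>A\<close> can be absorbed into \<zeta>, since both are known when the overlap
  begins.\<close>

lemma simple_term_martingale:
  assumes \<zeta>: "\<zeta> \<in> borel_measurable (F p)" and C: "\<And>\<omega>. \<omega> \<in> space M \<Longrightarrow> norm (\<zeta> \<omega>) \<le> C"
    and pq: "0 \<le> p" "p \<le> q" "q \<le> T" and t: "t \<in> {0..T}"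
  defines "\<Delta> \<equiv> \<lambda>r \<omega>. \<zeta> \<omega> \<bullet> (B (min q r) \<omega> - B (min p r) \<omega>)"
  shows "integrable M (\<Delta> t)"
    and "0 \<le> s \<Longrightarrow> s \<le> t \<Longrightarrow> A \<in> sets (F s) \<Longrightarrow> (\<integral>\<omega>\<in>A. \<Delta> t \<omega> \<partial>M) = (\<integral>\<omega>\<in>A. \<Delta> s \<omega> \<partial>M)"
proof -
  have int: "integrable M (\<Delta> r)" if "r \<in> {0..T}" for r
  proof (cases "r \<le> p")
    case True then show ?thesis using pq by (simp add: \<Delta>_def)
  next
    case False
    then show ?thesis
      unfolding \<Delta>_def using inner_increment(1)[OF \<zeta> C, of "min q r"] pq by (simp add: min_absorb1)
  qed
  show "integrable M (\<Delta> t)" by (rule int[OF t])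
  assume s: "0 \<le> s" "s \<le> t" and A: "A \<in> sets (F s)"
  have A': "A \<in> sets M" using A by (rule in_sets_F)
  consider "t \<le> p" | "q \<le> s" | "p < t" "s < q" by linarith
  then show "(\<integral>\<omega>\<in>A. \<Delta> t \<omega> \<partial>M) = (\<integral>\<omega>\<in>A. \<Delta> s \<omega> \<partial>M)"
  proof cases
    case 1
    then have "\<Delta> t = \<Delta> s" using s pq by (simp add: \<Delta>_def fun_eq_iff min_absorb2)
    then show ?thesis by simp
  next
    case 2
    then have "\<Delta> t = \<Delta> s" using s pq by (simp add: \<Delta>_def fun_eq_iff min_absorb1)
    then show ?thesis by simp
  next
    case 3
    let ?a = "max p s" and ?b = "min q t"
    have eq: "\<Delta> t \<omega> - \<Delta> s \<omega> = \<zeta> \<omega> \<bullet> (B ?b \<omega> - B ?a \<omega>)" for \<omega>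
    proof (cases "s \<le> p")
      case True
      then show ?thesis using 3 pq s by (simp add: \<Delta>_def min_absorb1 min_absorb2 max_absorb1)
    next
      case False
      then show ?thesis using 3 pq s
        by (simp add: \<Delta>_def min_absorb1 min_absorb2 max_absorb2 inner_diff_right)
    qed
    have ab: "0 \<le> ?a" "?a \<le> ?b" "?b \<le> T" using 3 s pq t by auto
    have "\<zeta> \<in> borel_measurable (F ?a)"
      by (rule measurable_from_subalg[OF _ \<zeta>]) (use sets_F_mono[of p ?a] in \<open>auto simp: subalgebra_def space_F\<close>)
    moreover have "A \<in> sets (F ?a)" using A sets_F_mono[of s ?a] by auto
    ultimately have "(\<lambda>\<omega>. indicat_real A \<omega> *\<^sub>R \<zeta> \<omega>) \<in> borel_measurable (F ?a)"
      by (intro borel_measurable_scaleR borel_measurable_indicator)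
    moreover have "norm (indicat_real A \<omega> *\<^sub>R \<zeta> \<omega>) \<le> C" if "\<omega> \<in> space M" for \<omega>
      using C[OF that] norm_ge_zero[of "\<zeta> \<omega>"] by (auto simp: indicator_def simp del: norm_ge_zero)
    ultimately have "(\<integral>\<omega>. (indicat_real A \<omega> *\<^sub>R \<zeta> \<omega>) \<bullet> (B ?b \<omega> - B ?a \<omega>) \<partial>M) = 0"
      using ab by (rule inner_increment(2))
    then have "(\<integral>\<omega>\<in>A. \<Delta> t \<omega> - \<Delta> s \<omega> \<partial>M) = 0"
      unfolding eq set_lebesgue_integral_def by simp
    moreover have "set_integrable M A (\<Delta> r)" if "r \<in> {0..T}" for r
      unfolding set_integrable_def using int[OF that] A' by (rule integrable_mult_indicator[rotated])
    ultimately show ?thesis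
      using s t by (subst (asm) set_integral_diff(2)) auto
  qed
qed

lemma simple_integrand_partition:
  assumes S: "simple_integrand M T B (n, p, \<zeta>)"
  shows "i < n \<Longrightarrow> p i \<le> p (Suc i)" and "i \<le> n \<Longrightarrow> 0 \<le> p i" and "i \<le> n \<Longrightarrow> p i \<le> T"
proof -
  show mono: "p i \<le> p (Suc i)" if "i < n" for i
    using S that by simp
  have ends: "0 \<le> p 0" "p n \<le> T"
    using S by simp_all
  show "0 \<le> p i" if "i \<le> n"
    using that
  proof (induction i)
    case (Suc i)
    then show ?case using mono[of i] by simp
  qed (rule ends)
  show "p i \<le> T" if "i \<le> n"
    using that
  proof (induction rule: inc_induct)
    case (step i)
    then show ?case using mono[of i] by simp
  qed (rule ends)
qed

lemma simple_integral_martingale: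
  assumes S: "simple_integrand M T B S" and t: "t \<in> {0..T}"
  shows "integrable M (simple_integral B S t)"
    and "0 \<le> s \<Longrightarrow> s \<le> t \<Longrightarrow> A \<in> sets (F s) \<Longrightarrow>
      (\<integral>\<omega>\<in>A. simple_integral B S t \<omega> \<partial>M) = (\<integral>\<omega>\<in>A. simple_integral B S s \<omega> \<partial>M)"
proof -
  obtain n p \<zeta> where S_eq: "S = (n, p, \<zeta>)" by (cases S) auto
  define \<Delta> where "\<Delta> i r \<omega> = \<zeta> i \<omega> \<bullet> (B (min (p (Suc i)) r) \<omega> - B (min (p i) r) \<omega>)" for i r \<omega>
  have eq: "simple_integral B S r = (\<lambda>\<omega>. \<Sum>i<n. \<Delta> i r \<omega>)" for r
    by (simp add: S_eq \<Delta>_def fun_eq_iff)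
  have m: "integrable M (\<Delta> i r)" "0 \<le> s' \<Longrightarrow> s' \<le> r \<Longrightarrow> A' \<in> sets (F s') \<Longrightarrow> (\<integral>\<omega>\<in>A'. \<Delta> i r \<omega> \<partial>M) = (\<integral>\<omega>\<in>A'. \<Delta> i s' \<omega> \<partial>M)"
    if "i < n" "r \<in> {0..T}" for i r s' A'
  proof -
    have \<zeta>: "\<zeta> i \<in> borel_measurable (F (p i))" and "\<exists>C. \<forall>\<omega>\<in>space M. norm (\<zeta> i \<omega>) \<le> C"
      using S that(1) by (simp_all add: S_eq)
    then obtain C where C: "\<forall>\<omega>\<in>space M. norm (\<zeta> i \<omega>) \<le> C"
      by (elim exE)
    have p: "0 \<le> p i" "p i \<le> p (Suc i)" "p (Suc i) \<le> T"
      using that(1)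
      by (auto intro: simple_integrand_partition[OF S[unfolded S_eq]])
    show "integrable M (\<Delta> i r)"
      unfolding \<Delta>_def by (rule simple_term_martingale(1)[OF \<zeta> _ p that(2)]) (rule C[rule_format])
    show "(\<integral>\<omega>\<in>A'. \<Delta> i r \<omega> \<partial>M) = (\<integral>\<omega>\<in>A'. \<Delta> i s' \<omega> \<partial>M)" if "0 \<le> s'" "s' \<le> r" "A' \<in> sets (F s')"
      unfolding \<Delta>_def by (rule simple_term_martingale(2)[OF \<zeta> _ p \<open>r \<in> {0..T}\<close> that]) (rule C[rule_format])
  qed
  show "integrable M (simple_integral B S t)"
    unfolding eq using t by (intro Bochner_Integration.integrable_sum m(1)) auto
  assume s: "0 \<le> s" "s \<le> t" and A: "A \<in> sets (F s)"
  have sum: "(\<integral>\<omega>\<in>A. (\<Sum>i<n. \<Delta> i r \<omega>) \<partial>M) = (\<Sum>i<n. \<integral>\<omega>\<in>A. \<Delta> i r \<omega> \<partial>M)" if "r \<in> {0..T}" for r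
    unfolding set_lebesgue_integral_def scaleR_sum_right
    using m(1) that in_sets_F[OF A] by (intro Bochner_Integration.integral_sum integrable_mult_indicator) auto
  show "(\<integral>\<omega>\<in>A. simple_integral B S t \<omega> \<partial>M) = (\<integral>\<omega>\<in>A. simple_integral B S s \<omega> \<partial>M)"
  proof -
    have "(\<Sum>i<n. \<integral>\<omega>\<in>A. \<Delta> i t \<omega> \<partial>M) = (\<Sum>i<n. \<integral>\<omega>\<in>A. \<Delta> i s \<omega> \<partial>M)"
      using s t A by (intro sum.cong m(2)) auto
    then show ?thesis
      unfolding eq using s t by (simp add: sum)
  qed
qed

text \<open>On a probability space mean square convergence implies convergence in mean. The limit is
  integrable because it lies at finite distance in mean from an integrable variable.\<close>

lemma set_integral_tendsto_of_L2:
  fixes f :: "'a \<Rightarrow> real"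
  assumes u: "\<And>k. integrable M (u k)" and f: "f \<in> borel_measurable M"
    and lim: "(\<lambda>k. \<integral>\<^sup>+\<omega>. ennreal ((u k \<omega> - f \<omega>)\<^sup>2) \<partial>M) \<longlonglongrightarrow> 0"
  shows "integrable M f" and "A \<in> sets M \<Longrightarrow> (\<lambda>k. \<integral>\<omega>\<in>A. u k \<omega> \<partial>M) \<longlonglongrightarrow> (\<integral>\<omega>\<in>A. f \<omega> \<partial>M)"
proof -
  have [measurable]: "u k \<in> borel_measurable M" for k using u by auto
  note f[measurable]
  have L1: "eventually (\<lambda>k. (\<integral>\<^sup>+\<omega>. ennreal \<bar>u k \<omega> - f \<omega>\<bar> \<partial>M) < ennreal (2 * e)) sequentially" if e: "e > 0" for e
  proof -
    have "eventually (\<lambda>k. (\<integral>\<^sup>+\<omega>. ennreal ((u k \<omega> - f \<omega>)\<^sup>2) \<partial>M) < ennreal (e\<^sup>2)) sequentially"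
      using lim e by (intro order_tendstoD(2)) auto
    then show ?thesis
    proof eventually_elim
      case (elim k)
      \<comment> \<open>A weighted Young inequality: a second moment below e^2 yields a first
        absolute moment below e + e^2 / e = 2 e.\<close>
      have le: "\<bar>x\<bar> \<le> e + x\<^sup>2 / e" for x :: real
      proof -
        have "0 \<le> (\<bar>x\<bar> - e / 2)\<^sup>2" by simp
        then have "\<bar>x\<bar> * e \<le> x\<^sup>2 + e\<^sup>2 / 4" by (simp add: power2_eq_square algebra_simps)
        also have "\<dots> \<le> (e + x\<^sup>2 / e) * e" using e by (simp add: power2_eq_square algebra_simps)
        finally show ?thesis using e by simp
      qed
      have "(\<integral>\<^sup>+\<omega>. ennreal \<bar>u k \<omega> - f \<omega>\<bar> \<partial>M) \<le> (\<integral>\<^sup>+\<omega>. ennreal e + ennreal (1 / e) * ennreal ((u k \<omega> - f \<omega>)\<^sup>2) \<partial>M)"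
        using e le by (intro nn_integral_mono) (simp add: ennreal_mult[symmetric] ennreal_plus[symmetric] del: ennreal_plus)
      also have "\<dots> = ennreal e + ennreal (1 / e) * (\<integral>\<^sup>+\<omega>. ennreal ((u k \<omega> - f \<omega>)\<^sup>2) \<partial>M)"
        by (simp add: nn_integral_add nn_integral_cmult emeasure_space_1)
      also have "\<dots> < ennreal e + ennreal (1 / e) * ennreal (e\<^sup>2)"
        using elim e by (intro ennreal_add_left_cancel_less[THEN iffD2] conjI ennreal_mult_strict_left_mono) auto
      also have "\<dots> = ennreal (2 * e)"
        using e by (simp add: ennreal_mult[symmetric] ennreal_plus[symmetric] power2_eq_square del: ennreal_plus)
      finally show ?case .
    qed
  qed
  from L1[of 1] obtain k where "(\<integral>\<^sup>+\<omega>. ennreal \<bar>u k \<omega> - f \<omega>\<bar> \<partial>M) < ennreal (2 * 1)"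
    by (auto simp: eventually_sequentially)
  then have "(\<integral>\<^sup>+\<omega>. ennreal (norm (u k \<omega> - f \<omega>)) \<partial>M) < \<infinity>"
    by (auto intro: less_trans)
  then have "integrable M (\<lambda>\<omega>. u k \<omega> - f \<omega>)"
    by (intro integrableI_bounded) auto
  from Bochner_Integration.integrable_diff[OF u[of k] this]
  show int: "integrable M f" by simp
  assume A: "A \<in> sets M"
  have ind: "integrable M (\<lambda>\<omega>. indicat_real A \<omega> *\<^sub>R g \<omega>)" if "integrable M g" for g :: "'a \<Rightarrow> real"
    using A that by (rule integrable_mult_indicator)
  show "(\<lambda>k. \<integral>\<omega>\<in>A. u k \<omega> \<partial>M) \<longlonglongrightarrow> (\<integral>\<omega>\<in>A. f \<omega> \<partial>M)"
    unfolding set_lebesgue_integral_def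
  proof (rule tendsto_L1_int[OF ind[OF u] ind[OF int]], rule order_tendstoI)
    fix a :: ennreal assume "0 < a"
    then obtain e where e: "0 < e" "ennreal (2 * e) \<le> a"
      by (cases a) (use that[of "enn2real a / 2"] that[of 1] in auto)
    have "(\<integral>\<^sup>+\<omega>. norm (indicat_real A \<omega> *\<^sub>R u k \<omega> - indicat_real A \<omega> *\<^sub>R f \<omega>) \<partial>M) \<le> (\<integral>\<^sup>+\<omega>. ennreal \<bar>u k \<omega> - f \<omega>\<bar> \<partial>M)" for k
      by (intro nn_integral_mono) (auto simp: indicator_def)
    then show "\<forall>\<^sub>F k in sequentially. (\<integral>\<^sup>+\<omega>. norm (indicat_real A \<omega> *\<^sub>R u k \<omega> - indicat_real A \<omega> *\<^sub>R f \<omega>) \<partial>M) < a"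
      using L1[OF e(1)] e(2) by (auto elim!: eventually_mono intro: le_less_trans less_le_trans)
  qed simp
qed

text \<open>The identity holds for the approximating simple integrals, and both sides pass to the
  limit. Comparing with the terminal time gives the martingale in closed form, which is what
  optional stopping consumes.\<close>

lemma ito_integral_martingale:
  assumes I: "ito_integral M T B Z I" and t: "t \<in> {0..T}"
  shows "integrable M (I t)"
    and "A \<in> sets (F t) \<Longrightarrow> (\<integral>\<omega>\<in>A. I t \<omega> \<partial>M) = (\<integral>\<omega>\<in>A. I T \<omega> \<partial>M)"
proof -
  obtain S where S: "\<And>k. simple_integrand M T B (S k)"
    and lim: "\<And>r. r \<in> {0..T} \<Longrightarrow> (\<lambda>k. \<integral>\<^sup>+\<omega>. ennreal ((simple_integral B (S k) r \<omega> - I r \<omega>)\<^sup>2) \<partial>M) \<longlonglongrightarrow> 0"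
    and prog: "prog I"
    using I unfolding ito_integral_def by blast
  have m: "I r \<in> borel_measurable M" if "r \<in> {0..T}" for r
    using measurable_prog[OF prog that] by (rule measurable_F)
  note L = set_integral_tendsto_of_L2[OF simple_integral_martingale(1)[OF S] m lim]
  show "integrable M (I t)" using t by (intro L(1)) auto
  assume A: "A \<in> sets (F t)"
  have T: "T \<in> {0..T}" using T_pos by simp
  have "(\<lambda>k. \<integral>\<omega>\<in>A. simple_integral B (S k) T \<omega> \<partial>M) \<longlonglongrightarrow> (\<integral>\<omega>\<in>A. I T \<omega> \<partial>M)"
    using in_sets_F[OF A] T by (intro L(2)) auto
  moreover have "(\<lambda>k. \<integral>\<omega>\<in>A. simple_integral B (S k) t \<omega> \<partial>M) \<longlonglongrightarrow> (\<integral>\<omega>\<in>A. I t \<omega> \<partial>M)"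
    using in_sets_F[OF A] t by (intro L(2)) auto
  moreover have "(\<integral>\<omega>\<in>A. simple_integral B (S k) T \<omega> \<partial>M) = (\<integral>\<omega>\<in>A. simple_integral B (S k) t \<omega> \<partial>M)" for k
    using simple_integral_martingale(2)[OF S T _ _ A] t by simp
  ultimately show "(\<integral>\<omega>\<in>A. I t \<omega> \<partial>M) = (\<integral>\<omega>\<in>A. I T \<omega> \<partial>M)"
    using LIMSEQ_unique by simp
qed

section \<open>Dominated paths and optional stopping\<close>

lemma closure_rationals_interval: "closure ({0..T} \<inter> \<rat>) = {0..T}"
proof (rule antisym)
  show "closure ({0..T} \<inter> \<rat>) \<subseteq> {0..T}"
    by (rule closure_minimal[OF Int_lower1 closed_atLeastAtMost])
  show "{0..T} \<subseteq> closure ({0..T} \<inter> \<rat>)"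
  proof
    fix t assume t: "t \<in> {0..T}"
    show "t \<in> closure ({0..T} \<inter> \<rat>)"
      unfolding closure_approachable
    proof (intro allI impI)
      fix e :: real assume e: "e > 0"
      have "max 0 (t - e) < min T (t + e)" using t e T_pos by auto
      then obtain q where "q \<in> \<rat>" "max 0 (t - e) < q" "q < min T (t + e)"
        using Rats_dense_in_real by blast
      then have "q \<in> {0..T} \<inter> \<rat>" "dist q t < e"
        by (auto simp: dist_real_def)
      then show "\<exists>y\<in>{0..T} \<inter> \<rat>. dist y t < e"
        by (rule bexI[rotated])
    qed
  qed
qed

text \<open>The supremum is taken over rational times to be measurable, and continuity extends the
  bound to all times. The square is traded for a linear bound by \<bar>y\<bar> \<le> 1 + y^2, which
  explains the summand 1.\<close>

lemma Sc2_dominated: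
  assumes Y: "Sc2_process M T B Y"
  shows "\<exists>w. integrable M w \<and> (AE \<omega> in M. \<forall>t\<in>{0..T}. \<bar>Y t \<omega>\<bar> \<le> w \<omega>)"
proof -
  define Q where "Q = {0..T} \<inter> \<rat>"
  have Q: "countable Q" "Q \<subseteq> {0..T}" "closure Q = {0..T}"
    using countable_rat by (auto simp: Q_def closure_rationals_interval)
  define G where "G \<omega> = (SUP q\<in>Q. ennreal (\<bar>Y q \<omega>\<bar>\<^sup>2))" for \<omega>
  have prog: "prog Y" and cont: "\<And>\<omega>. \<omega> \<in> space M \<Longrightarrow> continuous_on {0..T} (\<lambda>t. Y t \<omega>)"
    and fin: "(\<integral>\<^sup>+\<omega>. (SUP t\<in>{0..T}. ennreal (\<bar>Y t \<omega>\<bar>\<^sup>2)) \<partial>M) < \<infinity>"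
    using Y by (auto simp: Sc2_process_def)
  have Yq: "Y q \<in> borel_measurable M" if "q \<in> Q" for q
    using measurable_F[OF measurable_prog[OF prog]] that Q by blast
  have G[measurable]: "G \<in> borel_measurable M"
    unfolding G_def using Q(1) by (rule borel_measurable_SUP) (use Yq in measurable)
  have "(\<integral>\<^sup>+\<omega>. G \<omega> \<partial>M) \<le> (\<integral>\<^sup>+\<omega>. (SUP t\<in>{0..T}. ennreal (\<bar>Y t \<omega>\<bar>\<^sup>2)) \<partial>M)"
    unfolding G_def using Q by (intro nn_integral_mono SUP_subset_mono) auto
  also note fin
  finally have G_fin: "(\<integral>\<^sup>+\<omega>. G \<omega> \<partial>M) < \<infinity>" .
  have AE: "AE \<omega> in M. G \<omega> \<noteq> \<infinity>"
    using G_fin by (intro nn_integral_PInf_AE) auto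
  have "(\<integral>\<^sup>+\<omega>. ennreal (enn2real (G \<omega>)) \<partial>M) \<le> (\<integral>\<^sup>+\<omega>. G \<omega> \<partial>M)"
    by (intro nn_integral_mono) (auto simp: ennreal_enn2real_if)
  then have "integrable M (\<lambda>\<omega>. enn2real (G \<omega>))"
    using G_fin by (intro integrableI_nonneg) (auto intro: le_less_trans)
  then have "integrable M (\<lambda>\<omega>. 1 + enn2real (G \<omega>))"
    by simp
  moreover have "AE \<omega> in M. \<forall>t\<in>{0..T}. \<bar>Y t \<omega>\<bar> \<le> 1 + enn2real (G \<omega>)"
    using AE AE_space
  proof eventually_elim
    case (elim \<omega>)
    have "norm (Y q \<omega>) \<le> 1 + enn2real (G \<omega>)" if "q \<in> Q" for q
    proof -
      have "ennreal (\<bar>Y q \<omega>\<bar>\<^sup>2) \<le> G \<omega>"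
        unfolding G_def using that by (rule SUP_upper)
      also have "G \<omega> = ennreal (enn2real (G \<omega>))"
        using elim by (simp add: less_top)
      finally have "\<bar>Y q \<omega>\<bar>\<^sup>2 \<le> enn2real (G \<omega>)"
        by (simp add: ennreal_le_iff)
      moreover have "0 \<le> (\<bar>Y q \<omega>\<bar> - 1)\<^sup>2" by simp
      then have "2 * \<bar>Y q \<omega>\<bar> \<le> 1 + \<bar>Y q \<omega>\<bar>\<^sup>2" by (simp add: power2_eq_square algebra_simps)
      moreover have "norm (Y q \<omega>) = \<bar>Y q \<omega>\<bar>" by simp
      ultimately show ?thesis by linarith
    qed
    then show ?case
      using continuous_on_closure_norm_le[of Q "\<lambda>t. Y t \<omega>" "1 + enn2real (G \<omega>)"] cont[OF elim(2)] Q(3)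
      by auto
  qed
  ultimately show ?thesis by blast
qed

text \<open>The stopping time is approximated from above by its grid values. For these the claim is
  a finite sum of martingale identities, and path continuity with the dominating variable
  \<open>w\<close> gives the limit.\<close>

lemma optional_stopping:
  fixes I :: "real \<Rightarrow> 'a \<Rightarrow> real"
  assumes prog: "prog I" and cont: "\<And>\<omega>. \<omega> \<in> space M \<Longrightarrow> continuous_on {0..T} (\<lambda>t. I t \<omega>)"
    and int: "\<And>t. t \<in> {0..T} \<Longrightarrow> integrable M (I t)"
    and mart: "\<And>t A. t \<in> {0..T} \<Longrightarrow> A \<in> sets (F t) \<Longrightarrow> (\<integral>\<omega>\<in>A. I t \<omega> \<partial>M) = (\<integral>\<omega>\<in>A. I T \<omega> \<partial>M)"
    and w: "integrable M w" "AE \<omega> in M. \<forall>t\<in>{0..T}. \<bar>I t \<omega>\<bar> \<le> w \<omega>"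
    and \<sigma>: "stop \<sigma>" and A: "A \<in> sets (pre_sigma \<sigma>)"
  shows "(\<integral>\<omega>\<in>A. I (\<sigma> \<omega>) \<omega> \<partial>M) = (\<integral>\<omega>\<in>A. I T \<omega> \<partial>M)"
proof -
  have AM: "A \<in> sets M" using \<sigma> A by (rule pre_sigma_subset)
  have Asp: "A \<subseteq> space M" using sets.sets_into_space[OF AM] .
  \<comment> \<open>Grid number \<open>k\<close> divides [0, T] into k + 1 equal pieces;
    \<open>c k\<close> is the index of the first grid point not before \<sigma>, and it is 0 exactly
    when \<sigma> is 0.\<close>
  define g where "g k j = T * real j / real (Suc k)" for k j
  define c where "c k \<omega> = \<lceil>real (Suc k) * \<sigma> \<omega> / T\<rceil>" for k \<omega>
  define E where "E k j = {\<omega>\<in>A. c k \<omega> = int j}" for k j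
  define s where "s k \<omega> = (\<Sum>j\<le>Suc k. indicat_real (E k j) \<omega> * I (g k j) \<omega>)" for k \<omega>
  have g: "g k j \<in> {0..T}" if "j \<le> Suc k" for k j
  proof -
    have "T * real j \<le> T * real (Suc k)"
      using that T_pos by (intro mult_left_mono) auto
    then show ?thesis using T_pos by (simp add: g_def divide_le_eq del: of_nat_Suc)
  qed
  \<comment> \<open>The cell is the event that \<sigma> lies in the piece ending at
    \<open>g k j\<close>, hence a difference of two events known by that grid time.\<close>
  have E: "E k j \<in> sets (F (g k j))" if "j \<le> Suc k" for k j
  proof -
    have "E k j = {\<omega>\<in>A. \<sigma> \<omega> \<le> g k j} - {\<omega>\<in>A. \<sigma> \<omega> \<le> T * (real j - 1) / real (Suc k)}"
      unfolding E_def c_def g_def ceiling_eq_iff using T_pos by (auto simp: field_simps)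
    moreover have "{\<omega>\<in>A. \<sigma> \<omega> \<le> T * (real j - 1) / real (Suc k)} \<in> sets (F (g k j))"
    proof -
      have "T * (real j - 1) / real (Suc k) \<le> g k j" using T_pos by (simp add: g_def field_simps)
      then show ?thesis using pre_sigmaD[OF \<sigma> A] sets_F_mono by blast
    qed
    ultimately show ?thesis using pre_sigmaD[OF \<sigma> A] by (simp add: sets.Diff)
  qed
  have c: "\<exists>j\<le>Suc k. c k \<omega> = int j" if "\<omega> \<in> space M" for k \<omega>
  proof -
    have *: "0 \<le> \<sigma> \<omega> / T" "\<sigma> \<omega> / T \<le> 1" using stop_range[OF \<sigma> that] T_pos by auto
    have "real (Suc k) * (\<sigma> \<omega> / T) \<le> real (Suc k) * 1"
      by (intro mult_left_mono) (use * in auto)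
    moreover have "0 \<le> real (Suc k) * (\<sigma> \<omega> / T)"
      by (intro mult_nonneg_nonneg) (use * in auto)
    ultimately have "0 \<le> real (Suc k) * \<sigma> \<omega> / T" "real (Suc k) * \<sigma> \<omega> / T \<le> real (Suc k)"
      by (simp_all only: times_divide_eq_right mult_1_right)
    then have "0 \<le> c k \<omega>" "c k \<omega> \<le> int (Suc k)"
      unfolding c_def by (linarith, simp only: ceiling_le_iff of_int_of_nat_eq)
    then show ?thesis by (intro exI[of _ "nat (c k \<omega>)"]) auto
  qed
  \<comment> \<open>Each path in \<open>A\<close> belongs to exactly one cell, so the sum over cells
    picks a single summand.\<close>
  have collapse: "(\<Sum>j\<le>Suc k. indicat_real (E k j) \<omega> * X j) = indicat_real A \<omega> * X (nat (c k \<omega>))"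
    if \<omega>: "\<omega> \<in> space M" for k \<omega> and X :: "nat \<Rightarrow> real"
  proof -
    obtain j where j: "j \<le> Suc k" "c k \<omega> = int j" using c[OF \<omega>] by blast
    have "(\<Sum>j\<le>Suc k. indicat_real (E k j) \<omega> * X j) = (\<Sum>i\<le>Suc k. if i = j then indicat_real A \<omega> * X j else 0)"
      unfolding E_def using j by (intro sum.cong) (auto simp: indicator_def)
    then show ?thesis using j by simp
  qed
  have s_eq: "s k \<omega> = indicat_real A \<omega> * I (g k (nat (c k \<omega>))) \<omega>" if "\<omega> \<in> space M" for k \<omega>
    using collapse[OF that, of k "\<lambda>j. I (g k j) \<omega>"] by (simp only: s_def)
  have EM: "E k j \<in> sets M" if "j \<le> Suc k" for k j using E[OF that] by (rule in_sets_F)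
  have int_term: "integrable M (\<lambda>\<omega>. indicat_real (E k j) \<omega> * X \<omega>)" if "j \<le> Suc k" "integrable M X" for k j and X :: "'a \<Rightarrow> real"
    using integrable_mult_indicator[OF EM[OF that(1)] that(2)] by simp
  have T: "T \<in> {0..T}" using T_pos by simp
  have s_int: "(\<integral>\<omega>. s k \<omega> \<partial>M) = (\<integral>\<omega>\<in>A. I T \<omega> \<partial>M)" for k
  proof -
    have "(\<integral>\<omega>. s k \<omega> \<partial>M) = (\<Sum>j\<le>Suc k. \<integral>\<omega>. indicat_real (E k j) \<omega> * I (g k j) \<omega> \<partial>M)"
      unfolding s_def using int g by (intro Bochner_Integration.integral_sum int_term) auto
    also have "\<dots> = (\<Sum>j\<le>Suc k. \<integral>\<omega>. indicat_real (E k j) \<omega> * I T \<omega> \<partial>M)"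
      using mart[OF g E] by (intro sum.cong) (auto simp: set_lebesgue_integral_def)
    also have "\<dots> = (\<integral>\<omega>. (\<Sum>j\<le>Suc k. indicat_real (E k j) \<omega> * I T \<omega>) \<partial>M)"
      using int[OF T] by (intro Bochner_Integration.integral_sum[symmetric] int_term) auto
    also have "\<dots> = (\<integral>\<omega>. indicat_real A \<omega> * I T \<omega> \<partial>M)"
      by (intro Bochner_Integration.integral_cong collapse refl)
    finally show ?thesis by (simp add: set_lebesgue_integral_def)
  qed
  have gc: "(\<lambda>k. g k (nat (c k \<omega>))) \<longlonglongrightarrow> \<sigma> \<omega>" if "\<omega> \<in> space M" for \<omega>
  proof (rule tendsto_sandwich[where f="\<lambda>_. \<sigma> \<omega>" and h="\<lambda>k. \<sigma> \<omega> + T / real (Suc k)"])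
    have g_eq: "g k (nat (c k \<omega>)) = T * real_of_int (c k \<omega>) / real (Suc k)" for k
      using c[OF that, of k] by (auto simp: g_def)
    have "real (Suc k) * \<sigma> \<omega> / T \<le> real_of_int (c k \<omega>)" "real_of_int (c k \<omega>) \<le> real (Suc k) * \<sigma> \<omega> / T + 1" for k
      unfolding c_def by linarith+
    then show "eventually (\<lambda>k. \<sigma> \<omega> \<le> g k (nat (c k \<omega>))) sequentially"
      "eventually (\<lambda>k. g k (nat (c k \<omega>)) \<le> \<sigma> \<omega> + T / real (Suc k)) sequentially"
      using T_pos unfolding g_eq by (auto simp: field_simps simp del: of_nat_Suc intro!: always_eventually)
    have "(\<lambda>k. \<sigma> \<omega> + T * inverse (real (Suc k))) \<longlonglongrightarrow> \<sigma> \<omega> + T * 0"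
      by (intro tendsto_intros LIMSEQ_inverse_real_of_nat)
    then show "(\<lambda>k. \<sigma> \<omega> + T / real (Suc k)) \<longlonglongrightarrow> \<sigma> \<omega>"
      by (simp add: divide_inverse)
  qed simp
  have gr: "g k (nat (c k \<omega>)) \<in> {0..T}" if "\<omega> \<in> space M" for k \<omega>
    using c[OF that, of k] g by auto
  have "(\<lambda>k. \<integral>\<omega>. s k \<omega> \<partial>M) \<longlonglongrightarrow> (\<integral>\<omega>. indicat_real A \<omega> * I (\<sigma> \<omega>) \<omega> \<partial>M)"
  proof (rule integral_dominated_convergence[where w=w])
    show "(\<lambda>\<omega>. indicat_real A \<omega> * I (\<sigma> \<omega>) \<omega>) \<in> borel_measurable M"
      using measurable_pre_sigma[OF \<sigma> measurable_stopped[OF prog \<sigma>]] AM by measurable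
    show "s k \<in> borel_measurable M" for k
      unfolding s_def by (intro borel_measurable_sum borel_measurable_integrable int_term int g) auto
    show "integrable M w" by fact
    have "(\<lambda>k. s k \<omega>) \<longlonglongrightarrow> indicat_real A \<omega> * I (\<sigma> \<omega>) \<omega>" if "\<omega> \<in> space M" for \<omega>
    proof -
      have "(\<lambda>k. I (g k (nat (c k \<omega>))) \<omega>) \<longlonglongrightarrow> I (\<sigma> \<omega>) \<omega>"
        using stop_range[OF \<sigma> that]
        by (intro continuous_on_tendsto_compose[OF cont gc] always_eventually allI gr that) simp
      then show ?thesis
        unfolding s_eq[OF that] by (intro tendsto_intros)
    qed
    then show "AE \<omega> in M. (\<lambda>k. s k \<omega>) \<longlonglongrightarrow> indicat_real A \<omega> * I (\<sigma> \<omega>) \<omega>" by auto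
    show "AE \<omega> in M. norm (s k \<omega>) \<le> w \<omega>" for k
      using w(2) AE_space
    proof eventually_elim
      case (elim \<omega>)
      have "\<bar>I (g k (nat (c k \<omega>))) \<omega>\<bar> \<le> w \<omega>" using elim gr by blast
      then show ?case unfolding s_eq[OF elim(2)] by (auto simp: indicator_def)
    qed
  qed
  then have "(\<lambda>k::nat. \<integral>\<omega>\<in>A. I T \<omega> \<partial>M) \<longlonglongrightarrow> (\<integral>\<omega>\<in>A. I (\<sigma> \<omega>) \<omega> \<partial>M)"
    unfolding s_int by (simp add: set_lebesgue_integral_def)
  then show ?thesis by (rule LIMSEQ_unique) simp
qed

section \<open>Bounded drivers and backward equations between stopping times\<close>

definition bounded_field :: "real \<Rightarrow> (real \<Rightarrow> 'a \<Rightarrow> real) \<Rightarrow> bool" where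
  "bounded_field \<gamma> f \<longleftrightarrow>
     (\<lambda>(s, \<omega>). f s \<omega>) \<in> borel_measurable (restrict_space borel {0..T} \<Otimes>\<^sub>M M) \<and>
     (\<forall>s\<in>{0..T}. \<forall>\<omega>\<in>space M. 0 \<le> f s \<omega> \<and> f s \<omega> \<le> \<gamma>)"

text \<open>Clamping the time turns a field measurable on the strip over [0, T] into one measurable
  for all real times, to which product measurability with \<open>lborel\<close> applies.\<close>

lemma bounded_field_clamp:
  assumes "bounded_field \<gamma> f"
  shows "(\<lambda>(s, \<omega>). f (max 0 (min T s)) \<omega>) \<in> borel_measurable (borel \<Otimes>\<^sub>M M)"
proof -
  have 1: "(\<lambda>(s, \<omega>). f s \<omega>) \<in> borel_measurable (restrict_space borel {0..T} \<Otimes>\<^sub>M M)"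
    using assms by (simp add: bounded_field_def)
  have "(\<lambda>x. (max 0 (min T (fst x)), snd x)) \<in> measurable (borel \<Otimes>\<^sub>M M) (restrict_space borel {0..T} \<Otimes>\<^sub>M M)"
    using T_pos by (intro measurable_Pair measurable_restrict_space2) auto
  from measurable_compose[OF this 1] show ?thesis
    by (simp add: case_prod_beta)
qed

lemma bounded_field_path_integrable:
  assumes f: "bounded_field \<gamma> f" and \<omega>: "\<omega> \<in> space M" and a: "0 \<le> a"
  shows "set_integrable lborel {a..T} (\<lambda>s. f s \<omega>)"
proof -
  have m: "(\<lambda>s. f (max 0 (min T s)) \<omega>) \<in> borel_measurable borel"
    using measurable_compose[OF measurable_Pair2'[OF \<omega>, of borel] bounded_field_clamp[OF f]] by simp
  have "set_integrable lborel {a..T} (\<lambda>s. f (max 0 (min T s)) \<omega>)"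
    unfolding set_integrable_def
  proof (rule integrableI_bounded_set[where A="{a..T}" and B=\<gamma>])
    show "AE s in lborel. s \<in> {a..T} \<longrightarrow> norm (indicat_real {a..T} s *\<^sub>R f (max 0 (min T s)) \<omega>) \<le> \<gamma>"
      using f \<omega> T_pos by (auto simp: bounded_field_def indicator_def)
    show "emeasure lborel {a..T} < \<infinity>"
      by (cases "a \<le> T") auto
  qed (use m in \<open>auto simp: indicator_def\<close>)
  then show ?thesis
    unfolding set_integrable_def
    by (rule back_subst[of "integrable lborel"]) (use a in \<open>auto simp: indicator_def fun_eq_iff\<close>)
qed

lemma bounded_field_integral_measurable:
  assumes f: "bounded_field \<gamma> f" and \<sigma>: "\<sigma> \<in> borel_measurable M" and r: "\<And>\<omega>. \<omega> \<in> space M \<Longrightarrow> 0 \<le> \<sigma> \<omega>"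
  shows "(\<lambda>\<omega>. LBINT s:{\<sigma> \<omega>..T}. f s \<omega>) \<in> borel_measurable M"
proof -
  note bounded_field_clamp[OF f, measurable] \<sigma>[measurable]
  have m: "(\<lambda>(\<omega>, s). indicat_real {s. \<sigma> \<omega> \<le> s \<and> s \<le> T} s * f (max 0 (min T s)) \<omega>) \<in> borel_measurable (M \<Otimes>\<^sub>M lborel)"
  proof -
    have "(\<lambda>x. f (max 0 (min T (snd x))) (fst x)) \<in> borel_measurable (M \<Otimes>\<^sub>M lborel)"
      using measurable_compose[OF measurable_Pair[OF measurable_snd measurable_fst] bounded_field_clamp[OF f]]
      by (simp add: measurable_lborel1 case_prod_beta cong: measurable_cong_sets)
    moreover have "(\<lambda>x. indicat_real {s. \<sigma> (fst x) \<le> s \<and> s \<le> T} (snd x)) \<in> borel_measurable (M \<Otimes>\<^sub>M lborel)"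
      unfolding indicator_def mem_Collect_eq by measurable
    ultimately show ?thesis
      by (simp add: case_prod_beta)
  qed
  have "(\<lambda>\<omega>. \<integral>s. indicat_real {s. \<sigma> \<omega> \<le> s \<and> s \<le> T} s * f (max 0 (min T s)) \<omega> \<partial>lborel) \<in> borel_measurable M"
    using m by (rule lborel.borel_measurable_lebesgue_integral)
  then show ?thesis
  proof (rule measurable_cong[THEN iffD1, rotated])
    fix \<omega> assume "\<omega> \<in> space M"
    then show "(\<integral>s. indicat_real {s. \<sigma> \<omega> \<le> s \<and> s \<le> T} s * f (max 0 (min T s)) \<omega> \<partial>lborel) = (LBINT s:{\<sigma> \<omega>..T}. f s \<omega>)"
      unfolding set_lebesgue_integral_def using r[of \<omega>]
      by (intro Bochner_Integration.integral_cong) (auto simp: indicator_def)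
  qed
qed

lemma bounded_field_integral_bounds:
  assumes f: "bounded_field \<gamma> f" and \<omega>: "\<omega> \<in> space M" and a: "0 \<le> a"
  shows "0 \<le> (LBINT s:{a..T}. f s \<omega>)" and "(LBINT s:{a..T}. f s \<omega>) \<le> \<gamma> * T"
  using LBINT_bounds[of T "\<lambda>s. f s \<omega>" \<gamma> a] f \<omega> a T_pos by (auto simp: bounded_field_def)

lemma bounded_field_integral_integrable:
  assumes f: "bounded_field \<gamma> f" and \<sigma>: "stop \<sigma>"
  shows "integrable M (\<lambda>\<omega>. LBINT s:{\<sigma> \<omega>..T}. f s \<omega>)"
proof (rule integrable_const_bound[where B="\<gamma> * T"])
  show "AE \<omega> in M. norm (LBINT s:{\<sigma> \<omega>..T}. f s \<omega>) \<le> \<gamma> * T"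
    using bounded_field_integral_bounds[OF f] stop_range[OF \<sigma>] by (intro AE_I2) auto
  show "(\<lambda>\<omega>. LBINT s:{\<sigma> \<omega>..T}. f s \<omega>) \<in> borel_measurable M"
    using stop_range[OF \<sigma>] by (intro bounded_field_integral_measurable[OF f stop_measurable[OF \<sigma>]]) auto
qed

text \<open>Common form of both equations: \<open>K\<close> is 0 in the unreflected one. Obstacle
  and Skorokhod condition are left out; they return through flatness of \<open>K\<close> and through
  the values at hitting times.\<close>

definition backward :: "(real \<Rightarrow> 'a \<Rightarrow> real) \<Rightarrow> (real \<Rightarrow> 'a \<Rightarrow> real) \<Rightarrow> (real \<Rightarrow> 'a \<Rightarrow> real) \<Rightarrow> bool" where
  "backward f Y K \<longleftrightarrow> Sc2_process M T B Y \<and> Sci2_process M T B K \<and>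
     (\<exists>Z I. ito_integral M T B Z I \<and>
        (AE \<omega> in M. \<forall>t\<in>{0..T}.
           Y t \<omega> = (LBINT s:{t..T}. f s \<omega>) + K T \<omega> - K t \<omega> - (I T \<omega> - I t \<omega>)))"

lemma integrable_stopped:
  assumes Y: "Sc2_process M T B Y" and \<sigma>: "stop \<sigma>"
  shows "integrable M (\<lambda>\<omega>. Y (\<sigma> \<omega>) \<omega>)"
proof -
  obtain w where w: "integrable M w" "AE \<omega> in M. \<forall>t\<in>{0..T}. \<bar>Y t \<omega>\<bar> \<le> w \<omega>"
    using Sc2_dominated[OF Y] by blast
  have "prog Y" using Y by (simp add: Sc2_process_def)
  then have "(\<lambda>\<omega>. Y (\<sigma> \<omega>) \<omega>) \<in> borel_measurable M"
    using measurable_pre_sigma[OF \<sigma> measurable_stopped[OF _ \<sigma>]] by blast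
  moreover have "AE \<omega> in M. norm (Y (\<sigma> \<omega>) \<omega>) \<le> norm (w \<omega>)"
    using w(2) AE_space
  proof eventually_elim
    case (elim \<omega>)
    then have "\<bar>Y (\<sigma> \<omega>) \<omega>\<bar> \<le> w \<omega>" using stop_range[OF \<sigma>, of \<omega>] by simp
    then show ?case by simp
  qed
  ultimately show ?thesis using w(1) Bochner_Integration.integrable_bound by blast
qed

text \<open>In Y - \<integral>f + K the only part that varies with time beyond a fixed random
  variable is the stochastic integral, whose integral over \<open>A\<close> is the same at \<sigma>
  and at \<tau>. Both stoppings apply because \<open>A\<close> is known at \<sigma>, hence at
  \<tau>.\<close>

lemma backward_identity:
  assumes bw: "backward f Y K" and f: "bounded_field \<gamma> f"
    and \<sigma>: "stop \<sigma>" and \<tau>: "stop \<tau>" and le: "\<And>\<omega>. \<omega> \<in> space M \<Longrightarrow> \<sigma> \<omega> \<le> \<tau> \<omega>"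
    and A: "A \<in> sets (pre_sigma \<sigma>)"
  shows "(\<integral>\<omega>\<in>A. Y (\<sigma> \<omega>) \<omega> - (LBINT s:{\<sigma> \<omega>..T}. f s \<omega>) \<partial>M)
    = (\<integral>\<omega>\<in>A. Y (\<tau> \<omega>) \<omega> - (LBINT s:{\<tau> \<omega>..T}. f s \<omega>) + (K (\<tau> \<omega>) \<omega> - K (\<sigma> \<omega>) \<omega>) \<partial>M)"
proof -
  obtain Z I where I: "ito_integral M T B Z I"
    and eq: "AE \<omega> in M. \<forall>t\<in>{0..T}. Y t \<omega> = (LBINT s:{t..T}. f s \<omega>) + K T \<omega> - K t \<omega> - (I T \<omega> - I t \<omega>)"
    and Y: "Sc2_process M T B Y" and K: "Sc2_process M T B K"
    using bw by (auto simp: backward_def Sci2_process_def)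
  have T: "T \<in> {0..T}" using T_pos by simp
  have I_prog: "prog I" and I_cont: "\<And>\<omega>. \<omega> \<in> space M \<Longrightarrow> continuous_on {0..T} (\<lambda>t. I t \<omega>)"
    using I by (auto simp: ito_integral_def)
  obtain w where w: "integrable M w" "AE \<omega> in M. \<forall>t\<in>{0..T}. \<bar>Y t \<omega>\<bar> \<le> w \<omega>"
    using Sc2_dominated[OF Y] by blast
  obtain v where v: "integrable M v" "AE \<omega> in M. \<forall>t\<in>{0..T}. \<bar>K t \<omega>\<bar> \<le> v \<omega>"
    using Sc2_dominated[OF K] by blast
  \<comment> \<open>Solving the equation for \<open>I t\<close> yields a dominating variable: the
    terminal value, \<gamma> T for the driver, \<open>v\<close> twice for the two values of
    \<open>K\<close>, and \<open>w\<close> for \<open>Y\<close>.\<close>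
  let ?W = "\<lambda>\<omega>. \<bar>I T \<omega>\<bar> + \<gamma> * T + 2 * v \<omega> + w \<omega>"
  have W: "integrable M ?W"
    using w(1) v(1) integrable_abs[OF ito_integral_martingale(1)[OF I T]] by auto
  have dom: "AE \<omega> in M. \<forall>t\<in>{0..T}. \<bar>I t \<omega>\<bar> \<le> ?W \<omega>"
    using eq w(2) v(2) AE_space
  proof eventually_elim
    case (elim \<omega>)
    show ?case
    proof
      fix t assume t: "t \<in> {0..T}"
      have "\<bar>Y t \<omega>\<bar> \<le> w \<omega>" "\<bar>K t \<omega>\<bar> \<le> v \<omega>" "\<bar>K T \<omega>\<bar> \<le> v \<omega>"
        and "Y t \<omega> = (LBINT s:{t..T}. f s \<omega>) + K T \<omega> - K t \<omega> - (I T \<omega> - I t \<omega>)"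
        using elim t T by blast+
      moreover have "0 \<le> (LBINT s:{t..T}. f s \<omega>)" "(LBINT s:{t..T}. f s \<omega>) \<le> \<gamma> * T"
        using bounded_field_integral_bounds[OF f elim(4), of t] t by auto
      ultimately show "\<bar>I t \<omega>\<bar> \<le> ?W \<omega>" by linarith
    qed
  qed
  have A': "A \<in> sets (pre_sigma \<tau>)"
    using A pre_sigma_mono[OF \<sigma> \<tau> le] by blast
  have AM: "A \<in> sets M" using \<sigma> A by (rule pre_sigma_subset)
  have os: "(\<integral>\<omega>\<in>A'. I (\<rho> \<omega>) \<omega> \<partial>M) = (\<integral>\<omega>\<in>A'. I T \<omega> \<partial>M)"
    if "stop \<rho>" "A' \<in> sets (pre_sigma \<rho>)" for \<rho> A'
    by (rule optional_stopping[OF I_prog I_cont ito_integral_martingale(1)[OF I]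
          ito_integral_martingale(2)[OF I] W dom that])
  have IA: "(\<integral>\<omega>\<in>A. I (\<sigma> \<omega>) \<omega> \<partial>M) = (\<integral>\<omega>\<in>A. I (\<tau> \<omega>) \<omega> \<partial>M)"
    using os[OF \<sigma> A] os[OF \<tau> A'] by simp
  \<comment> \<open>By the equation, \<open>I\<close> at \<rho> equals \<open>?R\<close> plus
    \<open>?C\<close>, and \<open>?C\<close> is the same for every stopping time.\<close>
  let ?R = "\<lambda>\<rho> \<omega>. Y (\<rho> \<omega>) \<omega> - (LBINT s:{\<rho> \<omega>..T}. f s \<omega>) + K (\<rho> \<omega>) \<omega>"
  let ?C = "\<lambda>\<omega>. I T \<omega> - K T \<omega>"
  have si: "set_integrable M A g" if "integrable M g" for g :: "'a \<Rightarrow> real"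
    unfolding set_integrable_def using AM that by (rule integrable_mult_indicator)
  have R_int: "integrable M (?R \<rho>)" if "stop \<rho>" for \<rho>
    using integrable_stopped[OF Y that] integrable_stopped[OF K that] bounded_field_integral_integrable[OF f that]
    by (intro Bochner_Integration.integrable_add Bochner_Integration.integrable_diff)
  have C_int: "integrable M ?C"
    using ito_integral_martingale(1)[OF I T] integrable_stopped[OF K stop_const[OF T]] by auto
  have R: "(\<integral>\<omega>\<in>A. ?R \<rho> \<omega> \<partial>M) = (\<integral>\<omega>\<in>A. I (\<rho> \<omega>) \<omega> \<partial>M) - (\<integral>\<omega>\<in>A. ?C \<omega> \<partial>M)" if \<rho>: "stop \<rho>" for \<rho>
  proof -
    have ae: "AE \<omega> in M. I (\<rho> \<omega>) \<omega> = ?R \<rho> \<omega> + ?C \<omega>"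
      using eq AE_space
    proof eventually_elim
      case (elim \<omega>)
      then have "\<rho> \<omega> \<in> {0..T}" using stop_range[OF \<rho>] by simp
      then have "Y (\<rho> \<omega>) \<omega> = (LBINT s:{\<rho> \<omega>..T}. f s \<omega>) + K T \<omega> - K (\<rho> \<omega>) \<omega> - (I T \<omega> - I (\<rho> \<omega>) \<omega>)"
        using elim(1) by blast
      then show ?case by simp
    qed
    have "(\<integral>\<omega>\<in>A. I (\<rho> \<omega>) \<omega> \<partial>M) = (\<integral>\<omega>\<in>A. ?R \<rho> \<omega> + ?C \<omega> \<partial>M)"
    proof (rule set_lebesgue_integral_cong_AE[OF AM])
      show "(\<lambda>\<omega>. I (\<rho> \<omega>) \<omega>) \<in> borel_measurable M"
        by (rule measurable_pre_sigma[OF \<rho> measurable_stopped[OF I_prog \<rho>]])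
      show "(\<lambda>\<omega>. ?R \<rho> \<omega> + ?C \<omega>) \<in> borel_measurable M"
        by (rule borel_measurable_add[OF borel_measurable_integrable[OF R_int[OF \<rho>]] borel_measurable_integrable[OF C_int]])
      show "AE \<omega> \<in> A in M. I (\<rho> \<omega>) \<omega> = ?R \<rho> \<omega> + ?C \<omega>"
        using ae by eventually_elim (rule impI)
    qed
    also have "\<dots> = (\<integral>\<omega>\<in>A. ?R \<rho> \<omega> \<partial>M) + (\<integral>\<omega>\<in>A. ?C \<omega> \<partial>M)"
      by (rule set_integral_add(2)[OF si[OF R_int[OF \<rho>]] si[OF C_int]])
    finally show ?thesis by simp
  qed
  have "(\<integral>\<omega>\<in>A. ?R \<sigma> \<omega> - K (\<sigma> \<omega>) \<omega> \<partial>M) = (\<integral>\<omega>\<in>A. ?R \<tau> \<omega> - K (\<sigma> \<omega>) \<omega> \<partial>M)"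
    using R[OF \<sigma>] R[OF \<tau>] IA
    by (simp only: set_integral_diff(2)[OF si[OF R_int[OF \<sigma>]] si[OF integrable_stopped[OF K \<sigma>]]]
      set_integral_diff(2)[OF si[OF R_int[OF \<tau>]] si[OF integrable_stopped[OF K \<sigma>]]])
  then show ?thesis
    by (simp add: algebra_simps)
qed

section \<open>Hitting times of continuous adapted processes\<close>

definition hit :: "(real \<Rightarrow> 'a \<Rightarrow> real) \<Rightarrow> ('a \<Rightarrow> real) \<Rightarrow> 'a \<Rightarrow> real" where
  "hit X \<sigma> \<omega> = Inf (insert T {t \<in> {\<sigma> \<omega>..T}. X t \<omega> \<le> 0})"

context
  fixes X :: "real \<Rightarrow> 'a \<Rightarrow> real" and \<sigma> :: "'a \<Rightarrow> real"
  assumes adapted: "\<And>t. t \<in> {0..T} \<Longrightarrow> X t \<in> borel_measurable (F t)"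
    and cont: "\<And>\<omega>. \<omega> \<in> space M \<Longrightarrow> continuous_on {0..T} (\<lambda>t. X t \<omega>)"
    and \<sigma>: "stop \<sigma>"
begin

lemma hit_bdd_below: "bdd_below (insert T {t \<in> {\<sigma> \<omega>..T}. X t \<omega> \<le> 0})"
  by (intro bdd_belowI[of _ "min T (\<sigma> \<omega>)"]) auto

lemma hit_range: "\<omega> \<in> space M \<Longrightarrow> \<sigma> \<omega> \<le> hit X \<sigma> \<omega> \<and> hit X \<sigma> \<omega> \<le> T"
proof -
  assume \<omega>: "\<omega> \<in> space M"
  have "hit X \<sigma> \<omega> \<le> T"
    unfolding hit_def by (rule cInf_lower[OF _ hit_bdd_below]) simp
  moreover have "\<sigma> \<omega> \<le> hit X \<sigma> \<omega>"
    unfolding hit_def using stop_range[OF \<sigma> \<omega>] by (intro cInf_greatest) auto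
  ultimately show ?thesis by simp
qed

lemma before_hit:
  assumes \<omega>: "\<omega> \<in> space M" and t: "\<sigma> \<omega> \<le> t" "t < hit X \<sigma> \<omega>"
  shows "0 < X t \<omega>"
proof (rule ccontr)
  assume "\<not> 0 < X t \<omega>"
  then have "hit X \<sigma> \<omega> \<le> t"
    unfolding hit_def using t hit_range[OF \<omega>] by (intro cInf_lower hit_bdd_below) auto
  then show False using t by simp
qed

lemma at_hit:
  assumes \<omega>: "\<omega> \<in> space M" and t: "hit X \<sigma> \<omega> < T"
  shows "X (hit X \<sigma> \<omega>) \<omega> \<le> 0"
proof -
  let ?S = "{t \<in> {\<sigma> \<omega>..T}. X t \<omega> \<le> 0}"
  have "closed ?S"
  proof -
    have "continuous_on {\<sigma> \<omega>..T} (\<lambda>t. X t \<omega>)"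
      using cont[OF \<omega>] stop_range[OF \<sigma> \<omega>] by (rule_tac continuous_on_subset) auto
    then have "closed ({\<sigma> \<omega>..T} \<inter> (\<lambda>t. X t \<omega>) -` {..0})"
      by (intro continuous_closed_preimage) auto
    also have "{\<sigma> \<omega>..T} \<inter> (\<lambda>t. X t \<omega>) -` {..0} = ?S" by auto
    finally show ?thesis .
  qed
  then have "hit X \<sigma> \<omega> \<in> insert T ?S"
    unfolding hit_def by (intro closed_contains_Inf hit_bdd_below) auto
  then show ?thesis using t by auto
qed

text \<open>Reduces hitting to countably many events. A continuous path attains its minimum on the
  compact interval from \<sigma> to \<open>t\<close>, so values below every 1 / (k + 1) force a
  value \<le> 0. The time \<open>t\<close> is added to the rationals because the hit may occur
  exactly at \<open>t\<close>. The case t = T is excluded: there the default value of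
  \<open>hit\<close> carries no information on \<open>X\<close>.\<close>

lemma hit_le_iff:
  assumes \<omega>: "\<omega> \<in> space M" and t: "0 \<le> t" "t < T"
  shows "hit X \<sigma> \<omega> \<le> t \<longleftrightarrow> (\<forall>k::nat. \<exists>q\<in>insert t ({0..t} \<inter> \<rat>). \<sigma> \<omega> \<le> q \<and> X q \<omega> < 1 / real (Suc k))"
proof
  assume le: "hit X \<sigma> \<omega> \<le> t"
  let ?s = "hit X \<sigma> \<omega>"
  have s: "\<sigma> \<omega> \<le> ?s" "0 \<le> ?s" "X ?s \<omega> \<le> 0"
    using hit_range[OF \<omega>] stop_range[OF \<sigma> \<omega>] at_hit[OF \<omega>] le t by auto
  show "\<forall>k::nat. \<exists>q\<in>insert t ({0..t} \<inter> \<rat>). \<sigma> \<omega> \<le> q \<and> X q \<omega> < 1 / real (Suc k)"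
  proof
    fix k :: nat
    show "\<exists>q\<in>insert t ({0..t} \<inter> \<rat>). \<sigma> \<omega> \<le> q \<and> X q \<omega> < 1 / real (Suc k)"
    proof (cases "?s = t")
      case True
      then have "X t \<omega> < 1 / real (Suc k)" "\<sigma> \<omega> \<le> t" using s by (auto intro: le_less_trans)
      then show ?thesis by blast
    next
      case False
      have pos: "0 < 1 / real (Suc k)" by simp
      have "?s \<in> {0..T}" using s le t by simp
      then obtain \<delta> where \<delta>: "\<delta> > 0" "\<And>q. q \<in> {0..T} \<Longrightarrow> dist q ?s < \<delta> \<Longrightarrow> dist (X q \<omega>) (X ?s \<omega>) < 1 / real (Suc k)"
        using cont[OF \<omega>] pos unfolding continuous_on_iff by meson
      \<comment> \<open>The rational time is chosen to the right of the hit, which keeps it at or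
        after \<sigma>.\<close>
      have "?s < min t (?s + \<delta>)" using False le \<delta>(1) by simp
      then obtain q where q: "q \<in> \<rat>" "?s < q" "q < min t (?s + \<delta>)"
        using Rats_dense_in_real by blast
      have "X q \<omega> < 1 / real (Suc k)"
        using \<delta>(2)[of q] q s t by (simp add: dist_real_def abs_less_iff)
      then show ?thesis using q s by (intro bexI[of _ q]) auto
    qed
  qed
next
  assume *: "\<forall>k::nat. \<exists>q\<in>insert t ({0..t} \<inter> \<rat>). \<sigma> \<omega> \<le> q \<and> X q \<omega> < 1 / real (Suc k)"
  then have **: "\<exists>q\<in>{\<sigma> \<omega>..t}. X q \<omega> < 1 / real (Suc k)" for k by fastforce
  then have "{\<sigma> \<omega>..t} \<noteq> {}" by blast
  moreover have "continuous_on {\<sigma> \<omega>..t} (\<lambda>t. X t \<omega>)"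
    using cont[OF \<omega>] stop_range[OF \<sigma> \<omega>] t by (rule_tac continuous_on_subset) auto
  ultimately obtain s where s: "s \<in> {\<sigma> \<omega>..t}" "\<And>q. q \<in> {\<sigma> \<omega>..t} \<Longrightarrow> X s \<omega> \<le> X q \<omega>"
    using continuous_attains_inf[OF compact_Icc] by blast
  have "X s \<omega> \<le> 1 / real (Suc k)" for k
    using **[of k] s(2) by fastforce
  moreover have "(\<lambda>k. 1 / real (Suc k)) \<longlonglongrightarrow> 0"
    using LIMSEQ_inverse_real_of_nat by (simp add: inverse_eq_divide)
  ultimately have "X s \<omega> \<le> 0"
    using LIMSEQ_le_const by blast
  then have "\<not> s < hit X \<sigma> \<omega>"
    using before_hit[OF \<omega>, of s] s(1) by force
  then show "hit X \<sigma> \<omega> \<le> t" using s(1) by simp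
qed

lemma stop_hit: "stop (hit X \<sigma>)"
  unfolding stop_def stopping_time_def pred_def space_F
proof (intro conjI allI ballI)
  show "hit X \<sigma> \<omega> \<in> {0..T}" if "\<omega> \<in> space M" for \<omega>
    using hit_range[OF that] stop_range[OF \<sigma> that] by auto
  fix t
  consider "t < 0" | "0 \<le> t" "t < T" | "T \<le> t" by linarith
  then show "{\<omega> \<in> space M. hit X \<sigma> \<omega> \<le> t} \<in> sets (F t)"
  proof cases
    case 1
    then have "{\<omega> \<in> space M. hit X \<sigma> \<omega> \<le> t} = {}"
      using hit_range stop_range[OF \<sigma>] by force
    then show ?thesis by (simp only: sets.empty_sets)
  next
    case 2
    let ?Q = "insert t ({0..t} \<inter> \<rat>)"
    have Q: "countable ?Q" using countable_rat by auto
    have E: "{\<omega> \<in> space M. \<sigma> \<omega> \<le> q \<and> X q \<omega> < 1 / real (Suc k)} \<in> sets (F t)" if q: "q \<in> ?Q" for q k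
    proof -
      have q': "q \<in> {0..T}" "q \<le> t" using q 2 by auto
      have "{\<omega> \<in> space (F q). X q \<omega> < 1 / real (Suc k)} \<in> sets (F q)"
        using adapted[OF q'(1)] by (intro borel_measurable_less[OF _ borel_measurable_const])
      then have "{\<omega> \<in> space M. X q \<omega> < 1 / real (Suc k)} \<in> sets (F t)"
        using sets_F_mono[OF q'(2)] by (auto simp: space_F)
      moreover have "{\<omega> \<in> space M. \<sigma> \<omega> \<le> q} \<in> sets (F t)"
        using stop_le[OF \<sigma> q'(2)] .
      ultimately have "{\<omega> \<in> space M. \<sigma> \<omega> \<le> q} \<inter> {\<omega> \<in> space M. X q \<omega> < 1 / real (Suc k)} \<in> sets (F t)"
        by (intro sets.Int)
      also have "{\<omega> \<in> space M. \<sigma> \<omega> \<le> q} \<inter> {\<omega> \<in> space M. X q \<omega> < 1 / real (Suc k)} = {\<omega> \<in> space M. \<sigma> \<omega> \<le> q \<and> X q \<omega> < 1 / real (Suc k)}"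
        by auto
      finally show ?thesis .
    qed
    have "{\<omega> \<in> space M. hit X \<sigma> \<omega> \<le> t}
        = {\<omega> \<in> space M. \<forall>k. \<exists>q\<in>?Q. \<sigma> \<omega> \<le> q \<and> X q \<omega> < 1 / real (Suc k)}"
      by (intro Collect_cong conj_cong hit_le_iff[OF _ 2] refl)
    also have "\<dots> = (\<Inter>k. \<Union>q\<in>?Q. {\<omega> \<in> space M. \<sigma> \<omega> \<le> q \<and> X q \<omega> < 1 / real (Suc k)})"
    proof -
      have "{x\<in>S. \<forall>k::nat. \<exists>q\<in>Q. P q k x} = (\<Inter>k. \<Union>q\<in>Q. {x\<in>S. P q k x})"
        for S :: "'a set" and Q :: "real set" and P
        by auto
      then show ?thesis .
    qed
    also have "\<dots> \<in> sets (F t)"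
      by (intro sets.countable_INT' sets.countable_UN'[OF Q] image_subsetI E) simp_all
    finally show ?thesis .
  next
    case 3
    then have "{\<omega> \<in> space M. hit X \<sigma> \<omega> \<le> t} = space (F t)"
      using hit_range by (force simp: space_F)
    then show ?thesis by (simp only: sets.top)
  qed
qed

end

text \<open>Integrate both stopping identities over the event \<open>E\<close> in \<open>A\<close>
  on which the claim fails. There \<open>K\<close> contributes nothing, \<open>K'\<close> can only
  raise \<open>Y'\<close>, the driver integrals coincide, and the values at \<tau> are ordered;
  hence the positive difference has a non-positive integral and \<open>E\<close> is null.\<close>

lemma backward_compare:
  assumes bw: "backward f Y K" and f: "bounded_field \<gamma> f"
    and bw': "backward f' Y' K'" and f': "bounded_field \<gamma>' f'"
    and \<sigma>: "stop \<sigma>" and \<tau>: "stop \<tau>" and le: "\<And>\<omega>. \<omega> \<in> space M \<Longrightarrow> \<sigma> \<omega> \<le> \<tau> \<omega>"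
    and A: "A \<in> sets (pre_sigma \<sigma>)"
    and ff': "\<And>\<omega> s. \<omega> \<in> A \<Longrightarrow> \<sigma> \<omega> \<le> s \<Longrightarrow> f s \<omega> = f' s \<omega>"
    and flat: "AE \<omega> in M. K (\<tau> \<omega>) \<omega> = K (\<sigma> \<omega>) \<omega>"
    and end_le: "AE \<omega> in M. \<omega> \<in> A \<longrightarrow> Y (\<tau> \<omega>) \<omega> \<le> Y' (\<tau> \<omega>) \<omega>"
  shows "AE \<omega> in M. \<omega> \<in> A \<longrightarrow> Y (\<sigma> \<omega>) \<omega> \<le> Y' (\<sigma> \<omega>) \<omega>"
proof -
  define E where "E = {\<omega>\<in>A. Y' (\<sigma> \<omega>) \<omega> < Y (\<sigma> \<omega>) \<omega>}"
  have Y: "Sc2_process M T B Y" and Y': "Sc2_process M T B Y'"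
    and K: "Sc2_process M T B K" and K': "Sc2_process M T B K'"
    and K'_mono: "\<And>\<omega>. \<omega> \<in> space M \<Longrightarrow> mono_on {0..T} (\<lambda>t. K' t \<omega>)"
    using bw bw' by (auto simp: backward_def Sci2_process_def)
  have prog: "prog Y" "prog Y'" using Y Y' by (auto simp: Sc2_process_def)
  have Asp: "A \<subseteq> space M" using pre_sigma_subset[OF \<sigma> A] sets.sets_into_space by blast
  have E: "E \<in> sets (pre_sigma \<sigma>)"
  proof -
    have "{\<omega>\<in>space (pre_sigma \<sigma>). Y' (\<sigma> \<omega>) \<omega> < Y (\<sigma> \<omega>) \<omega>} \<in> sets (pre_sigma \<sigma>)"
      by (intro borel_measurable_less measurable_stopped prog \<sigma>)
    moreover have "E = A \<inter> {\<omega>\<in>space (pre_sigma \<sigma>). Y' (\<sigma> \<omega>) \<omega> < Y (\<sigma> \<omega>) \<omega>}"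
      using Asp by (auto simp: E_def space_pre_sigma)
    ultimately show ?thesis
      using A by (simp only: sets.Int)
  qed
  have EM: "E \<in> sets M" using \<sigma> E by (rule pre_sigma_subset)
  let ?G = "\<lambda>g \<rho> \<omega>. LBINT s:{\<rho> \<omega>..T}. g s \<omega>"
  let ?P = "\<lambda>\<rho> \<omega>. Y (\<rho> \<omega>) \<omega> - ?G f \<rho> \<omega>" and ?P' = "\<lambda>\<rho> \<omega>. Y' (\<rho> \<omega>) \<omega> - ?G f' \<rho> \<omega>"
  let ?Q = "\<lambda>\<omega>. ?P \<tau> \<omega> + (K (\<tau> \<omega>) \<omega> - K (\<sigma> \<omega>) \<omega>)" and ?Q' = "\<lambda>\<omega>. ?P' \<tau> \<omega> + (K' (\<tau> \<omega>) \<omega> - K' (\<sigma> \<omega>) \<omega>)"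
  have si: "set_integrable M E g" if "integrable M g" for g :: "'a \<Rightarrow> real"
    unfolding set_integrable_def using EM that by (rule integrable_mult_indicator)
  have P: "integrable M (?P \<rho>)" "integrable M (?P' \<rho>)" if "stop \<rho>" for \<rho>
    by (rule Bochner_Integration.integrable_diff[OF integrable_stopped[OF Y that] bounded_field_integral_integrable[OF f that]],
        rule Bochner_Integration.integrable_diff[OF integrable_stopped[OF Y' that] bounded_field_integral_integrable[OF f' that]])
  have Q: "integrable M ?Q" "integrable M ?Q'"
    by (rule Bochner_Integration.integrable_add[OF P(1)[OF \<tau>] Bochner_Integration.integrable_diff[OF integrable_stopped[OF K \<tau>] integrable_stopped[OF K \<sigma>]]],
        rule Bochner_Integration.integrable_add[OF P(2)[OF \<tau>] Bochner_Integration.integrable_diff[OF integrable_stopped[OF K' \<tau>] integrable_stopped[OF K' \<sigma>]]])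
  have "(\<integral>\<omega>\<in>E. ?P \<sigma> \<omega> - ?P' \<sigma> \<omega> \<partial>M) = (\<integral>\<omega>\<in>E. ?Q \<omega> - ?Q' \<omega> \<partial>M)"
    using backward_identity[OF bw f \<sigma> \<tau> le E] backward_identity[OF bw' f' \<sigma> \<tau> le E]
    by (simp only: set_integral_diff(2)[OF si[OF P(1)[OF \<sigma>]] si[OF P(2)[OF \<sigma>]]] set_integral_diff(2)[OF si[OF Q(1)] si[OF Q(2)]])
  also have "\<dots> \<le> 0"
  proof -
    have "AE \<omega> in M. indicat_real E \<omega> *\<^sub>R (?Q \<omega> - ?Q' \<omega>) \<le> 0"
      using flat end_le AE_space
    proof eventually_elim
      case (elim \<omega>)
      show ?case
      proof (cases "\<omega> \<in> E")
        case True
        then have "\<omega> \<in> A" by (simp add: E_def)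
        have "?G f \<tau> \<omega> = ?G f' \<tau> \<omega>"
          using ff'[OF \<open>\<omega> \<in> A\<close>] le[OF elim(3)] by (intro set_lebesgue_integral_cong) auto
        moreover have "K' (\<sigma> \<omega>) \<omega> \<le> K' (\<tau> \<omega>) \<omega>"
          using mono_onD[OF K'_mono[OF elim(3)]] le[OF elim(3)] stop_range[OF \<sigma> elim(3)] stop_range[OF \<tau> elim(3)] by auto
        moreover have "Y (\<tau> \<omega>) \<omega> \<le> Y' (\<tau> \<omega>) \<omega>" using elim(2) \<open>\<omega> \<in> A\<close> by blast
        ultimately have "?Q \<omega> - ?Q' \<omega> \<le> 0" using elim(1) by linarith
        then show ?thesis using True by simp
      qed simp
    qed
    moreover have "integrable M (\<lambda>\<omega>. indicat_real E \<omega> *\<^sub>R (?Q \<omega> - ?Q' \<omega>))"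
      using si[OF Bochner_Integration.integrable_diff[OF Q]] by (simp only: set_integrable_def)
    ultimately have "(\<integral>\<omega>. indicat_real E \<omega> *\<^sub>R (?Q \<omega> - ?Q' \<omega>) \<partial>M) \<le> (\<integral>\<omega>. 0 \<partial>M)"
      by (intro integral_mono_AE) auto
    then show ?thesis by (simp only: set_lebesgue_integral_def[of M] Bochner_Integration.integral_zero)
  qed
  finally have le0: "(\<integral>\<omega>. indicat_real E \<omega> *\<^sub>R (?P \<sigma> \<omega> - ?P' \<sigma> \<omega>) \<partial>M) \<le> 0"
    by (simp only: set_lebesgue_integral_def[of M])
  have P_eq: "?P \<sigma> \<omega> - ?P' \<sigma> \<omega> = Y (\<sigma> \<omega>) \<omega> - Y' (\<sigma> \<omega>) \<omega>" if "\<omega> \<in> E" for \<omega>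
  proof -
    have "?G f \<sigma> \<omega> = ?G f' \<sigma> \<omega>"
      using ff' that by (intro set_lebesgue_integral_cong) (auto simp: E_def)
    then show ?thesis by simp
  qed
  have nn: "0 \<le> indicat_real E \<omega> *\<^sub>R (?P \<sigma> \<omega> - ?P' \<sigma> \<omega>)" for \<omega>
    using P_eq[of \<omega>] by (cases "\<omega> \<in> E") (auto simp: E_def)
  have int: "integrable M (\<lambda>\<omega>. indicat_real E \<omega> *\<^sub>R (?P \<sigma> \<omega> - ?P' \<sigma> \<omega>))"
    using si[OF Bochner_Integration.integrable_diff[OF P[OF \<sigma>]]] by (simp only: set_integrable_def)
  have "(\<integral>\<omega>. indicat_real E \<omega> *\<^sub>R (?P \<sigma> \<omega> - ?P' \<sigma> \<omega>) \<partial>M) = 0"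
    using le0 integral_nonneg_AE[OF AE_I2[OF nn]] by (rule antisym)
  then have "AE \<omega> in M. indicat_real E \<omega> *\<^sub>R (?P \<sigma> \<omega> - ?P' \<sigma> \<omega>) = 0"
    using integral_nonneg_eq_0_iff_AE[OF int AE_I2[OF nn]] by blast
  then show ?thesis
  proof eventually_elim
    case (elim \<omega>)
    have "\<omega> \<notin> E"
    proof
      assume "\<omega> \<in> E"
      then have "Y (\<sigma> \<omega>) \<omega> - Y' (\<sigma> \<omega>) \<omega> = 0" using elim P_eq by simp
      then show False using \<open>\<omega> \<in> E\<close> by (simp add: E_def)
    qed
    then show ?case by (auto simp: E_def)
  qed
qed

end

section \<open>The impulse control problem\<close>

locale impulse = brownian M T B
  for M :: "'a measure" and T :: real and B :: "real \<Rightarrow> 'a \<Rightarrow> real ^ 'd" +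
  fixes \<gamma> c :: real
    and L :: "real \<Rightarrow> 'a \<Rightarrow> real ^ 'l"
    and U :: "(real ^ 'l) set"
    and h :: "real \<Rightarrow> 'a \<Rightarrow> real ^ 'l \<Rightarrow> real"
    and \<psi> :: "real ^ 'l \<Rightarrow> real"
    and Y K :: "nat \<Rightarrow> ('a \<Rightarrow> real) \<Rightarrow> ('a \<Rightarrow> real ^ 'l) \<Rightarrow> real \<Rightarrow> 'a \<Rightarrow> real"
    and Z :: "nat \<Rightarrow> ('a \<Rightarrow> real) \<Rightarrow> ('a \<Rightarrow> real ^ 'l) \<Rightarrow> real \<Rightarrow> 'a \<Rightarrow> real ^ 'd"
  assumes L: "H2_process M T B L"
    and U_finite: "finite U" and U_nonempty: "U \<noteq> {}"
    and h_measurable: "(\<lambda>((s, \<omega>), x). h s \<omega> x) \<in> borel_measurable (progressive_sigma M T B \<Otimes>\<^sub>M borel)"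
    and h_bounds: "\<And>s \<omega> x. s \<in> {0..T} \<Longrightarrow> \<omega> \<in> space M \<Longrightarrow> 0 \<le> h s \<omega> x \<and> h s \<omega> x \<le> \<gamma>"
    and c_pos: "c > 0" and \<psi>_ge: "\<And>\<beta>. \<beta> \<in> U \<Longrightarrow> c \<le> \<psi> \<beta>"
    and Y_0: "\<And>\<nu> \<xi>. admissible_start M T B \<nu> \<xi> \<Longrightarrow>
           bsde_solution M T B (driver h L \<nu> \<xi>) (Y 0 \<nu> \<xi>) (Z 0 \<nu> \<xi>)"
    and Y_Suc: "\<And>n \<nu> \<xi>. admissible_start M T B \<nu> \<xi> \<Longrightarrow>
           rbsde_solution M T B (driver h L \<nu> \<xi>) (obstacle U \<psi> (Y n) \<nu> \<xi>)
             (Y (Suc n) \<nu> \<xi>) (Z (Suc n) \<nu> \<xi>) (K (Suc n) \<nu> \<xi>)"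
begin

section \<open>Admissible starts and their drivers\<close>

abbreviation adm :: "('a \<Rightarrow> real) \<Rightarrow> ('a \<Rightarrow> real ^ 'l) \<Rightarrow> bool" where
  "adm \<equiv> admissible_start M T B"

lemma \<gamma>_nonneg: "0 \<le> \<gamma>"
  using h_bounds[of T] T_pos not_empty by force

lemma adm_iff: "adm \<nu> \<xi> \<longleftrightarrow> stop \<nu> \<and> \<xi> \<in> borel_measurable (pre_sigma \<nu>)"
  by (auto simp: admissible_start_def stop_def)

lemma adm_stop: "adm \<nu> \<xi> \<Longrightarrow> stop \<nu>"
  by (simp add: adm_iff)

lemma adm_measurable: "adm \<nu> \<xi> \<Longrightarrow> \<xi> \<in> borel_measurable M"
  using measurable_pre_sigma by (auto simp: adm_iff)

lemma adm_shift: "adm \<nu> \<xi> \<Longrightarrow> adm \<nu> (\<lambda>\<omega>. \<xi> \<omega> + \<beta>)"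
  by (auto simp: adm_iff intro: borel_measurable_add)

text \<open>The defining condition of a progressive set at the full horizon t = T makes it
  measurable for the product with \<open>F T\<close>, and \<open>F T\<close> lies in the
  sigma-algebra of \<open>M\<close>. This opens the way to pathwise integrals.\<close>

lemma progressive_into_product:
  assumes X: "X \<in> measurable (progressive_sigma M T B) N"
  shows "X \<in> measurable (restrict_space borel {0..T} \<Otimes>\<^sub>M M) N"
proof (rule measurable_from_subalg[OF _ X])
  have T: "T \<in> {0..T}" using T_pos by simp
  have "(\<lambda>\<omega>. \<omega>) \<in> measurable M (F T)"
    by (rule measurable_F[of _ T]) simp
  from measurable_compose[OF measurable_snd this]
  have "(\<lambda>x. (fst x, snd x)) \<in> measurable (restrict_space borel {0..T} \<Otimes>\<^sub>M M) (restrict_space borel {0..T} \<Otimes>\<^sub>M F T)"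
    by (intro measurable_Pair measurable_fst)
  then have id: "(\<lambda>x. x) \<in> measurable (restrict_space borel {0..T} \<Otimes>\<^sub>M M) (restrict_space borel {0..T} \<Otimes>\<^sub>M F T)"
    by simp
  have sp: "space (restrict_space borel {0..T} \<Otimes>\<^sub>M M) = {0..T} \<times> space M"
    by (simp add: space_pair_measure space_restrict_space)
  have "A \<in> sets (restrict_space borel {0..T} \<Otimes>\<^sub>M M)" if A: "A \<in> sets (progressive_sigma M T B)" for A
  proof -
    have "A \<inter> ({0..T} \<times> space M) \<in> sets (restrict_space borel {0..T} \<Otimes>\<^sub>M F T)" "A \<subseteq> {0..T} \<times> space M"
      using A T unfolding sets_progressive_sigma by blast+
    then have "A \<in> sets (restrict_space borel {0..T} \<Otimes>\<^sub>M F T)"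
      by (simp add: Int_absorb2)
    from measurable_sets[OF id this] show ?thesis
      using \<open>A \<subseteq> _\<close> by (simp add: sp Int_absorb2)
  qed
  then show "subalgebra (restrict_space borel {0..T} \<Otimes>\<^sub>M M) (progressive_sigma M T B)"
    by (auto simp: subalgebra_def space_progressive sp)
qed

lemma L_measurable: "(\<lambda>(s, \<omega>). L s \<omega>) \<in> borel_measurable (restrict_space borel {0..T} \<Otimes>\<^sub>M M)"
  using L by (intro progressive_into_product) (simp add: H2_process_def)

lemma bounded_field_h:
  assumes X: "(\<lambda>(s, \<omega>). X s \<omega>) \<in> borel_measurable (restrict_space borel {0..T} \<Otimes>\<^sub>M M)"
  shows "bounded_field \<gamma> (\<lambda>s \<omega>. h s \<omega> (X s \<omega>))"
proof -
  have "(\<lambda>x. x) \<in> measurable (restrict_space borel {0..T} \<Otimes>\<^sub>M M) (progressive_sigma M T B)"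
    by (rule progressive_into_product) simp
  from measurable_compose[OF measurable_Pair[OF this X] h_measurable]
  have "(\<lambda>(s, \<omega>). h s \<omega> (X s \<omega>)) \<in> borel_measurable (restrict_space borel {0..T} \<Otimes>\<^sub>M M)"
    by (simp add: case_prod_beta)
  then show ?thesis
    using h_bounds by (simp add: bounded_field_def)
qed

lemma restrict_product_measurable:
  assumes "f \<in> measurable (borel \<Otimes>\<^sub>M M) N"
  shows "f \<in> measurable (restrict_space borel {0..T} \<Otimes>\<^sub>M M) N"
proof -
  have "(\<lambda>x. (fst x, snd x)) \<in> measurable (restrict_space borel {0..T} \<Otimes>\<^sub>M M) (borel \<Otimes>\<^sub>M M)"
    by (intro measurable_Pair measurable_snd measurable_compose[OF measurable_fst] measurable_restrict_space1) simp
  from measurable_compose[OF this assms] show ?thesis by simp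
qed

lemma bounded_field_driver:
  assumes "adm \<nu> \<xi>"
  shows "bounded_field \<gamma> (driver h L \<nu> \<xi>)"
proof -
  have [measurable]: "\<xi> \<in> borel_measurable M" "\<nu> \<in> borel_measurable M"
    using adm_measurable[OF assms] stop_measurable[OF adm_stop[OF assms]] .
  have "(\<lambda>(s, \<omega>). \<xi> \<omega>) \<in> borel_measurable (restrict_space borel {0..T} \<Otimes>\<^sub>M M)"
    by measurable
  with L_measurable have "(\<lambda>x. (case x of (s, \<omega>) \<Rightarrow> L s \<omega>) + (case x of (s, \<omega>) \<Rightarrow> \<xi> \<omega>)) \<in> borel_measurable (restrict_space borel {0..T} \<Otimes>\<^sub>M M)"
    by (rule borel_measurable_add)
  then have "(\<lambda>(s, \<omega>). L s \<omega> + \<xi> \<omega>) \<in> borel_measurable (restrict_space borel {0..T} \<Otimes>\<^sub>M M)"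
    by (simp add: case_prod_beta)
  from bounded_field_h[OF this]
  have h: "bounded_field \<gamma> (\<lambda>s \<omega>. h s \<omega> (L s \<omega> + \<xi> \<omega>))" .
  have "(\<lambda>(s, \<omega>). indicat_real {\<nu> \<omega>..} s) \<in> borel_measurable (restrict_space borel {0..T} \<Otimes>\<^sub>M M)"
    unfolding indicator_def atLeast_iff by (rule restrict_product_measurable) measurable
  moreover have "(\<lambda>(s, \<omega>). h s \<omega> (L s \<omega> + \<xi> \<omega>)) \<in> borel_measurable (restrict_space borel {0..T} \<Otimes>\<^sub>M M)"
    using h by (simp add: bounded_field_def)
  ultimately have "(\<lambda>x. (case x of (s, \<omega>) \<Rightarrow> h s \<omega> (L s \<omega> + \<xi> \<omega>)) * (case x of (s, \<omega>) \<Rightarrow> indicat_real {\<nu> \<omega>..} s))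
      \<in> borel_measurable (restrict_space borel {0..T} \<Otimes>\<^sub>M M)"
    by (intro borel_measurable_times)
  then show ?thesis
    using h_bounds \<gamma>_nonneg unfolding bounded_field_def driver_def
    by (auto simp: case_prod_beta indicator_def)
qed

text \<open>Level 0 solves an equation without reflection and the hypotheses leave
  \<open>K 0\<close> arbitrary; setting it to 0 makes the same identity available at every
  level.\<close>

definition pushing :: "nat \<Rightarrow> ('a \<Rightarrow> real) \<Rightarrow> ('a \<Rightarrow> real ^ 'l) \<Rightarrow> real \<Rightarrow> 'a \<Rightarrow> real" where
  "pushing n \<nu> \<xi> = (if n = 0 then (\<lambda>_ _. 0) else K n \<nu> \<xi>)"

lemma backward_Y:
  assumes "adm \<nu> \<xi>"
  shows "backward (driver h L \<nu> \<xi>) (Y n \<nu> \<xi>) (pushing n \<nu> \<xi>)"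
proof (cases n)
  case 0
  have "(SUP t\<in>{0..T}. 0 :: ennreal) = 0"
    by (simp add: SUP_constant bot_ennreal)
  then have "Sci2_process M T B (\<lambda>_ _. 0)"
    unfolding Sci2_process_def Sc2_process_def by (simp add: mono_on_def)
  then show ?thesis
    using Y_0[OF assms] unfolding bsde_solution_def backward_def pushing_def 0 by auto
next
  case (Suc m)
  then show ?thesis
    using Y_Suc[OF assms, of m] unfolding rbsde_solution_def backward_def pushing_def Suc by auto
qed

lemma Sc2_Y: "adm \<nu> \<xi> \<Longrightarrow> Sc2_process M T B (Y n \<nu> \<xi>)"
  using backward_Y by (simp add: backward_def)

lemma Y_prog: "adm \<nu> \<xi> \<Longrightarrow> prog (Y n \<nu> \<xi>)"
  using Sc2_Y by (simp add: Sc2_process_def)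

lemma Y_continuous: "adm \<nu> \<xi> \<Longrightarrow> \<omega> \<in> space M \<Longrightarrow> continuous_on {0..T} (\<lambda>t. Y n \<nu> \<xi> t \<omega>)"
  using Sc2_Y by (simp add: Sc2_process_def)

lemma Y_terminal:
  assumes "adm \<nu> \<xi>"
  shows "AE \<omega> in M. Y n \<nu> \<xi> T \<omega> = 0"
proof -
  obtain I where "AE \<omega> in M. \<forall>t\<in>{0..T}. Y n \<nu> \<xi> t \<omega> = (LBINT s:{t..T}. driver h L \<nu> \<xi> s \<omega>)
      + pushing n \<nu> \<xi> T \<omega> - pushing n \<nu> \<xi> t \<omega> - (I T \<omega> - I t \<omega>)"
    using backward_Y[OF assms, of n] unfolding backward_def by blast
  then show ?thesis
  proof eventually_elim
    case (elim \<omega>)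
    have "T \<in> {0..T}" using T_pos by simp
    moreover have "(LBINT s:{T..T}. driver h L \<nu> \<xi> s \<omega>) = 0"
      by (simp add: LBINT_point)
    ultimately show ?case using elim by fastforce
  qed
qed

section \<open>The gap above the obstacle and the times at which it closes\<close>

definition gap :: "nat \<Rightarrow> ('a \<Rightarrow> real) \<Rightarrow> ('a \<Rightarrow> real ^ 'l) \<Rightarrow> real \<Rightarrow> 'a \<Rightarrow> real" where
  "gap n \<nu> \<xi> t \<omega> = Y (Suc n) \<nu> \<xi> t \<omega> - obstacle U \<psi> (Y n) \<nu> \<xi> t \<omega>"

lemma gap_continuous:
  assumes "adm \<nu> \<xi>" "\<omega> \<in> space M"
  shows "continuous_on {0..T} (\<lambda>t. gap n \<nu> \<xi> t \<omega>)"
  unfolding gap_def obstacle_def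
  by (intro continuous_on_diff Y_continuous assms continuous_on_Max U_finite U_nonempty
      continuous_on_add continuous_on_const adm_shift)

lemma gap_adapted:
  assumes "adm \<nu> \<xi>" "t \<in> {0..T}"
  shows "gap n \<nu> \<xi> t \<in> borel_measurable (F t)"
proof -
  have "(\<lambda>\<omega>. Max ((\<lambda>\<beta>. - \<psi> \<beta> + Y n \<nu> (\<lambda>\<omega>'. \<xi> \<omega>' + \<beta>) t \<omega>) ` U)) \<in> borel_measurable (F t)"
    using U_finite
    by (intro borel_measurable_Max borel_measurable_add borel_measurable_const measurable_prog Y_prog adm_shift assms)
  then show ?thesis
    unfolding gap_def obstacle_def
    by (rule borel_measurable_diff[OF measurable_prog[OF Y_prog[OF assms(1)] assms(2)]])
qed

text \<open>With no intervention left the time is \<open>T\<close>, which encodes inaction: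
  interventions are charged only before \<open>T\<close>.\<close>

definition next_time :: "nat \<Rightarrow> ('a \<Rightarrow> real) \<Rightarrow> ('a \<Rightarrow> real ^ 'l) \<Rightarrow> ('a \<Rightarrow> real) \<Rightarrow> 'a \<Rightarrow> real" where
  "next_time n \<nu> \<xi> \<sigma> = (case n of 0 \<Rightarrow> (\<lambda>_. T) | Suc m \<Rightarrow> hit (gap m \<nu> \<xi>) \<sigma>)"

lemma next_time_stop: "adm \<nu> \<xi> \<Longrightarrow> stop \<sigma> \<Longrightarrow> stop (next_time n \<nu> \<xi> \<sigma>)"
  using T_pos
  by (auto simp: next_time_def split: nat.split intro!: stop_const stop_hit gap_adapted gap_continuous)

lemma next_time_range:
  "adm \<nu> \<xi> \<Longrightarrow> stop \<sigma> \<Longrightarrow> \<omega> \<in> space M \<Longrightarrow> \<sigma> \<omega> \<le> next_time n \<nu> \<xi> \<sigma> \<omega> \<and> next_time n \<nu> \<xi> \<sigma> \<omega> \<le> T"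
  using stop_range[of \<sigma> \<omega>] hit_range[OF gap_adapted gap_continuous, of \<nu> \<xi> \<sigma> \<omega>]
  by (auto simp: next_time_def split: nat.split)

lemma obstacle_le:
  assumes "adm \<nu> \<xi>"
  shows "AE \<omega> in M. \<forall>t\<in>{0..T}. obstacle U \<psi> (Y n) \<nu> \<xi> t \<omega> \<le> Y (Suc n) \<nu> \<xi> t \<omega>"
  using Y_Suc[OF assms] by (simp add: rbsde_solution_def)

lemma at_next_time:
  assumes "adm \<nu> \<xi>" "stop \<sigma>"
  shows "AE \<omega> in M. next_time (Suc n) \<nu> \<xi> \<sigma> \<omega> < T \<longrightarrow>
    Y (Suc n) \<nu> \<xi> (next_time (Suc n) \<nu> \<xi> \<sigma> \<omega>) \<omega> = obstacle U \<psi> (Y n) \<nu> \<xi> (next_time (Suc n) \<nu> \<xi> \<sigma> \<omega>) \<omega>"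
  using obstacle_le[OF assms(1), of n] AE_space
proof eventually_elim
  case (elim \<omega>)
  show ?case
  proof
    assume t: "next_time (Suc n) \<nu> \<xi> \<sigma> \<omega> < T"
    have "next_time (Suc n) \<nu> \<xi> \<sigma> \<omega> \<in> {0..T}"
      using stop_range[OF next_time_stop[OF assms] elim(2)] by simp
    with elim(1) have "obstacle U \<psi> (Y n) \<nu> \<xi> (next_time (Suc n) \<nu> \<xi> \<sigma> \<omega>) \<omega> \<le> Y (Suc n) \<nu> \<xi> (next_time (Suc n) \<nu> \<xi> \<sigma> \<omega>) \<omega>"
      by blast
    moreover have "gap n \<nu> \<xi> (next_time (Suc n) \<nu> \<xi> \<sigma> \<omega>) \<omega> \<le> 0"
      using at_hit[OF gap_adapted gap_continuous assms(2) elim(2), OF assms(1) _ assms(1)] t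
      by (simp add: next_time_def)
    ultimately show "Y (Suc n) \<nu> \<xi> (next_time (Suc n) \<nu> \<xi> \<sigma> \<omega>) \<omega> = obstacle U \<psi> (Y n) \<nu> \<xi> (next_time (Suc n) \<nu> \<xi> \<sigma> \<omega>) \<omega>"
      by (simp add: gap_def)
  qed
qed

text \<open>Before the hitting time the gap is positive, and there the Skorokhod condition allows no
  growth of \<open>K\<close>.\<close>

lemma pushing_flat:
  assumes "adm \<nu> \<xi>" "stop \<sigma>"
  shows "AE \<omega> in M. pushing n \<nu> \<xi> (next_time n \<nu> \<xi> \<sigma> \<omega>) \<omega> = pushing n \<nu> \<xi> (\<sigma> \<omega>) \<omega>"
proof (cases n)
  case 0 then show ?thesis by (simp add: pushing_def)
next
  case (Suc m)
  have R: "AE \<omega> in M. (LINT t:{0..T}|interval_measure (\<lambda>t. K (Suc m) \<nu> \<xi> (max 0 (min T t)) \<omega>).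
        Y (Suc m) \<nu> \<xi> t \<omega> - obstacle U \<psi> (Y m) \<nu> \<xi> t \<omega>) = 0"
    and K: "\<And>\<omega>. \<omega> \<in> space M \<Longrightarrow> continuous_on {0..T} (\<lambda>t. K (Suc m) \<nu> \<xi> t \<omega>)"
      "\<And>\<omega>. \<omega> \<in> space M \<Longrightarrow> mono_on {0..T} (\<lambda>t. K (Suc m) \<nu> \<xi> t \<omega>)"
    using Y_Suc[OF assms(1), of m] by (auto simp: rbsde_solution_def Sci2_process_def Sc2_process_def)
  show ?thesis
    using R obstacle_le[OF assms(1), of m] AE_space
  proof eventually_elim
    case (elim \<omega>)
    have "K (Suc m) \<nu> \<xi> (\<sigma> \<omega>) \<omega> = K (Suc m) \<nu> \<xi> (next_time (Suc m) \<nu> \<xi> \<sigma> \<omega>) \<omega>"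
    proof (rule skorokhod_flat[OF K(1)[OF elim(3)] K(2)[OF elim(3)] gap_continuous[OF assms(1) elim(3)]])
      show "0 \<le> gap m \<nu> \<xi> t \<omega>" if "t \<in> {0..T}" for t
        using elim(2) that by (simp add: gap_def)
      show "(LINT t:{0..T}|interval_measure (\<lambda>t. K (Suc m) \<nu> \<xi> (max 0 (min T t)) \<omega>). gap m \<nu> \<xi> t \<omega>) = 0"
        using elim(1) by (simp only: gap_def)
      show "0 \<le> \<sigma> \<omega>" "\<sigma> \<omega> \<le> next_time (Suc m) \<nu> \<xi> \<sigma> \<omega>" "next_time (Suc m) \<nu> \<xi> \<sigma> \<omega> \<le> T"
        using stop_range[OF assms(2) elim(3)] next_time_range[OF assms elim(3)] by auto
      show "0 < gap m \<nu> \<xi> t \<omega>" if "\<sigma> \<omega> \<le> t" "t < next_time (Suc m) \<nu> \<xi> \<sigma> \<omega>" for t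
        using that by (intro before_hit[OF gap_adapted gap_continuous assms(2) elim(3), OF assms(1) _ assms(1)])
          (simp_all add: next_time_def)
    qed
    then show ?case by (simp add: Suc pushing_def)
  qed
qed

text \<open>This replaces the uniqueness theorem for reflected equations.\<close>

lemma Y_agree:
  assumes "adm \<nu> \<xi>" "adm \<nu>' \<xi>'" "stop \<sigma>" "A \<in> sets (pre_sigma \<sigma>)"
    and "\<And>\<omega>. \<omega> \<in> A \<Longrightarrow> \<nu> \<omega> \<le> \<sigma> \<omega> \<and> \<nu>' \<omega> \<le> \<sigma> \<omega> \<and> \<xi> \<omega> = \<xi>' \<omega>"
  shows "AE \<omega> in M. \<omega> \<in> A \<longrightarrow> Y n \<nu> \<xi> (\<sigma> \<omega>) \<omega> = Y n \<nu>' \<xi>' (\<sigma> \<omega>) \<omega>"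
  using assms
proof (induction n arbitrary: \<nu> \<xi> \<nu>' \<xi>' \<sigma> A rule: less_induct)
  \<comment> \<open>One inequality is moved from \<sigma> to the next intervention time of the first
    start: until then its \<open>K\<close> is flat, and on \<open>A\<close> the drivers agree from
    \<sigma> on, both starts lying in the past with the same level.\<close>
  have compare: "AE \<omega> in M. \<omega> \<in> A \<longrightarrow> Y n \<nu> \<xi> (\<sigma> \<omega>) \<omega> \<le> Y n \<nu>' \<xi>' (\<sigma> \<omega>) \<omega>"
    if a: "adm \<nu> \<xi>" "adm \<nu>' \<xi>'" "stop \<sigma>" "A \<in> sets (pre_sigma \<sigma>)"
      and eq: "\<And>\<omega>. \<omega> \<in> A \<Longrightarrow> \<nu> \<omega> \<le> \<sigma> \<omega> \<and> \<nu>' \<omega> \<le> \<sigma> \<omega> \<and> \<xi> \<omega> = \<xi>' \<omega>"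
      and e: "AE \<omega> in M. \<omega> \<in> A \<longrightarrow> Y n \<nu> \<xi> (next_time n \<nu> \<xi> \<sigma> \<omega>) \<omega> \<le> Y n \<nu>' \<xi>' (next_time n \<nu> \<xi> \<sigma> \<omega>) \<omega>"
    for n \<nu> \<xi> \<nu>' \<xi>' \<sigma> A
    using next_time_range[OF a(1,3)] eq
    by (intro backward_compare[OF backward_Y[OF a(1)] bounded_field_driver[OF a(1)] backward_Y[OF a(2)] bounded_field_driver[OF a(2)]
          a(3) next_time_stop[OF a(1,3)] _ a(4) _ pushing_flat[OF a(1,3)] e])
      (auto simp: driver_def indicator_def intro: order_trans)
  case (less n)
  have le: "AE \<omega> in M. \<omega> \<in> A \<longrightarrow> Y n \<nu> \<xi> (\<sigma> \<omega>) \<omega> \<le> Y n \<nu>' \<xi>' (\<sigma> \<omega>) \<omega>"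
    if a: "adm \<nu> \<xi>" "adm \<nu>' \<xi>'" and eq: "\<And>\<omega>. \<omega> \<in> A \<Longrightarrow> \<nu> \<omega> \<le> \<sigma> \<omega> \<and> \<nu>' \<omega> \<le> \<sigma> \<omega> \<and> \<xi> \<omega> = \<xi>' \<omega>" for \<nu> \<xi> \<nu>' \<xi>'
  proof (rule compare[OF a less.prems(3,4) eq])
    let ?D = "next_time n \<nu> \<xi> \<sigma>"
    note D = next_time_stop[OF a(1) less.prems(3), of n]
    note r = next_time_range[OF a(1) less.prems(3), of _ n]
    have A: "A \<in> sets (pre_sigma ?D)"
      using pre_sigma_mono[OF less.prems(3) D] r less.prems(4) by blast
    have Asp: "A \<subseteq> space M" using pre_sigma_subset[OF D A] sets.sets_into_space by blast
    \<comment> \<open>Where the next time is before \<open>T\<close>, the left value equals its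
      obstacle. This is a maximum of values one level lower at shifted starts, which the induction
      hypothesis matches with the obstacle of the other start; that obstacle lies below the right
      value. At level 0 the next time is \<open>T\<close> and there is nothing to show.\<close>
    have "AE \<omega> in M. \<omega> \<in> A \<longrightarrow> ?D \<omega> < T \<longrightarrow> Y n \<nu> \<xi> (?D \<omega>) \<omega> \<le> Y n \<nu>' \<xi>' (?D \<omega>) \<omega>"
    proof (cases n)
      case 0
      then show ?thesis by (simp add: next_time_def)
    next
      case (Suc m)
      have "AE \<omega> in M. \<omega> \<in> A \<longrightarrow> Y m \<nu> (\<lambda>\<omega>'. \<xi> \<omega>' + \<beta>) (?D \<omega>) \<omega> = Y m \<nu>' (\<lambda>\<omega>'. \<xi>' \<omega>' + \<beta>) (?D \<omega>) \<omega>" for \<beta>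
      proof (rule less.IH[OF _ adm_shift[OF a(1)] adm_shift[OF a(2)] D A])
        fix \<omega> assume "\<omega> \<in> A"
        then show "\<nu> \<omega> \<le> ?D \<omega> \<and> \<nu>' \<omega> \<le> ?D \<omega> \<and> \<xi> \<omega> + \<beta> = \<xi>' \<omega> + \<beta>"
          using eq[of \<omega>] r[of \<omega>] Asp by auto
      qed (simp add: Suc)
      then have "AE \<omega> in M. \<forall>\<beta>\<in>U. \<omega> \<in> A \<longrightarrow> Y m \<nu> (\<lambda>\<omega>'. \<xi> \<omega>' + \<beta>) (?D \<omega>) \<omega> = Y m \<nu>' (\<lambda>\<omega>'. \<xi>' \<omega>' + \<beta>) (?D \<omega>) \<omega>"
        using U_finite by (intro AE_finite_allI) auto
      then show ?thesis
        using at_next_time[OF a(1) less.prems(3), of m] obstacle_le[OF a(2), of m] AE_space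
      proof eventually_elim
        case (elim \<omega>)
        have "obstacle U \<psi> (Y m) \<nu> \<xi> (?D \<omega>) \<omega> = obstacle U \<psi> (Y m) \<nu>' \<xi>' (?D \<omega>) \<omega>" if "\<omega> \<in> A"
          unfolding obstacle_def using elim(1) that by (intro arg_cong[where f=Max] image_cong) auto
        moreover have "obstacle U \<psi> (Y m) \<nu>' \<xi>' (?D \<omega>) \<omega> \<le> Y n \<nu>' \<xi>' (?D \<omega>) \<omega>"
          using elim(3) stop_range[OF D elim(4)] by (simp add: Suc)
        ultimately show ?case using elim(2) by (simp add: Suc)
      qed
    qed
    \<comment> \<open>At \<open>T\<close> both processes vanish.\<close>
    then show "AE \<omega> in M. \<omega> \<in> A \<longrightarrow> Y n \<nu> \<xi> (?D \<omega>) \<omega> \<le> Y n \<nu>' \<xi>' (?D \<omega>) \<omega>"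
      using Y_terminal[OF a(1), of n] Y_terminal[OF a(2), of n] AE_space
    proof eventually_elim
      case (elim \<omega>)
      then show ?case
        using stop_range[OF D elim(4)] by (cases "?D \<omega> < T") auto
    qed
  qed
  \<comment> \<open>The argument is one-sided, using the hitting time of the left process, so
    equality needs it with the starts exchanged.\<close>
  show ?case
    using le[OF less.prems(1,2)] le[OF less.prems(2,1)] less.prems(5) by fastforce
qed

section \<open>Payoffs of finitely many interventions after a random start\<close>

definition regular :: "(nat \<Rightarrow> 'a \<Rightarrow> real) \<Rightarrow> (nat \<Rightarrow> 'a \<Rightarrow> real ^ 'l) \<Rightarrow> bool" where
  "regular \<tau> \<xi> \<longleftrightarrow> (\<forall>j. stop (\<tau> j) \<and> \<xi> j \<in> borel_measurable (pre_sigma (\<tau> j)) \<and>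
     (\<forall>\<omega>\<in>space M. \<xi> j \<omega> \<in> U \<and> \<tau> j \<omega> \<le> \<tau> (Suc j) \<omega>))"

definition stage ::
  "nat \<Rightarrow> ('a \<Rightarrow> real ^ 'l) \<Rightarrow> (nat \<Rightarrow> 'a \<Rightarrow> real) \<Rightarrow> (nat \<Rightarrow> 'a \<Rightarrow> real ^ 'l) \<Rightarrow> real \<Rightarrow> 'a \<Rightarrow> real ^ 'l" where
  "stage k \<Xi> \<tau> \<xi> s \<omega> = L s \<omega> + \<Xi> \<omega> + (\<Sum>j<k. indicat_real {\<tau> j \<omega>..} s *\<^sub>R \<xi> j \<omega>)"

definition cost :: "nat \<Rightarrow> (nat \<Rightarrow> 'a \<Rightarrow> real) \<Rightarrow> (nat \<Rightarrow> 'a \<Rightarrow> real ^ 'l) \<Rightarrow> 'a \<Rightarrow> real" where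
  "cost k \<tau> \<xi> \<omega> = (\<Sum>j<k. \<psi> (\<xi> j \<omega>) * indicat_real {..<T} (\<tau> j \<omega>))"

text \<open>The reward on [\<nu>, T] from the level \<Xi> with the first \<open>k\<close>
  interventions only. The random start is what allows an induction: after one intervention the
  remaining problem has the same form.\<close>

definition payoff ::
  "nat \<Rightarrow> ('a \<Rightarrow> real) \<Rightarrow> ('a \<Rightarrow> real ^ 'l) \<Rightarrow> (nat \<Rightarrow> 'a \<Rightarrow> real) \<Rightarrow> (nat \<Rightarrow> 'a \<Rightarrow> real ^ 'l) \<Rightarrow> real" where
  "payoff k \<nu> \<Xi> \<tau> \<xi> = (\<integral>\<omega>. (LBINT s:{\<nu> \<omega>..T}. h s \<omega> (stage k \<Xi> \<tau> \<xi> s \<omega>)) - cost k \<tau> \<xi> \<omega> \<partial>M)"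

lemma regular_stop: "regular \<tau> \<xi> \<Longrightarrow> stop (\<tau> j)"
  by (simp add: regular_def)

lemma regular_U: "regular \<tau> \<xi> \<Longrightarrow> \<omega> \<in> space M \<Longrightarrow> \<xi> j \<omega> \<in> U"
  by (simp add: regular_def)

lemma regular_measurable: "regular \<tau> \<xi> \<Longrightarrow> \<xi> j \<in> borel_measurable M"
  unfolding regular_def using measurable_pre_sigma by blast

lemma regular_mono:
  assumes "regular \<tau> \<xi>" "\<omega> \<in> space M"
  shows "\<tau> 0 \<omega> \<le> \<tau> j \<omega>"
  using assms by (induction j) (auto simp: regular_def intro: order_trans)

lemma regular_shift: "regular \<tau> \<xi> \<Longrightarrow> regular (\<lambda>j. \<tau> (Suc j)) (\<lambda>j. \<xi> (Suc j))"
  by (simp add: regular_def)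

text \<open>The cost \<psi> is an arbitrary function on the finite set \<open>U\<close>, so the
  composition is a finite sum over the level sets of \<xi>.\<close>

lemma measurable_\<psi>:
  assumes \<xi>: "\<xi> \<in> borel_measurable M" and U: "\<And>\<omega>. \<omega> \<in> space M \<Longrightarrow> \<xi> \<omega> \<in> U"
  shows "(\<lambda>\<omega>. \<psi> (\<xi> \<omega>)) \<in> borel_measurable M"
proof -
  have "(\<lambda>\<omega>. \<Sum>\<beta>\<in>U. \<psi> \<beta> * indicat_real (\<xi> -` {\<beta>} \<inter> space M) \<omega>) \<in> borel_measurable M"
    using \<xi> by (intro borel_measurable_sum borel_measurable_times borel_measurable_const
        borel_measurable_indicator measurable_sets) auto
  then show ?thesis
  proof (rule measurable_cong[THEN iffD1, rotated])
    fix \<omega> assume \<omega>: "\<omega> \<in> space M"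
    have "(\<Sum>\<beta>\<in>U. \<psi> \<beta> * indicat_real (\<xi> -` {\<beta>} \<inter> space M) \<omega>) = (\<Sum>\<beta>\<in>U. if \<beta> = \<xi> \<omega> then \<psi> \<beta> else 0)"
      using \<omega> by (intro sum.cong) (auto simp: indicator_def)
    then show "(\<Sum>\<beta>\<in>U. \<psi> \<beta> * indicat_real (\<xi> -` {\<beta>} \<inter> space M) \<omega>) = \<psi> (\<xi> \<omega>)"
      using U_finite U[OF \<omega>] by simp
  qed
qed

lemma integrable_cost_term:
  assumes \<xi>: "\<xi> \<in> borel_measurable M" and U: "\<And>\<omega>. \<omega> \<in> space M \<Longrightarrow> \<xi> \<omega> \<in> U" and \<tau>: "stop \<tau>"
  shows "integrable M (\<lambda>\<omega>. \<psi> (\<xi> \<omega>) * indicat_real {..<T} (\<tau> \<omega>))"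
proof (rule integrable_const_bound[where B="Max (\<psi> ` U)"])
  show "AE \<omega> in M. norm (\<psi> (\<xi> \<omega>) * indicat_real {..<T} (\<tau> \<omega>)) \<le> Max (\<psi> ` U)"
  proof (rule AE_I2)
    fix \<omega> assume \<omega>: "\<omega> \<in> space M"
    have "0 \<le> \<psi> (\<xi> \<omega>)" using \<psi>_ge[OF U[OF \<omega>]] c_pos by simp
    moreover have "\<psi> (\<xi> \<omega>) \<le> Max (\<psi> ` U)" using U_finite U[OF \<omega>] by simp
    ultimately show "norm (\<psi> (\<xi> \<omega>) * indicat_real {..<T} (\<tau> \<omega>)) \<le> Max (\<psi> ` U)"
      by (auto simp: indicator_def)
  qed
  show "(\<lambda>\<omega>. \<psi> (\<xi> \<omega>) * indicat_real {..<T} (\<tau> \<omega>)) \<in> borel_measurable M"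
    using measurable_\<psi>[OF \<xi> U] stop_measurable[OF \<tau>] by measurable
qed

lemma integrable_cost: "regular \<tau> \<xi> \<Longrightarrow> integrable M (cost k \<tau> \<xi>)"
  unfolding cost_def
  by (intro Bochner_Integration.integrable_sum integrable_cost_term regular_measurable regular_U regular_stop)

lemma stage_measurable:
  assumes \<Xi>: "\<Xi> \<in> borel_measurable M" and r: "regular \<tau> \<xi>"
  shows "(\<lambda>(s, \<omega>). stage k \<Xi> \<tau> \<xi> s \<omega>) \<in> borel_measurable (restrict_space borel {0..T} \<Otimes>\<^sub>M M)"
proof -
  have "(\<lambda>x. indicat_real {\<tau> j (snd x)..} (fst x) *\<^sub>R \<xi> j (snd x)) \<in> borel_measurable (borel \<Otimes>\<^sub>M M)" for j
  proof -
    note [measurable] = stop_measurable[OF regular_stop[OF r, of j]] regular_measurable[OF r, of j]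
    show ?thesis unfolding indicator_def atLeast_iff by measurable
  qed
  moreover have "(\<lambda>x. \<Xi> (snd x)) \<in> borel_measurable (borel \<Otimes>\<^sub>M M)"
    using \<Xi> by measurable
  ultimately have "(\<lambda>x. \<Xi> (snd x) + (\<Sum>j<k. indicat_real {\<tau> j (snd x)..} (fst x) *\<^sub>R \<xi> j (snd x))) \<in> borel_measurable (borel \<Otimes>\<^sub>M M)"
    by (intro borel_measurable_add borel_measurable_sum)
  then have "(\<lambda>x. \<Xi> (snd x) + (\<Sum>j<k. indicat_real {\<tau> j (snd x)..} (fst x) *\<^sub>R \<xi> j (snd x))) \<in> borel_measurable (restrict_space borel {0..T} \<Otimes>\<^sub>M M)"
    by (rule restrict_product_measurable)
  from borel_measurable_add[OF L_measurable this] show ?thesis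
    by (simp add: stage_def case_prod_beta add.assoc)
qed

lemma bounded_field_stage:
  "\<Xi> \<in> borel_measurable M \<Longrightarrow> regular \<tau> \<xi> \<Longrightarrow> bounded_field \<gamma> (\<lambda>s \<omega>. h s \<omega> (stage k \<Xi> \<tau> \<xi> s \<omega>))"
  by (intro bounded_field_h stage_measurable)

lemma integrable_running:
  "adm \<nu> \<Xi> \<Longrightarrow> regular \<tau> \<xi> \<Longrightarrow> integrable M (\<lambda>\<omega>. LBINT s:{\<nu> \<omega>..T}. h s \<omega> (stage k \<Xi> \<tau> \<xi> s \<omega>))"
  by (rule bounded_field_integral_integrable[OF bounded_field_stage[OF adm_measurable] adm_stop])

abbreviation tail :: "('a \<Rightarrow> real) \<Rightarrow> ('a \<Rightarrow> real ^ 'l) \<Rightarrow> ('a \<Rightarrow> real) \<Rightarrow> 'a \<Rightarrow> real" where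
  "tail \<nu> \<Xi> \<rho> \<omega> \<equiv> LBINT s:{\<rho> \<omega>..T}. driver h L \<nu> \<Xi> s \<omega>"

lemma integrable_tail: "adm \<nu> \<Xi> \<Longrightarrow> stop \<rho> \<Longrightarrow> integrable M (tail \<nu> \<Xi> \<rho>)"
  by (rule bounded_field_integral_integrable[OF bounded_field_driver])

text \<open>The difference of the two tails is the running reward between \<nu> and \<tau>; by the
  stopping identity, this variable has the same expectation as \<open>Y n\<close> at \<nu>.\<close>

abbreviation continuation ::
  "nat \<Rightarrow> ('a \<Rightarrow> real) \<Rightarrow> ('a \<Rightarrow> real ^ 'l) \<Rightarrow> ('a \<Rightarrow> real) \<Rightarrow> 'a \<Rightarrow> real" where
  "continuation n \<nu> \<Xi> \<tau> \<omega> \<equiv> Y n \<nu> \<Xi> (\<tau> \<omega>) \<omega>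
     + (pushing n \<nu> \<Xi> (\<tau> \<omega>) \<omega> - pushing n \<nu> \<Xi> (\<nu> \<omega>) \<omega>) + tail \<nu> \<Xi> \<nu> \<omega> - tail \<nu> \<Xi> \<tau> \<omega>"

lemma integrable_continuation:
  assumes a: "adm \<nu> \<Xi>" and \<tau>: "stop \<tau>"
  shows "integrable M (continuation n \<nu> \<Xi> \<tau>)"
proof -
  have "Sc2_process M T B (pushing n \<nu> \<Xi>)"
    using backward_Y[OF a] by (simp add: backward_def Sci2_process_def)
  then show ?thesis
    by (intro Bochner_Integration.integrable_add Bochner_Integration.integrable_diff
      integrable_stopped[OF Sc2_Y[OF a]] integrable_stopped[of "pushing n \<nu> \<Xi>"]
      integrable_tail a \<tau> adm_stop[OF a])
qed

lemma expectation_identity: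
  assumes a: "adm \<nu> \<Xi>" and \<tau>: "stop \<tau>" and le: "\<And>\<omega>. \<omega> \<in> space M \<Longrightarrow> \<nu> \<omega> \<le> \<tau> \<omega>"
  shows "(\<integral>\<omega>. Y n \<nu> \<Xi> (\<nu> \<omega>) \<omega> \<partial>M) = (\<integral>\<omega>. continuation n \<nu> \<Xi> \<tau> \<omega> \<partial>M)"
proof -
  note \<nu> = adm_stop[OF a]
  let ?P = "\<lambda>\<omega>. Y n \<nu> \<Xi> (\<nu> \<omega>) \<omega> - tail \<nu> \<Xi> \<nu> \<omega>"
  let ?R = "\<lambda>\<omega>. Y n \<nu> \<Xi> (\<tau> \<omega>) \<omega> - tail \<nu> \<Xi> \<tau> \<omega> + (pushing n \<nu> \<Xi> (\<tau> \<omega>) \<omega> - pushing n \<nu> \<Xi> (\<nu> \<omega>) \<omega>)"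
  have R_eq: "continuation n \<nu> \<Xi> \<tau> \<omega> - tail \<nu> \<Xi> \<nu> \<omega> = ?R \<omega>" for \<omega>
    by simp
  have P: "integrable M ?P"
    by (intro Bochner_Integration.integrable_diff integrable_stopped[OF Sc2_Y[OF a]] integrable_tail a \<nu>)
  have R: "integrable M ?R"
    using Bochner_Integration.integrable_diff[OF integrable_continuation[OF a \<tau>, of n] integrable_tail[OF a \<nu>]]
    by (simp only: R_eq)
  have "space M \<in> sets (pre_sigma \<nu>)"
    using sets.top[of "pre_sigma \<nu>"] by (simp add: space_pre_sigma)
  then have "(\<integral>\<omega>\<in>space M. ?P \<omega> \<partial>M) = (\<integral>\<omega>\<in>space M. ?R \<omega> \<partial>M)"
    by (intro backward_identity[OF backward_Y[OF a] bounded_field_driver[OF a] \<nu> \<tau> le])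
  then have "(\<integral>\<omega>. ?P \<omega> \<partial>M) = (\<integral>\<omega>. ?R \<omega> \<partial>M)"
    by (simp only: set_integral_space[OF P] set_integral_space[OF R])
  then have "(\<integral>\<omega>. ?P \<omega> + tail \<nu> \<Xi> \<nu> \<omega> \<partial>M) = (\<integral>\<omega>. ?R \<omega> + tail \<nu> \<Xi> \<nu> \<omega> \<partial>M)"
    by (simp only: Bochner_Integration.integral_add[OF P integrable_tail[OF a \<nu>]]
        Bochner_Integration.integral_add[OF R integrable_tail[OF a \<nu>]])
  then show ?thesis
    by (simp add: algebra_simps)
qed

section \<open>One intervention followed by the value with the remaining ones\<close>

abbreviation intervention ::
  "nat \<Rightarrow> ('a \<Rightarrow> real) \<Rightarrow> ('a \<Rightarrow> real ^ 'l) \<Rightarrow> ('a \<Rightarrow> real) \<Rightarrow> ('a \<Rightarrow> real ^ 'l) \<Rightarrow> 'a \<Rightarrow> real" where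
  "intervention k \<nu> \<Xi> \<tau> \<xi> \<omega> \<equiv> Y k \<tau> (\<lambda>\<omega>. \<Xi> \<omega> + \<xi> \<omega>) (\<tau> \<omega>) \<omega>
     - \<psi> (\<xi> \<omega>) * indicat_real {..<T} (\<tau> \<omega>) + tail \<nu> \<Xi> \<nu> \<omega> - tail \<nu> \<Xi> \<tau> \<omega>"

context
  fixes \<nu> \<tau> :: "'a \<Rightarrow> real" and \<Xi> \<xi> :: "'a \<Rightarrow> real ^ 'l"
  assumes a: "adm \<nu> \<Xi>" and \<tau>: "stop \<tau>" and le: "\<And>\<omega>. \<omega> \<in> space M \<Longrightarrow> \<nu> \<omega> \<le> \<tau> \<omega>"
    and \<xi>: "\<xi> \<in> borel_measurable (pre_sigma \<tau>)" and \<xi>_U: "\<And>\<omega>. \<omega> \<in> space M \<Longrightarrow> \<xi> \<omega> \<in> U"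
begin

lemma adm_after: "adm \<tau> (\<lambda>\<omega>. \<Xi> \<omega> + \<xi> \<omega>)"
proof -
  have "\<Xi> \<in> borel_measurable (pre_sigma \<tau>)"
    using a by (intro measurable_pre_sigma_mono[OF _ \<tau> le]) (auto simp: adm_iff)
  then show ?thesis
    using \<tau> \<xi> by (auto simp: adm_iff intro: borel_measurable_add)
qed

text \<open>Inside the level on the left, \<xi> is frozen at the outer \<omega>, so on each event
  \<xi> = \<beta> the start carries a constant shift, as in the obstacle. \<open>Y_agree\<close>
  applies on each of these events, and finitely many exceptional sets are united.\<close>

lemma Y_after:
  "AE \<omega> in M. Y k \<nu> (\<lambda>\<omega>'. \<Xi> \<omega>' + \<xi> \<omega>) (\<tau> \<omega>) \<omega> = Y k \<tau> (\<lambda>\<omega>. \<Xi> \<omega> + \<xi> \<omega>) (\<tau> \<omega>) \<omega>"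
proof -
  have "AE \<omega> in M. \<omega> \<in> \<xi> -` {\<beta>} \<inter> space M \<longrightarrow>
      Y k \<nu> (\<lambda>\<omega>'. \<Xi> \<omega>' + \<beta>) (\<tau> \<omega>) \<omega> = Y k \<tau> (\<lambda>\<omega>. \<Xi> \<omega> + \<xi> \<omega>) (\<tau> \<omega>) \<omega>" for \<beta>
  proof (rule Y_agree[OF adm_shift[OF a] adm_after \<tau>])
    show "\<xi> -` {\<beta>} \<inter> space M \<in> sets (pre_sigma \<tau>)"
      using measurable_sets[OF \<xi>, of "{\<beta>}"] by (simp add: space_pre_sigma)
  qed (use le in auto)
  then have "AE \<omega> in M. \<forall>\<beta>\<in>U. \<omega> \<in> \<xi> -` {\<beta>} \<inter> space M \<longrightarrow>
      Y k \<nu> (\<lambda>\<omega>'. \<Xi> \<omega>' + \<beta>) (\<tau> \<omega>) \<omega> = Y k \<tau> (\<lambda>\<omega>. \<Xi> \<omega> + \<xi> \<omega>) (\<tau> \<omega>) \<omega>"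
    using U_finite by (intro AE_finite_allI) auto
  then show ?thesis
    using AE_space
  proof eventually_elim
    case (elim \<omega>)
    then show ?case using \<xi>_U[OF elim(2)] by simp
  qed
qed

lemma integrable_after:
  "integrable M (intervention k \<nu> \<Xi> \<tau> \<xi>)"
  by (intro Bochner_Integration.integrable_add Bochner_Integration.integrable_diff
      integrable_stopped[OF Sc2_Y[OF adm_after] \<tau>] integrable_cost_term[OF measurable_pre_sigma[OF \<tau> \<xi>] \<xi>_U \<tau>]
      integrable_tail[OF a] \<tau> adm_stop[OF a])

text \<open>Before \<open>T\<close> the intervention is one candidate in the obstacle, which lies
  below \<open>Y (Suc k)\<close>; at \<open>T\<close> both values vanish and no cost is charged.
  What \<open>K\<close> gains on the way is non-negative.\<close>

lemma intervention_le:
  "(\<integral>\<omega>. intervention k \<nu> \<Xi> \<tau> \<xi> \<omega> \<partial>M)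
    \<le> (\<integral>\<omega>. Y (Suc k) \<nu> \<Xi> (\<nu> \<omega>) \<omega> \<partial>M)"
proof (subst expectation_identity[OF a \<tau> le], assumption, rule integral_mono_AE[OF integrable_after])
  have K: "Sci2_process M T B (pushing (Suc k) \<nu> \<Xi>)"
    using backward_Y[OF a] by (simp add: backward_def)
  show "integrable M (continuation (Suc k) \<nu> \<Xi> \<tau>)"
    by (rule integrable_continuation[OF a \<tau>])
  show "AE \<omega> in M. intervention k \<nu> \<Xi> \<tau> \<xi> \<omega> \<le> continuation (Suc k) \<nu> \<Xi> \<tau> \<omega>"
    using Y_after[of k] obstacle_le[OF a, of k] Y_terminal[OF a, of "Suc k"] Y_terminal[OF adm_after, of k] AE_space
  proof eventually_elim
    case (elim \<omega>)
    have r: "0 \<le> \<nu> \<omega>" "\<nu> \<omega> \<le> \<tau> \<omega>" "\<tau> \<omega> \<le> T"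
      using stop_range[OF adm_stop[OF a] elim(5)] stop_range[OF \<tau> elim(5)] le[OF elim(5)] by auto
    have m: "mono_on {0..T} (\<lambda>t. pushing (Suc k) \<nu> \<Xi> t \<omega>)"
      using K elim(5) by (simp add: Sci2_process_def)
    have "pushing (Suc k) \<nu> \<Xi> (\<nu> \<omega>) \<omega> \<le> pushing (Suc k) \<nu> \<Xi> (\<tau> \<omega>) \<omega>"
      using r by (intro mono_onD[OF m]) auto
    moreover have "Y k \<tau> (\<lambda>\<omega>. \<Xi> \<omega> + \<xi> \<omega>) (\<tau> \<omega>) \<omega> - \<psi> (\<xi> \<omega>) * indicat_real {..<T} (\<tau> \<omega>) \<le> Y (Suc k) \<nu> \<Xi> (\<tau> \<omega>) \<omega>"
    proof (cases "\<tau> \<omega> < T")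
      case True
      have "- \<psi> (\<xi> \<omega>) + Y k \<nu> (\<lambda>\<omega>'. \<Xi> \<omega>' + \<xi> \<omega>) (\<tau> \<omega>) \<omega> \<le> obstacle U \<psi> (Y k) \<nu> \<Xi> (\<tau> \<omega>) \<omega>"
        unfolding obstacle_def using U_finite \<xi>_U[OF elim(5)] by (intro Max_ge) auto
      also have "\<dots> \<le> Y (Suc k) \<nu> \<Xi> (\<tau> \<omega>) \<omega>"
        using elim(2) r by simp
      finally show ?thesis using True elim(1) by simp
    next
      case False
      then have "\<tau> \<omega> = T" using r by simp
      then show ?thesis using elim(3,4) by simp
    qed
    ultimately show ?case by linarith
  qed
qed

end

text \<open>All losses in the inequality vanish at the hitting time of the obstacle with a
  maximizing \<beta>: \<open>K\<close> has not grown, the process equals its obstacle, and the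
  maximum is attained.\<close>

lemma intervention_eq:
  assumes a: "adm \<nu> \<Xi>"
  obtains \<tau> \<xi> where "stop \<tau>" "\<And>\<omega>. \<omega> \<in> space M \<Longrightarrow> \<nu> \<omega> \<le> \<tau> \<omega>"
    "\<xi> \<in> borel_measurable (pre_sigma \<tau>)" "\<And>\<omega>. \<omega> \<in> space M \<Longrightarrow> \<xi> \<omega> \<in> U"
    "(\<integral>\<omega>. intervention k \<nu> \<Xi> \<tau> \<xi> \<omega> \<partial>M)
    = (\<integral>\<omega>. Y (Suc k) \<nu> \<Xi> (\<nu> \<omega>) \<omega> \<partial>M)"
proof -
  define \<tau> where "\<tau> = next_time (Suc k) \<nu> \<Xi> \<nu>"
  have \<nu>: "stop \<nu>" using a by (rule adm_stop)
  have \<tau>: "stop \<tau>" unfolding \<tau>_def by (rule next_time_stop[OF a \<nu>])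
  have le: "\<nu> \<omega> \<le> \<tau> \<omega>" if "\<omega> \<in> space M" for \<omega>
    unfolding \<tau>_def using next_time_range[OF a \<nu> that] by blast
  define f where "f \<beta> \<omega> = - \<psi> \<beta> + Y k \<nu> (\<lambda>\<omega>'. \<Xi> \<omega>' + \<beta>) (\<tau> \<omega>) \<omega>" for \<beta> \<omega>
  have "f \<beta> \<in> borel_measurable (pre_sigma \<tau>)" for \<beta>
    unfolding f_def by (intro borel_measurable_add borel_measurable_const measurable_stopped Y_prog adm_shift a \<tau>)
  then obtain \<xi> where \<xi>: "\<xi> \<in> borel_measurable (pre_sigma \<tau>)"
    and best: "\<And>\<omega>. \<omega> \<in> space M \<Longrightarrow> \<xi> \<omega> \<in> U \<and> f (\<xi> \<omega>) \<omega> = Max ((\<lambda>\<beta>. f \<beta> \<omega>) ` U)"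
    using measurable_argmax[OF U_finite U_nonempty, of f "pre_sigma \<tau>"] by (auto simp: space_pre_sigma)
  have \<xi>_U: "\<xi> \<omega> \<in> U" if "\<omega> \<in> space M" for \<omega> using best[OF that] by blast
  have after: "adm \<tau> (\<lambda>\<omega>. \<Xi> \<omega> + \<xi> \<omega>)"
    by (rule adm_after[OF a \<tau> le \<xi> \<xi>_U])
  have agree: "AE \<omega> in M. Y k \<nu> (\<lambda>\<omega>'. \<Xi> \<omega>' + \<xi> \<omega>) (\<tau> \<omega>) \<omega> = Y k \<tau> (\<lambda>\<omega>. \<Xi> \<omega> + \<xi> \<omega>) (\<tau> \<omega>) \<omega>"
    by (rule Y_after[OF a \<tau> le \<xi> \<xi>_U])
  have "(\<integral>\<omega>. intervention k \<nu> \<Xi> \<tau> \<xi> \<omega> \<partial>M)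
    = (\<integral>\<omega>. Y (Suc k) \<nu> \<Xi> (\<nu> \<omega>) \<omega> \<partial>M)"
  proof (subst expectation_identity[OF a \<tau> le], assumption, rule integral_cong_AE)
    show "intervention k \<nu> \<Xi> \<tau> \<xi> \<in> borel_measurable M"
      by (rule borel_measurable_integrable, rule integrable_after[OF a \<tau> le \<xi> \<xi>_U])
    show "continuation (Suc k) \<nu> \<Xi> \<tau> \<in> borel_measurable M"
      by (rule borel_measurable_integrable[OF integrable_continuation[OF a \<tau>]])
    show "AE \<omega> in M. intervention k \<nu> \<Xi> \<tau> \<xi> \<omega> = continuation (Suc k) \<nu> \<Xi> \<tau> \<omega>"
      using agree at_next_time[OF a \<nu>, of k] pushing_flat[OF a \<nu>, of "Suc k"]
        Y_terminal[OF a, of "Suc k"] Y_terminal[OF after, of k] AE_space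
    proof eventually_elim
      case (elim \<omega>)
      have "Y k \<tau> (\<lambda>\<omega>. \<Xi> \<omega> + \<xi> \<omega>) (\<tau> \<omega>) \<omega> - \<psi> (\<xi> \<omega>) * indicat_real {..<T} (\<tau> \<omega>) = Y (Suc k) \<nu> \<Xi> (\<tau> \<omega>) \<omega>"
      proof (cases "\<tau> \<omega> < T")
        case True
        then have "Y (Suc k) \<nu> \<Xi> (\<tau> \<omega>) \<omega> = f (\<xi> \<omega>) \<omega>"
          using elim(2) best[OF elim(6)] by (simp add: \<tau>_def[symmetric] obstacle_def f_def)
        then show ?thesis using True elim(1) by (simp add: f_def)
      next
        \<comment> \<open>When the obstacle is not met before \<open>T\<close>, the chosen \<xi> has
          no effect on the value, since \<open>Y\<close> is 0 there for every level and the cost is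
          waived.\<close>
        case False
        then have "\<tau> \<omega> = T" using stop_range[OF \<tau> elim(6)] by simp
        then show ?thesis using elim(4,5) by simp
      qed
      moreover have "pushing (Suc k) \<nu> \<Xi> (\<tau> \<omega>) \<omega> = pushing (Suc k) \<nu> \<Xi> (\<nu> \<omega>) \<omega>"
        using elim(3) by (simp add: \<tau>_def)
      ultimately show ?case by simp
    qed
  qed
  with \<tau> le \<xi> \<xi>_U show ?thesis by (rule that)
qed

lemma payoff_0:
  assumes a: "adm \<nu> \<Xi>"
  shows "payoff 0 \<nu> \<Xi> \<tau> \<xi> = (\<integral>\<omega>. Y 0 \<nu> \<Xi> (\<nu> \<omega>) \<omega> \<partial>M)"
proof -
  have T: "stop (\<lambda>_. T)" using T_pos by (intro stop_const) simp
  have "(\<integral>\<omega>. Y 0 \<nu> \<Xi> (\<nu> \<omega>) \<omega> \<partial>M)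
    = (\<integral>\<omega>. Y 0 \<nu> \<Xi> T \<omega> + (pushing 0 \<nu> \<Xi> T \<omega> - pushing 0 \<nu> \<Xi> (\<nu> \<omega>) \<omega>)
        + tail \<nu> \<Xi> \<nu> \<omega> - (LBINT s:{T..T}. driver h L \<nu> \<Xi> s \<omega>) \<partial>M)"
    using stop_range[OF adm_stop[OF a]] by (intro expectation_identity[OF a T]) auto
  also have "\<dots> = (\<integral>\<omega>. Y 0 \<nu> \<Xi> T \<omega> \<partial>M) + (\<integral>\<omega>. tail \<nu> \<Xi> \<nu> \<omega> \<partial>M)"
    using integrable_stopped[OF Sc2_Y[OF a] T] bounded_field_integral_integrable[OF bounded_field_driver[OF a] adm_stop[OF a]]
    by (simp add: pushing_def LBINT_point)
  also have "(\<integral>\<omega>. Y 0 \<nu> \<Xi> T \<omega> \<partial>M) = 0"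
    using Y_terminal[OF a] by (intro integral_eq_zero_AE)
  also have "tail \<nu> \<Xi> \<nu> = (\<lambda>\<omega>. (LBINT s:{\<nu> \<omega>..T}. h s \<omega> (stage 0 \<Xi> \<tau> \<xi> s \<omega>)) - cost 0 \<tau> \<xi> \<omega>)"
    by (intro ext, simp add: cost_def, intro set_lebesgue_integral_cong) (auto simp: driver_def stage_def)
  finally show ?thesis by (simp add: payoff_def)
qed

text \<open>A pathwise identity: the running reward is cut at \<open>\<tau> 0\<close> and the first
  cost is split off. The value at level \<open>k\<close> occurs on both sides, on the right inside
  \<open>intervention\<close>, so that the shortfall of a payoff from its value can be passed from
  \<open>k\<close> to \<open>Suc k\<close>, as an inequality and as an equality.\<close>

lemma payoff_Suc:
  assumes a: "adm \<nu> \<Xi>" and r: "regular \<tau> \<xi>" and le: "\<And>\<omega>. \<omega> \<in> space M \<Longrightarrow> \<nu> \<omega> \<le> \<tau> 0 \<omega>"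
  shows "payoff (Suc k) \<nu> \<Xi> \<tau> \<xi> + (\<integral>\<omega>. Y k (\<tau> 0) (\<lambda>\<omega>. \<Xi> \<omega> + \<xi> 0 \<omega>) (\<tau> 0 \<omega>) \<omega> \<partial>M)
    = payoff k (\<tau> 0) (\<lambda>\<omega>. \<Xi> \<omega> + \<xi> 0 \<omega>) (\<lambda>j. \<tau> (Suc j)) (\<lambda>j. \<xi> (Suc j))
      + (\<integral>\<omega>. intervention k \<nu> \<Xi> (\<tau> 0) (\<xi> 0) \<omega> \<partial>M)"
    (is "_ + (\<integral>\<omega>. ?Y \<omega> \<partial>M) = payoff k ?\<nu>' ?\<Xi>' ?\<tau>' ?\<xi>' + (\<integral>\<omega>. ?I \<omega> \<partial>M)")
proof -
  have r0: "stop (\<tau> 0)" "\<xi> 0 \<in> borel_measurable (pre_sigma (\<tau> 0))"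
    using r by (auto simp: regular_def)
  have a': "adm ?\<nu>' ?\<Xi>'"
    by (rule adm_after[OF a r0(1) le r0(2) regular_U[OF r]])
  note r' = regular_shift[OF r]
  note int = Bochner_Integration.integrable_diff[OF integrable_running integrable_cost]
  have Y: "integrable M ?Y"
    by (rule integrable_stopped[OF Sc2_Y[OF a'] r0(1)])
  have I: "integrable M ?I"
    by (rule integrable_after[OF a r0(1) le r0(2) regular_U[OF r]])
  have "(LBINT s:{\<nu> \<omega>..T}. h s \<omega> (stage (Suc k) \<Xi> \<tau> \<xi> s \<omega>)) - cost (Suc k) \<tau> \<xi> \<omega> + ?Y \<omega>
    = ((LBINT s:{\<tau> 0 \<omega>..T}. h s \<omega> (stage k ?\<Xi>' ?\<tau>' ?\<xi>' s \<omega>)) - cost k ?\<tau>' ?\<xi>' \<omega>) + ?I \<omega>"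
    if \<omega>: "\<omega> \<in> space M" for \<omega>
  proof -
    have rng: "0 \<le> \<nu> \<omega>" "\<nu> \<omega> \<le> \<tau> 0 \<omega>"
      using stop_range[OF adm_stop[OF a] \<omega>] le[OF \<omega>] by auto
    have i: "integrable lborel (\<lambda>s. indicat_real {\<tau> 0 \<omega>..T} s *\<^sub>R h s \<omega> (stage k ?\<Xi>' ?\<tau>' ?\<xi>' s \<omega>))"
      "integrable lborel (\<lambda>s. indicat_real {\<nu> \<omega>..T} s *\<^sub>R driver h L \<nu> \<Xi> s \<omega>)"
      "integrable lborel (\<lambda>s. indicat_real {\<tau> 0 \<omega>..T} s *\<^sub>R driver h L \<nu> \<Xi> s \<omega>)"
      using bounded_field_path_integrable[OF bounded_field_stage[OF adm_measurable[OF a'] r'] \<omega>, of "\<tau> 0 \<omega>" k]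
        bounded_field_path_integrable[OF bounded_field_driver[OF a] \<omega>, of "\<nu> \<omega>"]
        bounded_field_path_integrable[OF bounded_field_driver[OF a] \<omega>, of "\<tau> 0 \<omega>"] rng
      by (simp_all add: set_integrable_def)
    \<comment> \<open>From \<open>\<tau> 0\<close> on, the first intervention is part of the level
      of the resumed problem; earlier no intervention is active, and the integrand is the driver of
      the original start.\<close>
    have pt: "indicat_real {\<nu> \<omega>..T} s *\<^sub>R h s \<omega> (stage (Suc k) \<Xi> \<tau> \<xi> s \<omega>)
      = indicat_real {\<tau> 0 \<omega>..T} s *\<^sub>R h s \<omega> (stage k ?\<Xi>' ?\<tau>' ?\<xi>' s \<omega>)
        + (indicat_real {\<nu> \<omega>..T} s *\<^sub>R driver h L \<nu> \<Xi> s \<omega> - indicat_real {\<tau> 0 \<omega>..T} s *\<^sub>R driver h L \<nu> \<Xi> s \<omega>)" for s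
    proof (cases "\<tau> 0 \<omega> \<le> s")
      case True
      then have "stage (Suc k) \<Xi> \<tau> \<xi> s \<omega> = stage k ?\<Xi>' ?\<tau>' ?\<xi>' s \<omega>"
        unfolding stage_def by (subst sum.lessThan_Suc_shift) (simp add: algebra_simps)
      moreover have "indicat_real {\<nu> \<omega>..T} s = indicat_real {\<tau> 0 \<omega>..T} s"
        using True rng by (auto simp: indicator_def)
      ultimately show ?thesis by simp
    next
      case False
      then have "indicat_real {\<tau> j \<omega>..} s = 0" for j
        using regular_mono[OF r \<omega>, of j] by (simp add: indicator_def)
      then have "stage (Suc k) \<Xi> \<tau> \<xi> s \<omega> = L s \<omega> + \<Xi> \<omega>"
        by (simp add: stage_def)
      then show ?thesis
        using False by (simp add: driver_def indicator_def)
    qed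
    have "(LBINT s:{\<nu> \<omega>..T}. h s \<omega> (stage (Suc k) \<Xi> \<tau> \<xi> s \<omega>))
      = (LBINT s:{\<tau> 0 \<omega>..T}. h s \<omega> (stage k ?\<Xi>' ?\<tau>' ?\<xi>' s \<omega>))
        + (tail \<nu> \<Xi> \<nu> \<omega> - tail \<nu> \<Xi> (\<tau> 0) \<omega>)"
      unfolding set_lebesgue_integral_def pt
      by (simp only: Bochner_Integration.integral_add[OF i(1) Bochner_Integration.integrable_diff[OF i(2,3)]]
          Bochner_Integration.integral_diff[OF i(2,3)])
    moreover have "cost (Suc k) \<tau> \<xi> \<omega> = \<psi> (\<xi> 0 \<omega>) * indicat_real {..<T} (\<tau> 0 \<omega>) + cost k ?\<tau>' ?\<xi>' \<omega>"
      unfolding cost_def by (rule sum.lessThan_Suc_shift)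
    ultimately show ?thesis by simp
  qed
  then show ?thesis
    unfolding payoff_def
      Bochner_Integration.integral_add[OF int[OF a r r] Y, symmetric]
      Bochner_Integration.integral_add[OF int[OF a' r' r'] I, symmetric]
    by (intro Bochner_Integration.integral_cong refl)
qed

lemma payoff_le:
  assumes "adm \<nu> \<Xi>" "regular \<tau> \<xi>" "\<And>\<omega>. \<omega> \<in> space M \<Longrightarrow> \<nu> \<omega> \<le> \<tau> 0 \<omega>"
  shows "payoff k \<nu> \<Xi> \<tau> \<xi> \<le> (\<integral>\<omega>. Y k \<nu> \<Xi> (\<nu> \<omega>) \<omega> \<partial>M)"
  using assms
proof (induction k arbitrary: \<nu> \<Xi> \<tau> \<xi>)
  case 0 then show ?case by (simp add: payoff_0)
next
  case (Suc k)
  note a = Suc.prems(1) and r = Suc.prems(2) and le = Suc.prems(3)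
  have r0: "stop (\<tau> 0)" "\<xi> 0 \<in> borel_measurable (pre_sigma (\<tau> 0))"
    using r by (auto simp: regular_def)
  have after: "adm (\<tau> 0) (\<lambda>\<omega>. \<Xi> \<omega> + \<xi> 0 \<omega>)"
    by (rule adm_after[OF a r0(1) le r0(2) regular_U[OF r]])
  have "payoff k (\<tau> 0) (\<lambda>\<omega>. \<Xi> \<omega> + \<xi> 0 \<omega>) (\<lambda>j. \<tau> (Suc j)) (\<lambda>j. \<xi> (Suc j))
      \<le> (\<integral>\<omega>. Y k (\<tau> 0) (\<lambda>\<omega>. \<Xi> \<omega> + \<xi> 0 \<omega>) (\<tau> 0 \<omega>) \<omega> \<partial>M)"
    using r by (intro Suc.IH after regular_shift) (simp_all add: regular_def)
  moreover have "(\<integral>\<omega>. intervention k \<nu> \<Xi> (\<tau> 0) (\<xi> 0) \<omega> \<partial>M) \<le> (\<integral>\<omega>. Y (Suc k) \<nu> \<Xi> (\<nu> \<omega>) \<omega> \<partial>M)"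
    by (rule intervention_le[OF a r0(1) le r0(2) regular_U[OF r]])
  ultimately show ?case
    using payoff_Suc[OF a r, of k] le by simp
qed

text \<open>Optimal first interventions are prepended one by one. The times from index
  \<open>k\<close> on equal \<open>T\<close> on every path, so the strategy found is one with at
  most \<open>k\<close> effective interventions.\<close>

lemma payoff_attained:
  assumes "adm \<nu> \<Xi>"
  shows "\<exists>\<tau> \<xi>. regular \<tau> \<xi> \<and> (\<forall>\<omega>\<in>space M. \<nu> \<omega> \<le> \<tau> 0 \<omega>) \<and> (\<forall>j\<ge>k. \<forall>\<omega>. \<tau> j \<omega> = T) \<and>
    payoff k \<nu> \<Xi> \<tau> \<xi> = (\<integral>\<omega>. Y k \<nu> \<Xi> (\<nu> \<omega>) \<omega> \<partial>M)"
  using assms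
proof (induction k arbitrary: \<nu> \<Xi>)
  case 0
  \<comment> \<open>A strategy needs a value in \<open>U\<close> even when it never acts; times
    constantly equal to \<open>T\<close> make it free of charge.\<close>
  obtain \<beta> where "\<beta> \<in> U" using U_nonempty by blast
  then have "regular (\<lambda>_ _. T) (\<lambda>_ _. \<beta>)"
    using T_pos by (simp add: regular_def stop_const)
  then show ?case
    using payoff_0[OF 0] stop_range[OF adm_stop[OF 0]] by (intro exI[of _ "\<lambda>_ _. T"] exI[of _ "\<lambda>_ _. \<beta>"]) simp
next
  case (Suc k)
  note a = Suc.prems
  obtain \<tau>\<^sub>0 \<xi>\<^sub>0 where c: "stop \<tau>\<^sub>0" "\<And>\<omega>. \<omega> \<in> space M \<Longrightarrow> \<nu> \<omega> \<le> \<tau>\<^sub>0 \<omega>"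
    "\<xi>\<^sub>0 \<in> borel_measurable (pre_sigma \<tau>\<^sub>0)" "\<And>\<omega>. \<omega> \<in> space M \<Longrightarrow> \<xi>\<^sub>0 \<omega> \<in> U"
    and opt: "(\<integral>\<omega>. intervention k \<nu> \<Xi> \<tau>\<^sub>0 \<xi>\<^sub>0 \<omega> \<partial>M)
    = (\<integral>\<omega>. Y (Suc k) \<nu> \<Xi> (\<nu> \<omega>) \<omega> \<partial>M)"
    by (rule intervention_eq[OF a, of k]) (rule that)
  have a': "adm \<tau>\<^sub>0 (\<lambda>\<omega>. \<Xi> \<omega> + \<xi>\<^sub>0 \<omega>)"
    by (rule adm_after[OF a c])
  obtain \<tau>' \<xi>' where r': "regular \<tau>' \<xi>'" "\<forall>\<omega>\<in>space M. \<tau>\<^sub>0 \<omega> \<le> \<tau>' 0 \<omega>" "\<forall>j\<ge>k. \<forall>\<omega>. \<tau>' j \<omega> = T"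
    and p': "payoff k \<tau>\<^sub>0 (\<lambda>\<omega>. \<Xi> \<omega> + \<xi>\<^sub>0 \<omega>) \<tau>' \<xi>' = (\<integral>\<omega>. Y k \<tau>\<^sub>0 (\<lambda>\<omega>. \<Xi> \<omega> + \<xi>\<^sub>0 \<omega>) (\<tau>\<^sub>0 \<omega>) \<omega> \<partial>M)"
    using Suc.IH[OF a'] by blast
  define \<tau> where "\<tau> = case_nat \<tau>\<^sub>0 \<tau>'"
  define \<xi> where "\<xi> = case_nat \<xi>\<^sub>0 \<xi>'"
  have simps: "\<tau> 0 = \<tau>\<^sub>0" "\<xi> 0 = \<xi>\<^sub>0" "(\<lambda>j. \<tau> (Suc j)) = \<tau>'" "(\<lambda>j. \<xi> (Suc j)) = \<xi>'"
    by (simp_all add: \<tau>_def \<xi>_def)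
  have r: "regular \<tau> \<xi>"
    unfolding regular_def
  proof
    fix j
    show "stop (\<tau> j) \<and> \<xi> j \<in> borel_measurable (pre_sigma (\<tau> j)) \<and> (\<forall>\<omega>\<in>space M. \<xi> j \<omega> \<in> U \<and> \<tau> j \<omega> \<le> \<tau> (Suc j) \<omega>)"
      using c r' by (cases j) (simp_all add: \<tau>_def \<xi>_def regular_def)
  qed
  have "payoff (Suc k) \<nu> \<Xi> \<tau> \<xi> = (\<integral>\<omega>. Y (Suc k) \<nu> \<Xi> (\<nu> \<omega>) \<omega> \<partial>M)"
    using payoff_Suc[OF a r, of k] c(2) opt by (simp add: simps p')
  moreover have "\<forall>j\<ge>Suc k. \<forall>\<omega>. \<tau> j \<omega> = T"
    using r'(3) by (auto simp: \<tau>_def split: nat.split)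
  ultimately show ?case
    using r c(2) simps(1) by (intro exI[of _ \<tau>] exI[of _ \<xi>]) simp
qed

section \<open>The value at time 0 and the rewards of arbitrary strategies\<close>

lemma adm_0: "adm (\<lambda>_. 0) (\<lambda>_. 0)"
  using T_pos by (auto simp: adm_iff intro: stop_const)

abbreviation payoff0 :: "nat \<Rightarrow> (nat \<Rightarrow> 'a \<Rightarrow> real) \<Rightarrow> (nat \<Rightarrow> 'a \<Rightarrow> real ^ 'l) \<Rightarrow> real" where
  "payoff0 n \<tau> \<xi> \<equiv> payoff n (\<lambda>_. 0) (\<lambda>_. 0) \<tau> \<xi>"

abbreviation value0 :: "nat \<Rightarrow> real" where
  "value0 n \<equiv> expectation (\<lambda>\<omega>. Y n (\<lambda>_. 0) (\<lambda>_. 0) 0 \<omega>)"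

text \<open>The induction produces expectations; triviality of \<open>F 0\<close> turns them into
  the values of \<open>Y\<close> at time 0 on almost every path.\<close>

lemma Y_initial: "AE \<omega> in M. Y n (\<lambda>_. 0) (\<lambda>_. 0) 0 \<omega> = value0 n"
proof (rule F_0_measurable_const)
  have 0: "(0::real) \<in> {0..T}" using T_pos by simp
  show "Y n (\<lambda>_. 0) (\<lambda>_. 0) 0 \<in> borel_measurable (F 0)"
    by (rule measurable_prog[OF Y_prog[OF adm_0] 0])
  show "integrable M (Y n (\<lambda>_. 0) (\<lambda>_. 0) 0)"
    by (rule integrable_stopped[OF Sc2_Y[OF adm_0] stop_const[OF 0]])
qed

lemma \<psi>_nonneg: "\<beta> \<in> U \<Longrightarrow> 0 \<le> \<psi> \<beta>"
  using \<psi>_ge c_pos by fastforce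

lemma running_bounds:
  assumes "\<omega> \<in> space M"
  shows "0 \<le> (LBINT s:{0..T}. h s \<omega> (X s))" and "(LBINT s:{0..T}. h s \<omega> (X s)) \<le> \<gamma> * T"
  using LBINT_bounds[of T "\<lambda>s. h s \<omega> (X s)" \<gamma> 0] h_bounds[OF _ assms] T_pos by auto

lemma cost_nonneg: "regular \<tau> \<xi> \<Longrightarrow> \<omega> \<in> space M \<Longrightarrow> 0 \<le> cost n \<tau> \<xi> \<omega>"
  unfolding cost_def by (intro sum_nonneg mult_nonneg_nonneg \<psi>_nonneg regular_U) auto

abbreviation running :: "nat \<Rightarrow> (nat \<Rightarrow> 'a \<Rightarrow> real) \<Rightarrow> (nat \<Rightarrow> 'a \<Rightarrow> real ^ 'l) \<Rightarrow> 'a \<Rightarrow> real" where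
  "running n \<tau> \<xi> \<omega> \<equiv> LBINT s:{0..T}. h s \<omega> (stage n (\<lambda>_. 0) \<tau> \<xi> s \<omega>)"

abbreviation controlled_running :: "(nat \<Rightarrow> 'a \<Rightarrow> real) \<Rightarrow> (nat \<Rightarrow> 'a \<Rightarrow> real ^ 'l) \<Rightarrow> 'a \<Rightarrow> real" where
  "controlled_running \<tau> \<xi> \<omega> \<equiv> LBINT s:{0..T}. h s \<omega> (controlled L (\<tau>, \<xi>) s \<omega>)"

lemma integrable_payoff:
  "regular \<tau> \<xi> \<Longrightarrow> integrable M (\<lambda>\<omega>. running n \<tau> \<xi> \<omega> - cost n \<tau> \<xi> \<omega>)"
  using integrable_running[OF adm_0] integrable_cost by (intro Bochner_Integration.integrable_diff) auto

lemma controlled_eq_stage: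
  assumes "\<And>j. n \<le> j \<Longrightarrow> s < \<tau> j \<omega>"
  shows "controlled L (\<tau>, \<xi>) s \<omega> = stage n (\<lambda>_. 0) \<tau> \<xi> s \<omega>"
proof -
  have "(\<Sum>j. indicat_real {\<tau> j \<omega>..} s *\<^sub>R \<xi> j \<omega>) = (\<Sum>j<n. indicat_real {\<tau> j \<omega>..} s *\<^sub>R \<xi> j \<omega>)"
  proof (rule suminf_finite)
    fix j assume "j \<notin> {..<n}"
    then have "s < \<tau> j \<omega>" using assms by simp
    then show "indicat_real {\<tau> j \<omega>..} s *\<^sub>R \<xi> j \<omega> = 0" by simp
  qed simp
  then show ?thesis by (simp add: controlled_def stage_def)
qed

text \<open>For times before \<open>T\<close> the series is a finite sum; the single time
  \<open>T\<close>, where all later interventions switch on, does not affect the integral.\<close>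

lemma LBINT_controlled:
  assumes "\<And>j. n \<le> j \<Longrightarrow> T \<le> \<tau> j \<omega>"
  shows "controlled_running \<tau> \<xi> \<omega> = running n \<tau> \<xi> \<omega>"
proof -
  have eq: "h s \<omega> (controlled L (\<tau>, \<xi>) s \<omega>) = h s \<omega> (stage n (\<lambda>_. 0) \<tau> \<xi> s \<omega>)" if "s < T" for s
    using assms that by (subst controlled_eq_stage[where n=n]) (auto intro: less_le_trans)
  show ?thesis
    unfolding set_lebesgue_integral_def using eq
    by (intro lborel_integral_cong_off_point[of T]) (auto simp: indicator_def)
qed

lemma reward_eq_payoff:
  assumes r: "regular \<tau> \<xi>" and T: "\<And>j \<omega>. n \<le> j \<Longrightarrow> \<tau> j \<omega> = T"
  shows "reward M T L h \<psi> (\<tau>, \<xi>) = ereal (payoff0 n \<tau> \<xi>)"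
proof -
  have "(\<Sum>j. ereal (\<psi> (\<xi> j \<omega>) * indicat_real {..<T} (\<tau> j \<omega>))) = ereal (cost n \<tau> \<xi> \<omega>)" for \<omega>
  proof -
    have "(\<Sum>j. ereal (\<psi> (\<xi> j \<omega>) * indicat_real {..<T} (\<tau> j \<omega>)))
        = (\<Sum>j<n. ereal (\<psi> (\<xi> j \<omega>) * indicat_real {..<T} (\<tau> j \<omega>)))"
      using T by (intro suminf_finite) (auto simp: not_less zero_ereal_def)
    then show ?thesis by (simp add: cost_def)
  qed
  then have "reward M T L h \<psi> (\<tau>, \<xi>) = ereal_expectation M (\<lambda>\<omega>.
      ereal (running n \<tau> \<xi> \<omega> - cost n \<tau> \<xi> \<omega>))"
    unfolding reward_def using T by (subst LBINT_controlled[where n=n]) auto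
  then show ?thesis
    unfolding payoff_def by (simp only: ereal_expectation_real[OF integrable_payoff[OF r]])
qed

text \<open>On a null set containing the paths that violate the ordering or the range, all times are
  sent to \<open>T\<close>. Every \<open>F t\<close> contains the null sets, so the new times still
  are stopping times and the \<xi> remain measurable at them.\<close>

lemma strategy_regular:
  assumes "(\<tau>, \<xi>) \<in> strategies M T B U"
  obtains \<tau>' where "regular \<tau>' \<xi>" "AE \<omega> in M. \<forall>j. \<tau>' j \<omega> = \<tau> j \<omega>"
proof -
  have st: "\<And>j. stopping_time F (\<tau> j)"
    and good: "AE \<omega> in M. 0 \<le> \<tau> 0 \<omega> \<and> (\<forall>n. \<tau> n \<omega> \<le> \<tau> (Suc n) \<omega> \<and> \<tau> n \<omega> \<le> T)"
    and \<xi>: "\<And>j. \<xi> j \<in> borel_measurable (pre_sigma (\<tau> j))" "\<And>j \<omega>. \<omega> \<in> space M \<Longrightarrow> \<xi> j \<omega> \<in> U"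
    using assms by (auto simp: strategies_def)
  obtain N where N: "{\<omega> \<in> space M. \<not> (0 \<le> \<tau> 0 \<omega> \<and> (\<forall>n. \<tau> n \<omega> \<le> \<tau> (Suc n) \<omega> \<and> \<tau> n \<omega> \<le> T))} \<subseteq> N" "N \<in> null_sets M"
    by (rule AE_E[OF good]) (rule that, assumption, rule null_setsI)
  have N_F: "N \<inter> A \<in> sets (F t)" if "A \<in> sets M" for A t
    using N(2) that by (intro null_sets_F null_set_Int2)
  \<comment> \<open>The original times are bounded by \<open>T\<close> only almost surely, so an
    event known at such a time is exhausted by its parts on which the time is at most
    \<open>k\<close>.\<close>
  have in_M: "A \<in> sets M" if A: "A \<in> sets (pre_sigma (\<tau> j))" for A j
  proof -
    have "A = (\<Union>k::nat. {\<omega>\<in>A. \<tau> j \<omega> \<le> real k})"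
      using real_arch_simple by auto
    moreover have "(\<Union>k::nat. {\<omega>\<in>A. \<tau> j \<omega> \<le> real k}) \<in> sets M"
      by (intro sets.countable_UN' countableI_type image_subsetI in_sets_F[OF sets_pre_sigmaD[OF st A]])
    ultimately show ?thesis by (simp only:)
  qed
  define \<tau>' where "\<tau>' j \<omega> = (if \<omega> \<in> N then T else \<tau> j \<omega>)" for j \<omega>
  have ok: "0 \<le> \<tau> j \<omega> \<and> \<tau> j \<omega> \<le> \<tau> (Suc j) \<omega> \<and> \<tau> j \<omega> \<le> T" if "\<omega> \<in> space M" "\<omega> \<notin> N" for j \<omega>
  proof -
    have *: "0 \<le> \<tau> 0 \<omega>" "\<And>n. \<tau> n \<omega> \<le> \<tau> (Suc n) \<omega>" "\<And>n. \<tau> n \<omega> \<le> T"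
      using N(1) that by auto
    have "0 \<le> \<tau> j \<omega>" by (induction j) (auto intro: order_trans *)
    then show ?thesis using * by blast
  qed
  \<comment> \<open>Serves twice: with the whole space it gives the stopping property, with
    preimages under \<xi> it gives measurability at the new times.\<close>
  have piece: "{\<omega>\<in>A. \<tau>' j \<omega> \<le> t} \<in> sets (F t)"
    if A: "A \<in> sets (pre_sigma (\<tau> j))" for A j t
  proof -
    have "{\<omega>\<in>A. \<tau> j \<omega> \<le> t} - N \<in> sets (F t)"
      by (rule sets.Diff[OF sets_pre_sigmaD[OF st A] null_sets_F[OF N(2)]])
    moreover have "(if T \<le> t then N \<inter> A else {}) \<in> sets (F t)"
      using N_F[OF in_M[OF A]] by simp
    ultimately have "({\<omega>\<in>A. \<tau> j \<omega> \<le> t} - N) \<union> (if T \<le> t then N \<inter> A else {}) \<in> sets (F t)"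
      by (rule sets.Un)
    also have "({\<omega>\<in>A. \<tau> j \<omega> \<le> t} - N) \<union> (if T \<le> t then N \<inter> A else {}) = {\<omega>\<in>A. \<tau>' j \<omega> \<le> t}"
      by (auto simp: \<tau>'_def)
    finally show ?thesis .
  qed
  have stop: "stop (\<tau>' j)" for j
    unfolding stop_def stopping_time_def pred_def space_F
  proof (intro conjI allI ballI)
    show "{\<omega> \<in> space M. \<tau>' j \<omega> \<le> t} \<in> sets (F t)" for t
      using piece[OF sets.top[of "pre_sigma (\<tau> j)"]] by (simp add: space_pre_sigma)
    show "\<tau>' j \<omega> \<in> {0..T}" if "\<omega> \<in> space M" for \<omega>
      using ok[OF that] T_pos by (simp add: \<tau>'_def)
  qed
  have "\<xi> j \<in> borel_measurable (pre_sigma (\<tau>' j))" for j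
  proof (rule measurableI)
    fix S :: "(real^'l) set" assume S: "S \<in> sets borel"
    have A: "\<xi> j -` S \<inter> space M \<in> sets (pre_sigma (\<tau> j))"
      using measurable_sets[OF \<xi>(1) S] by (simp add: space_pre_sigma)
    show "\<xi> j -` S \<inter> space (pre_sigma (\<tau>' j)) \<in> sets (pre_sigma (\<tau>' j))"
      unfolding space_pre_sigma using piece[OF A] by (intro pre_sigmaI[OF stop]) auto
  qed simp
  then have "regular \<tau>' \<xi>"
    unfolding regular_def using stop \<xi>(2) ok by (simp add: \<tau>'_def)
  moreover have "AE \<omega> in M. \<forall>j. \<tau>' j \<omega> = \<tau> j \<omega>"
    using AE_not_in[OF N(2)] by eventually_elim (simp add: \<tau>'_def)
  ultimately show ?thesis by (rule that)
qed

text \<open>A bound path by path: the cost series dominates its partial sum, and the running rewards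
  can differ only where the intervention with index \<open>n\<close> still happens before
  \<open>T\<close>. The right-hand side is integrable, so monotonicity of the expectation
  suffices.\<close>

lemma reward_le:
  assumes r: "regular \<tau>' \<xi>" and ae: "AE \<omega> in M. \<forall>j. \<tau>' j \<omega> = \<tau> j \<omega>"
  shows "reward M T L h \<psi> (\<tau>, \<xi>) \<le> ereal (payoff0 n \<tau>' \<xi> + \<gamma> * T * prob {\<omega>\<in>space M. \<tau>' n \<omega> < T})"
proof -
  let ?A = "{\<omega>\<in>space M. \<tau>' n \<omega> < T}"
  let ?R = "\<lambda>\<omega>. running n \<tau>' \<xi> \<omega> - cost n \<tau>' \<xi> \<omega>"
  have A: "?A \<in> sets M"
    using stop_measurable[OF regular_stop[OF r, of n]] by measurable
  have int: "integrable M (\<lambda>\<omega>. \<gamma> * T * indicat_real ?A \<omega>)"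
    using A by (intro integrable_mult_right integrable_real_indicator) (auto simp: emeasure_eq_measure)
  have "reward M T L h \<psi> (\<tau>, \<xi>) \<le> ereal_expectation M (\<lambda>\<omega>. ereal (?R \<omega> + \<gamma> * T * indicat_real ?A \<omega>))"
    unfolding reward_def
  proof (rule ereal_expectation_mono)
    show "AE \<omega> in M. ereal (controlled_running \<tau> \<xi> \<omega>)
        - (\<Sum>n. ereal (\<psi> (snd (\<tau>, \<xi>) n \<omega>) * indicat_real {..<T} (fst (\<tau>, \<xi>) n \<omega>)))
      \<le> ereal (?R \<omega> + \<gamma> * T * indicat_real ?A \<omega>)"
      using ae AE_space
    proof eventually_elim
      case (elim \<omega>)
      have "ereal (cost n \<tau>' \<xi> \<omega>) = (\<Sum>j<n. ereal (\<psi> (\<xi> j \<omega>) * indicat_real {..<T} (\<tau> j \<omega>)))"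
        using elim(1) by (simp add: cost_def)
      also have "\<dots> \<le> (\<Sum>j. ereal (\<psi> (\<xi> j \<omega>) * indicat_real {..<T} (\<tau> j \<omega>)))"
        using \<psi>_nonneg[OF regular_U[OF r elim(2)]] by (intro sum_le_suminf) (auto simp: summable_ereal_pos)
      finally have cost: "ereal (cost n \<tau>' \<xi> \<omega>) \<le> (\<Sum>j. ereal (\<psi> (\<xi> j \<omega>) * indicat_real {..<T} (\<tau> j \<omega>)))" .
      \<comment> \<open>Where \<open>\<tau>' n\<close> is before \<open>T\<close>, the two running
        rewards are compared only through their common range from 0 to \<gamma> T.\<close>
      have run: "controlled_running \<tau> \<xi> \<omega>
        \<le> running n \<tau>' \<xi> \<omega> + \<gamma> * T * indicat_real ?A \<omega>"
      proof (cases "\<tau>' n \<omega> < T")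
        case True
        then show ?thesis
          using running_bounds[OF elim(2), of "\<lambda>s. controlled L (\<tau>, \<xi>) s \<omega>"]
            running_bounds[OF elim(2), of "\<lambda>s. stage n (\<lambda>_. 0) \<tau>' \<xi> s \<omega>"] elim(2) by simp
      next
        case False
        have "T \<le> \<tau> j \<omega>" if "n \<le> j" for j
        proof -
          have "\<tau>' n \<omega> \<le> \<tau>' j \<omega>"
            using that
          proof (induction rule: dec_induct)
            case (step m)
            then show ?case using r elim(2) by (auto simp: regular_def intro: order_trans)
          qed simp
          then show ?thesis using False elim(1) by simp
        qed
        then have "controlled_running \<tau> \<xi> \<omega> = running n \<tau> \<xi> \<omega>"
          by (rule LBINT_controlled)
        also have "running n \<tau> \<xi> \<omega> = running n \<tau>' \<xi> \<omega>"
          using elim(1) by (simp add: stage_def)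
        finally show ?thesis using False by simp
      qed
      have "ereal (controlled_running \<tau> \<xi> \<omega>)
        - (\<Sum>n. ereal (\<psi> (\<xi> n \<omega>) * indicat_real {..<T} (\<tau> n \<omega>)))
        \<le> ereal (running n \<tau>' \<xi> \<omega> + \<gamma> * T * indicat_real ?A \<omega>) - ereal (cost n \<tau>' \<xi> \<omega>)"
        using cost run by (intro ereal_minus_mono) auto
      then show ?case by (simp add: algebra_simps)
    qed
  qed
  also have "\<dots> = ereal (\<integral>\<omega>. ?R \<omega> + \<gamma> * T * indicat_real ?A \<omega> \<partial>M)"
    by (rule ereal_expectation_real[OF Bochner_Integration.integrable_add[OF integrable_payoff[OF r] int]])
  also have "(\<integral>\<omega>. ?R \<omega> + \<gamma> * T * indicat_real ?A \<omega> \<partial>M) = payoff0 n \<tau>' \<xi> + \<gamma> * T * prob ?A"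
    unfolding Bochner_Integration.integral_add[OF integrable_payoff[OF r] int]
    using A by (simp add: payoff_def)
  finally show ?thesis .
qed

lemma payoff0_le_value0: "regular \<tau> \<xi> \<Longrightarrow> payoff0 n \<tau> \<xi> \<le> value0 n"
  using stop_range[OF regular_stop] by (intro payoff_le adm_0) auto

text \<open>On paths with infinitely many interventions before \<open>T\<close>, the first
  \<open>n\<close> alone cost at least c n. If such paths have positive probability, the truncated
  payoffs tend to -\<infinity>.\<close>

lemma payoff0_le_cost:
  assumes r: "regular \<tau> \<xi>"
  shows "payoff0 n \<tau> \<xi> \<le> \<gamma> * T - c * n * prob {\<omega>\<in>space M. \<forall>j. \<tau> j \<omega> < T}"
proof -
  let ?A = "{\<omega>\<in>space M. \<forall>j. \<tau> j \<omega> < T}"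
  have A: "?A \<in> sets M"
  proof -
    have [measurable]: "\<tau> j \<in> borel_measurable M" for j using stop_measurable[OF regular_stop[OF r]] .
    show ?thesis by measurable
  qed
  have "payoff0 n \<tau> \<xi> \<le> (\<integral>\<omega>. \<gamma> * T - c * n * indicat_real ?A \<omega> \<partial>M)"
    unfolding payoff_def
  proof (rule integral_mono[OF integrable_payoff[OF r]])
    show "integrable M (\<lambda>\<omega>. \<gamma> * T - c * n * indicat_real ?A \<omega>)"
      using A by (intro Bochner_Integration.integrable_diff integrable_mult_right integrable_real_indicator)
        (auto simp: emeasure_eq_measure)
    fix \<omega> assume \<omega>: "\<omega> \<in> space M"
    have "c * n * indicat_real ?A \<omega> \<le> cost n \<tau> \<xi> \<omega>"
    proof (cases "\<omega> \<in> ?A")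
      case True
      have "(\<Sum>j<n. c) \<le> (\<Sum>j<n. \<psi> (\<xi> j \<omega>))"
        using \<psi>_ge[OF regular_U[OF r \<omega>]] by (intro sum_mono)
      then show ?thesis using True by (simp add: cost_def mult.commute)
    next
      case False
      then have "indicat_real ?A \<omega> = 0" by (rule indicator_simps(2))
      then show ?thesis using cost_nonneg[OF r \<omega>, of n] by simp
    qed
    then show "running n \<tau> \<xi> \<omega> - cost n \<tau> \<xi> \<omega> \<le> \<gamma> * T - c * n * indicat_real ?A \<omega>"
      using running_bounds(2)[OF \<omega>, of "\<lambda>s. stage n (\<lambda>_. 0) \<tau> \<xi> s \<omega>"] by linarith
  qed
  also have "\<dots> = \<gamma> * T - c * n * prob ?A"
    using A by (subst Bochner_Integration.integral_diff) (auto simp: emeasure_eq_measure prob_space intro!: integrable_mult_right integrable_real_indicator)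
  finally show ?thesis .
qed

lemma optimal_strategy:
  "\<exists>\<delta>\<in>bounded_strategies M T B U n. reward M T L h \<psi> \<delta> = ereal (value0 n)"
proof -
  obtain \<tau> \<xi> where r: "regular \<tau> \<xi>" and T: "\<forall>j\<ge>n. \<forall>\<omega>. \<tau> j \<omega> = T" and p: "payoff0 n \<tau> \<xi> = value0 n"
    using payoff_attained[OF adm_0, of n] by blast
  have "(\<tau>, \<xi>) \<in> strategies M T B U"
    using r stop_range[OF regular_stop[OF r]] unfolding strategies_def by (auto simp: regular_def stop_def)
  moreover have "{\<omega> \<in> space M. \<forall>j. \<tau> j \<omega> < T} = {}"
    using T by (metis (no_types, lifting) Collect_empty_eq less_irrefl order_refl)
  then have "prob {\<omega> \<in> space M. \<forall>j. \<tau> j \<omega> < T} = 0"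
    by (simp only: measure_empty)
  ultimately have "(\<tau>, \<xi>) \<in> bounded_strategies M T B U n"
    using T by (simp add: bounded_strategies_def finite_strategies_def)
  moreover have "reward M T L h \<psi> (\<tau>, \<xi>) = ereal (value0 n)"
    using reward_eq_payoff[OF r, of n] T p by simp
  ultimately show ?thesis by blast
qed

lemma bounded_subset_strategies: "bounded_strategies M T B U n \<subseteq> strategies M T B U"
  by (auto simp: bounded_strategies_def finite_strategies_def)

lemma bounded_strategies_mono: "bounded_strategies M T B U n \<subseteq> bounded_strategies M T B U (Suc n)"
proof
  fix \<delta> assume d: "\<delta> \<in> bounded_strategies M T B U n"
  obtain \<tau> \<xi> where \<delta>: "\<delta> = (\<tau>, \<xi>)" by (cases \<delta>)
  have "AE \<omega> in M. \<tau> n \<omega> = T" "AE \<omega> in M. 0 \<le> \<tau> 0 \<omega> \<and> (\<forall>n. \<tau> n \<omega> \<le> \<tau> (Suc n) \<omega> \<and> \<tau> n \<omega> \<le> T)"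
    using d by (auto simp: \<delta> bounded_strategies_def finite_strategies_def strategies_def)
  then have "AE \<omega> in M. \<tau> (Suc n) \<omega> = T"
    by eventually_elim (metis order_antisym)
  then show "\<delta> \<in> bounded_strategies M T B U (Suc n)"
    using d by (simp add: \<delta> bounded_strategies_def)
qed

text \<open>Indices start at 0, so \<tau>_n = T almost surely leaves exactly the interventions 0,
  ..., n - 1. These are the \<open>n\<close> interventions counted by \<open>Y n\<close>, and
  truncation at \<open>n\<close> loses nothing, the exceptional event being null.\<close>

lemma SUP_bounded_strategies:
  "(SUP \<delta>\<in>bounded_strategies M T B U n. reward M T L h \<psi> \<delta>) = ereal (value0 n)"
proof (rule antisym)
  show "(SUP \<delta>\<in>bounded_strategies M T B U n. reward M T L h \<psi> \<delta>) \<le> ereal (value0 n)"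
  proof (rule SUP_least)
    fix \<delta> assume d: "\<delta> \<in> bounded_strategies M T B U n"
    obtain \<tau> \<xi> where \<delta>: "\<delta> = (\<tau>, \<xi>)" by (cases \<delta>)
    have "(\<tau>, \<xi>) \<in> strategies M T B U" and \<tau>_n: "AE \<omega> in M. \<tau> n \<omega> = T"
      using d bounded_subset_strategies by (auto simp: \<delta> bounded_strategies_def)
    then obtain \<tau>' where r: "regular \<tau>' \<xi>" and ae: "AE \<omega> in M. \<forall>j. \<tau>' j \<omega> = \<tau> j \<omega>"
      using strategy_regular by blast
    have "AE \<omega> in M. \<not> \<tau>' n \<omega> < T"
      using \<tau>_n ae by eventually_elim simp
    moreover have "{\<omega>\<in>space M. \<tau>' n \<omega> < T} \<in> sets M"
      using stop_measurable[OF regular_stop[OF r, of n]] by measurable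
    ultimately have "prob {\<omega>\<in>space M. \<tau>' n \<omega> < T} = 0"
      by (subst prob_eq_0) (auto elim: eventually_mono)
    then show "reward M T L h \<psi> \<delta> \<le> ereal (value0 n)"
      using reward_le[OF r ae, of n] payoff0_le_value0[OF r, of n] by (auto simp: \<delta> intro: order_trans)
  qed
  show "ereal (value0 n) \<le> (SUP \<delta>\<in>bounded_strategies M T B U n. reward M T L h \<psi> \<delta>)"
    using optimal_strategy[of n] by (metis SUP_upper)
qed

text \<open>Monotonicity in \<open>n\<close> is read off from the control problem: the strategy
  classes increase.\<close>

lemma value0_mono: "incseq value0"
proof (rule incseq_SucI)
  fix n
  have "ereal (value0 n) \<le> ereal (value0 (Suc n))"
    unfolding SUP_bounded_strategies[symmetric] by (rule SUP_subset_mono[OF bounded_strategies_mono order_refl])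
  then show "value0 n \<le> value0 (Suc n)" by simp
qed

lemma value0_le: "value0 n \<le> \<gamma> * T"
proof -
  obtain \<tau> \<xi> where r: "regular \<tau> \<xi>" and p: "payoff0 n \<tau> \<xi> = value0 n"
    using payoff_attained[OF adm_0, of n] by blast
  have "0 \<le> c * n * prob {\<omega>\<in>space M. \<forall>j. \<tau> j \<omega> < T}"
    using c_pos by simp
  then show ?thesis using payoff0_le_cost[OF r, of n] p by linarith
qed

lemma SUP_strategies:
  assumes lim: "value0 \<longlonglongrightarrow> v"
  shows "(SUP \<delta>\<in>strategies M T B U. reward M T L h \<psi> \<delta>) = ereal v"
proof (rule antisym)
  show "ereal v \<le> (SUP \<delta>\<in>strategies M T B U. reward M T L h \<psi> \<delta>)"
  proof (rule LIMSEQ_le_const2)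
    show "(\<lambda>n. ereal (value0 n)) \<longlonglongrightarrow> ereal v"
      using lim by simp
    show "\<exists>N. \<forall>n\<ge>N. ereal (value0 n) \<le> (SUP \<delta>\<in>strategies M T B U. reward M T L h \<psi> \<delta>)"
      unfolding SUP_bounded_strategies[symmetric]
      by (intro exI allI impI SUP_subset_mono bounded_subset_strategies order_refl)
  qed
  show "(SUP \<delta>\<in>strategies M T B U. reward M T L h \<psi> \<delta>) \<le> ereal v"
  proof (rule SUP_least)
    fix \<delta> assume d: "\<delta> \<in> strategies M T B U"
    obtain \<tau> \<xi> where \<delta>: "\<delta> = (\<tau>, \<xi>)" by (cases \<delta>)
    obtain \<tau>' where r: "regular \<tau>' \<xi>" and ae: "AE \<omega> in M. \<forall>j. \<tau>' j \<omega> = \<tau> j \<omega>"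
      using d strategy_regular unfolding \<delta> by blast
    define A where "A n = {\<omega>\<in>space M. \<tau>' n \<omega> < T}" for n
    have A: "A n \<in> sets M" for n
      unfolding A_def using stop_measurable[OF regular_stop[OF r, of n]] by measurable
    have "decseq A"
      using r by (intro decseq_SucI) (auto simp: A_def regular_def intro: le_less_trans)
    then have "(\<lambda>n. prob (A n)) \<longlonglongrightarrow> prob (\<Inter>n. A n)"
      using A by (intro finite_Lim_measure_decseq) auto
    moreover have I: "(\<Inter>n. A n) = {\<omega>\<in>space M. \<forall>j. \<tau>' j \<omega> < T}"
      by (auto simp: A_def)
    ultimately have pA: "(\<lambda>n. prob (A n)) \<longlonglongrightarrow> prob {\<omega>\<in>space M. \<forall>j. \<tau>' j \<omega> < T}" (is "_ \<longlonglongrightarrow> ?p")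
      by simp
    have le: "reward M T L h \<psi> \<delta> \<le> ereal (payoff0 n \<tau>' \<xi> + \<gamma> * T * prob (A n))" for n
      using reward_le[OF r ae, of n] by (simp add: \<delta> A_def)
    show "reward M T L h \<psi> \<delta> \<le> ereal v"
    proof (cases "?p = 0")
      \<comment> \<open>Almost surely only finitely many interventions are made before
        \<open>T\<close>, so the truncation error tends to 0.\<close>
      case True
      have "(\<lambda>n. value0 n + \<gamma> * T * prob (A n)) \<longlonglongrightarrow> v + \<gamma> * T * 0"
        using pA True by (intro tendsto_intros lim) simp
      then have "(\<lambda>n. ereal (value0 n + \<gamma> * T * prob (A n))) \<longlonglongrightarrow> ereal v" by simp
      moreover have "reward M T L h \<psi> \<delta> \<le> ereal (value0 n + \<gamma> * T * prob (A n))" for n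
        using le[of n] payoff0_le_value0[OF r, of n] by (auto intro: order_trans)
      ultimately show ?thesis by (meson LIMSEQ_le_const)
    next
      case False
      then have p: "0 < c * ?p" using c_pos by (simp add: zero_less_measure_iff)
      \<comment> \<open>The payoff is at most \<gamma> T - c n p and the truncation error at most
        \<gamma> T; this \<open>n\<close> brings their sum below \<open>v\<close>.\<close>
      obtain n :: nat where "2 * \<gamma> * T - v < real n * (c * ?p)"
        using reals_Archimedean3[OF p] by blast
      moreover have "\<gamma> * T * prob (A n) \<le> \<gamma> * T * 1"
        using \<gamma>_nonneg T_pos by (intro mult_left_mono) auto
      ultimately have "payoff0 n \<tau>' \<xi> + \<gamma> * T * prob (A n) \<le> v"
        using payoff0_le_cost[OF r, of n] by (simp add: algebra_simps)
      then show ?thesis using le[of n] by (auto intro: order_trans)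
    qed
  qed
qed

lemma value_convergence:
  "AE \<omega> in M.
     (SUP \<delta>\<in>strategies M T B U. reward M T L h \<psi> \<delta>) = ereal (limit_process Y (\<lambda>_. 0) (\<lambda>_. 0) 0 \<omega>) \<and>
     (\<lambda>n. Y n (\<lambda>_. 0) (\<lambda>_. 0) 0 \<omega>) \<longlonglongrightarrow> limit_process Y (\<lambda>_. 0) (\<lambda>_. 0) 0 \<omega> \<and>
     (\<lambda>n. SUP \<delta>\<in>bounded_strategies M T B U n. reward M T L h \<psi> \<delta>)
       \<longlonglongrightarrow> ereal (limit_process Y (\<lambda>_. 0) (\<lambda>_. 0) 0 \<omega>)"
proof -
  obtain v where v: "value0 \<longlonglongrightarrow> v"
    using incseq_convergent[OF value0_mono] value0_le by metis
  \<comment> \<open>One exceptional set for all \<open>n\<close>, outside of which the path values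
    form the deterministic sequence \<open>value0\<close>.\<close>
  have "AE \<omega> in M. \<forall>n. Y n (\<lambda>_. 0) (\<lambda>_. 0) 0 \<omega> = value0 n"
    using Y_initial by (simp add: AE_all_countable)
  then show ?thesis
  proof eventually_elim
    case (elim \<omega>)
    then have eq: "(\<lambda>n. Y n (\<lambda>_. 0) (\<lambda>_. 0) 0 \<omega>) = value0" by auto
    \<comment> \<open>\<open>limit_process\<close> is defined through \<open>lim\<close>, which
      denotes the limit here because \<open>value0\<close> has been shown to converge.\<close>
    then have l: "limit_process Y (\<lambda>_. 0) (\<lambda>_. 0) 0 \<omega> = v"
      using v by (simp add: limit_process_def limI)
    show ?case
      unfolding l eq SUP_bounded_strategies using SUP_strategies[OF v] v by simp
  qed
qed

end

theorem corollary6p1: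
  fixes M :: "'a measure"
    and T \<gamma> c :: real
    and B :: "real \<Rightarrow> 'a \<Rightarrow> real ^ 'd"
    and L :: "real \<Rightarrow> 'a \<Rightarrow> real ^ 'l"
    and U :: "(real ^ 'l) set"
    and h :: "real \<Rightarrow> 'a \<Rightarrow> real ^ 'l \<Rightarrow> real"
    and \<psi> :: "real ^ 'l \<Rightarrow> real"
    and Y K :: "nat \<Rightarrow> ('a \<Rightarrow> real) \<Rightarrow> ('a \<Rightarrow> real ^ 'l) \<Rightarrow> real \<Rightarrow> 'a \<Rightarrow> real"
    and Z :: "nat \<Rightarrow> ('a \<Rightarrow> real) \<Rightarrow> ('a \<Rightarrow> real ^ 'l) \<Rightarrow> real \<Rightarrow> 'a \<Rightarrow> real ^ 'd"
  assumes "T > 0"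
    and "prob_space M"
    and "standard_brownian_motion M T B"
    and "H2_process M T B L"
    and "finite U" and "U \<noteq> {}"
    and "(\<lambda>((s, \<omega>), x). h s \<omega> x) \<in> borel_measurable (progressive_sigma M T B \<Otimes>\<^sub>M borel)"
    and "\<And>s \<omega> x. s \<in> {0..T} \<Longrightarrow> \<omega> \<in> space M \<Longrightarrow> 0 \<le> h s \<omega> x \<and> h s \<omega> x \<le> \<gamma>"
    and "\<And>\<beta>. \<beta> \<in> U \<Longrightarrow> 0 \<le> \<psi> \<beta>"
    and "c > 0" and "(INF \<beta>\<in>U. \<psi> \<beta>) \<ge> c"
    and "\<And>\<nu> \<xi>. admissible_start M T B \<nu> \<xi> \<Longrightarrow>
           bsde_solution M T B (driver h L \<nu> \<xi>) (Y 0 \<nu> \<xi>) (Z 0 \<nu> \<xi>)"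
    and "\<And>n \<nu> \<xi>. n \<ge> 1 \<Longrightarrow> admissible_start M T B \<nu> \<xi> \<Longrightarrow>
           rbsde_solution M T B (driver h L \<nu> \<xi>) (obstacle U \<psi> (Y (n - 1)) \<nu> \<xi>)
             (Y n \<nu> \<xi>) (Z n \<nu> \<xi>) (K n \<nu> \<xi>)"
  shows "AE \<omega> in M.
           (SUP \<delta>\<in>strategies M T B U. reward M T L h \<psi> \<delta>)
             = ereal (limit_process Y (\<lambda>_. 0) (\<lambda>_. 0) 0 \<omega>) \<and>
           (\<lambda>n. Y n (\<lambda>_. 0) (\<lambda>_. 0) 0 \<omega>) \<longlonglongrightarrow> limit_process Y (\<lambda>_. 0) (\<lambda>_. 0) 0 \<omega> \<and>
           (\<lambda>n. SUP \<delta>\<in>bounded_strategies M T B U n. reward M T L h \<psi> \<delta>)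
             \<longlonglongrightarrow> ereal (limit_process Y (\<lambda>_. 0) (\<lambda>_. 0) 0 \<omega>)"
proof -
  \<comment> \<open>An infimum of reals lies below the members only for sets bounded below;
    finiteness of \<open>U\<close> provides this.\<close>
  have \<psi>_ge: "c \<le> \<psi> \<beta>" if "\<beta> \<in> U" for \<beta>
    using assms(5,11) that by (meson bdd_below_finite cINF_lower finite_imageI order_trans)
  have Suc: "rbsde_solution M T B (driver h L \<nu> \<xi>) (obstacle U \<psi> (Y n) \<nu> \<xi>)
      (Y (Suc n) \<nu> \<xi>) (Z (Suc n) \<nu> \<xi>) (K (Suc n) \<nu> \<xi>)" if "admissible_start M T B \<nu> \<xi>" for n \<nu> \<xi>
    using assms(13)[of "Suc n", OF _ that] by simp
  interpret prob_space M by fact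
  interpret impulse M T B \<gamma> c L U h \<psi> Y K Z
    by unfold_locales (fact assms \<psi>_ge Suc)+
  show ?thesis by (rule value_convergence)
qed

end
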